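(* Let $n\ge 1$ and let $\lambda$ be a partition of $n$. Let $\kappa_1\ge \kappa_2\ge\cdots\ge\kappa_n$ be the multiset of values $i-j$ over the cells $(i,j)$ of the diagram of $\lambda$ ($i$ the column index, $j$ the row index), arranged in non-increasing order, and set $c_i=\kappa_i+i-1$ for $1\le i\le n$, so that $\prod_{(i,j)\in\lambda}(\alpha+i-j)=\prod_{i=1}^n(\alpha+c_i-i+1)$ and $0\le c_1\le\cdots\le c_n\le n$. Then $$\langle \tilde{J}_{(n)}^{(\alpha)}(X),s_\lambda\rangle = \sum_{k=0}^n K_{\lambda,1^n}\, h_k(B(c_1,\ldots,c_n)) \binom{\alpha + k}{n} = \sum_{k=0}^n K_{\lambda,1^n}\, r_{n-k}(B(c_1,\ldots,c_n)) \binom{\alpha}{k}k!.$$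
   Context: Jack polynomials: over $\mathbb{Q}(\alpha)$, with $\alpha$ an indeterminate, let $\langle p_\lambda,p_\nu\rangle_\alpha=\delta_{\lambda\nu}z_\lambda\alpha^{\ell(\lambda)}$, where $z_\lambda=\prod_i i^{m_i}m_i!$ and $m_i$ is the number of parts of $\lambda$ equal to $i$. The integral form Jack symmetric functions $J_\mu^{(\alpha)}(X)$ are the unique family, indexed by partitions $\mu$, of symmetric functions that are pairwise orthogonal for $\langle\cdot,\cdot\rangle_\alpha$, are triangular (only monomial symmetric functions $m_\lambda$ with $\lambda\le\mu$ in dominance order appear in $J_\mu^{(\alpha)}$), and are normalized so that the coefficient of $m_{1^n}$ in $J_\mu^{(\alpha)}$ is $n!$ where $n=|\mu|$. For $\mu$ a partition of $n$, define $\tilde J_\mu^{(\alpha)}(X)=\alpha^nJ_\mu^{(1/\alpha)}(X)$. The bracket $\langle\cdot,\cdot\rangle$ (without subscript) is the Hall scalar product, for which Schur functions are orthonormal (extended linearly over $\mathbb{Q}(\alpha)$). Binomial coefficients $\binom{\alpha+k}{n}$ and $\binom{\alpha}{k}$ are polynomials in $\alpha$. Partition diagrams are drawn in French notation: rows left-justified, the $j$th row from the bottom having $\lambda_j$ cells; the cell $(i,j)$ is in column $i$ (from the left) and row $j$ (from the bottom). $K_{\lambda,1^n}$ is the number of standard Young tableaux of shape $\lambda$. Rook theory: for $0\le c_1\le\cdots\le c_n\le n$ integers, $B(c_1,\ldots,c_n)$ is the Ferrers board in the $n\times n$ grid consisting of the bottom $c_i$ cells of column $i$, for each $i$. For a board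 $B$ (a subset of the $n\times n$ grid), $r_k(B)$ is the number of ways to place $k$ nonattacking rooks (no two in the same row or column) on $B$, and $h_k(B)$ is the number of ways to place $n$ nonattacking rooks on the $n\times n$ grid with exactly $k$ of them on $B$. *)

theory Defs
  imports
    "HOL-Computational_Algebra.Computational_Algebra"
    "HOL-Computational_Algebra.Field_as_Ring"
    "HOL-Library.Poly_Mapping"
    "HOL-Library.FuncSet"
begin

section \<open>Partitions and diagrams\<close>

text \<open>Partitions are weakly decreasing lists of positive integers.\<close>

definition is_partition :: "nat list \<Rightarrow> bool" where
  "is_partition la \<longleftrightarrow> sorted_wrt (\<ge>) la \<and> 0 \<notin> set la"

text \<open>Since \<open>take\<close> stops at the end of a list, \<open>la\<close> and \<open>\<mu>\<close> are in effect padded with zeros.\<close>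

definition dominance_le :: "nat list \<Rightarrow> nat list \<Rightarrow> bool" where
  "dominance_le la \<mu> \<longleftrightarrow>
     sum_list la = sum_list \<mu> \<and> (\<forall>k. sum_list (take k la) \<le> sum_list (take k \<mu>))"

definition z_num :: "nat list \<Rightarrow> nat" where
  "z_num la = (\<Prod>i\<in>set la. i ^ count_list la i * fact (count_list la i))"

text \<open>French notation, indices starting at 1: \<open>(i, j)\<close> is the cell in column \<open>i\<close> (from the left)
  and row \<open>j\<close> (from the bottom).\<close>

definition diagram :: "nat list \<Rightarrow> (nat \<times> nat) set" where
  "diagram la = {(i, j). 1 \<le> j \<and> j \<le> length la \<and> 1 \<le> i \<and> i \<le> la ! (j - 1)}"

definition SSYT :: "nat list \<Rightarrow> (nat \<times> nat \<Rightarrow> nat) set" where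
  "SSYT la = {T \<in> extensional (diagram la).
     (\<forall>i i' j. (i, j) \<in> diagram la \<and> (i', j) \<in> diagram la \<and> i \<le> i' \<longrightarrow> T (i, j) \<le> T (i', j)) \<and>
     (\<forall>i j j'. (i, j) \<in> diagram la \<and> (i, j') \<in> diagram la \<and> j < j' \<longrightarrow> T (i, j) < T (i, j'))}"

definition SYT :: "nat list \<Rightarrow> (nat \<times> nat \<Rightarrow> nat) set" where
  "SYT la = {T \<in> SSYT la. bij_betw T (diagram la) {1..sum_list la}}"

section \<open>Symmetric functions\<close>

text \<open>A formal power series in variables \<open>x\<^sub>0, x\<^sub>1, x\<^sub>2, \<dots>\<close> is represented by its coefficient
  function; a monomial is represented by its finitely supported exponent vector.\<close>

type_synonym 'a series = "(nat \<Rightarrow>\<^sub>0 nat) \<Rightarrow> 'a"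

definition symmetric_function :: "'a::zero series \<Rightarrow> bool" where
  "symmetric_function f \<longleftrightarrow>
     (\<forall>\<pi> x. bij \<pi> \<longrightarrow> f (Poly_Mapping.map_key \<pi> x) = f x) \<and>
     (\<exists>d. \<forall>x. f x \<noteq> 0 \<longrightarrow> (\<Sum>i\<in>Poly_Mapping.keys x. Poly_Mapping.lookup x i) \<le> d)"

definition series_one :: "'a::zero_neq_one series" where
  "series_one x = (if x = 0 then 1 else 0)"

definition series_mult :: "'a::comm_semiring_1 series \<Rightarrow> 'a series \<Rightarrow> 'a series" where
  "series_mult f g x = (\<Sum>(y, z) | y + z = x. f y * g z)"

definition monomial_sym :: "nat list \<Rightarrow> 'a::zero_neq_one series" where
  "monomial_sym la x =
     (if image_mset (Poly_Mapping.lookup x) (mset_set (Poly_Mapping.keys x)) = mset la then 1 else 0)"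

definition power_sum1 :: "nat \<Rightarrow> 'a::zero_neq_one series" where
  "power_sum1 k x = (if \<exists>i. x = Poly_Mapping.single i k then 1 else 0)"

definition power_sum :: "nat list \<Rightarrow> 'a::comm_semiring_1 series" where
  "power_sum la = foldr (\<lambda>k. series_mult (power_sum1 k)) la series_one"

definition schur :: "nat list \<Rightarrow> 'a::semiring_1 series" where
  "schur la x = of_nat (card {T \<in> SSYT la.
     \<forall>k. card {u \<in> diagram la. T u = k} = Poly_Mapping.lookup x k})"

text \<open>Coordinates with respect to a linear basis \<open>b\<close> of the symmetric functions that is indexed by
  partitions (only used for monomial symmetric functions, power sums and Schur functions).\<close>

definition has_expansion ::
  "(nat list \<Rightarrow> 'a::comm_semiring_1 series) \<Rightarrow> (nat list \<Rightarrow> 'a) \<Rightarrow> 'a series \<Rightarrow> bool" where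
  "has_expansion b c f \<longleftrightarrow>
     finite {la. c la \<noteq> 0} \<and> (\<forall>la. c la \<noteq> 0 \<longrightarrow> is_partition la) \<and>
     f = (\<lambda>x. \<Sum>la | c la \<noteq> 0. c la * b la x)"

definition coords ::
  "(nat list \<Rightarrow> 'a::comm_semiring_1 series) \<Rightarrow> 'a series \<Rightarrow> nat list \<Rightarrow> 'a" where
  "coords b f = (THE c. has_expansion b c f)"

text \<open>The Hall scalar product: the bilinear form for which the Schur functions are orthonormal.\<close>

definition hall :: "'a::comm_semiring_1 series \<Rightarrow> 'a series \<Rightarrow> 'a" where
  "hall f g = (\<Sum>la | coords schur f la \<noteq> 0. coords schur f la * coords schur g la)"

section \<open>Jack symmetric functions\<close>

type_synonym rat_fun = "rat poly fract"

definition alpha :: rat_fun where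
  "alpha = to_fract [:0, 1:]"

text \<open>The bilinear form for which power sums of distinct partitions are orthogonal and
  \<open>\<langle>p\<^sub>\<mu>, p\<^sub>\<mu>\<rangle> = z\<^sub>\<mu> \<alpha>\<^bsup>\<ell>(\<mu>)\<^esup>\<close>.\<close>

definition alpha_product :: "rat_fun series \<Rightarrow> rat_fun series \<Rightarrow> rat_fun" where
  "alpha_product f g = (\<Sum>la | coords power_sum f la \<noteq> 0.
     coords power_sum f la * coords power_sum g la * (of_nat (z_num la) * alpha ^ length la))"

text \<open>The conditions that characterise the integral form Jack symmetric functions among families
  indexed by partitions; the values of \<open>J\<close> at other lists are irrelevant.\<close>

definition integral_jack_family :: "(nat list \<Rightarrow> rat_fun series) \<Rightarrow> bool" where
  "integral_jack_family J \<longleftrightarrow>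
     (\<forall>\<mu>. is_partition \<mu> \<longrightarrow> symmetric_function (J \<mu>)) \<and>
     (\<forall>\<mu> \<nu>. is_partition \<mu> \<and> is_partition \<nu> \<and> \<mu> \<noteq> \<nu> \<longrightarrow> alpha_product (J \<mu>) (J \<nu>) = 0) \<and>
     (\<forall>\<mu> la. is_partition \<mu> \<and> is_partition la \<and> coords monomial_sym (J \<mu>) la \<noteq> 0
        \<longrightarrow> dominance_le la \<mu>) \<and>
     (\<forall>\<mu>. is_partition \<mu> \<longrightarrow>
        coords monomial_sym (J \<mu>) (replicate (sum_list \<mu>) 1) = fact (sum_list \<mu>))"

text \<open>The value of a rational function at \<open>t\<close>; it is only used at \<open>t = 1 / \<alpha>\<close>, where no denominator
  vanishes.\<close>

definition subst_alpha :: "rat_fun \<Rightarrow> rat_fun \<Rightarrow> rat_fun" where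
  "subst_alpha t r =
     poly (map_poly of_rat (fst (quot_of_fract r))) t /
     poly (map_poly of_rat (snd (quot_of_fract r))) t"

definition J_tilde :: "(nat list \<Rightarrow> rat_fun series) \<Rightarrow> nat list \<Rightarrow> rat_fun series" where
  "J_tilde J \<mu> = (\<lambda>x. alpha ^ sum_list \<mu> * subst_alpha (1 / alpha) (J \<mu> x))"

section \<open>Rook theory\<close>

text \<open>Cells are again pairs (column, row).\<close>

definition ferrers_board :: "nat \<Rightarrow> (nat \<Rightarrow> int) \<Rightarrow> (nat \<times> nat) set" where
  "ferrers_board n c = {(i, j). i \<in> {1..n} \<and> j \<in> {1..n} \<and> int j \<le> c i}"

definition nonattacking :: "(nat \<times> nat) set \<Rightarrow> bool" where
  "nonattacking S \<longleftrightarrow> inj_on fst S \<and> inj_on snd S"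

definition rook_number :: "(nat \<times> nat) set \<Rightarrow> nat \<Rightarrow> nat" where
  "rook_number B k = card {S. S \<subseteq> B \<and> nonattacking S \<and> card S = k}"

definition hit_number :: "nat \<Rightarrow> (nat \<times> nat) set \<Rightarrow> nat \<Rightarrow> nat" where
  "hit_number n B k = card {S. S \<subseteq> {1..n} \<times> {1..n} \<and> nonattacking S \<and> card S = n \<and> card (S \<inter> B) = k}"

end

theory Submission
  imports Defs "HOL-Combinatorics.Permutations" "HOL-Library.Function_Algebras"
begin

text \<open>One-row Jack functions are determined by duality. Pairing a symmetric function of degree
  \<open>n\<close> with the sum of \<open>p\<^sub>\<mu> / (z\<^sub>\<mu> \<alpha>^l(\<mu>))\<close> over all partitions \<open>\<mu>\<close> of \<open>n\<close>
  extracts its coefficient of \<open>x\<^sub>0^n\<close>, and by triangularity that coefficient vanishes for all Jack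
  functions of degree \<open>n\<close> except the one-row one, which is therefore a multiple of this sum. Its
  coefficients are those of \<open>\<Prod>\<^sub>i (1 - x\<^sub>i)^(-1/\<alpha>)\<close>, so after the substitution the coefficient
  of \<open>x^\<nu>\<close> is \<open>g(\<nu>) = n! \<Prod>\<^sub>i \<alpha>(\<alpha> + 1)\<dots>(\<alpha> + \<nu>\<^sub>i - 1) / \<nu>\<^sub>i!\<close>, and
  \<open>g(\<nu>) = \<Sum>\<^sub>i (\<alpha> + \<nu>\<^sub>i - 1) g(\<nu> - e\<^sub>i)\<close>. The symmetric function with Schur
  coefficients \<open>K(\<lambda>, 1^n) \<Prod> (\<alpha> + i - j)\<close> obeys the same recursion: adding a cell of
  content \<open>c\<close> with weight \<open>\<alpha> + c\<close> acts on Schur functions as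
  \<open>\<Sum>\<^sub>i (\<alpha> x\<^sub>i + x\<^sub>i\<^sup>2 \<partial>\<^sub>i)\<close>, which is checked one variable at a time on horizontal strips.
  The content product is then expanded by the factorization theorem of Goldman, Joichi and White,
  and rook numbers are converted to hit numbers by Vandermonde's identity.\<close>

section \<open>Rook and hit numbers\<close>

text \<open>\<open>J\<close> is fixed only by its characterising properties and
  \<open>coords\<close> is a definite description, so coefficients of \<open>J [n]\<close> become
  accessible only once expansions are known to exist and to be unique. Uniqueness comes from
  evaluating a series at one test monomial per partition, where Schur functions and power sums are
  triangular. In a fixed degree there are as many power sums as test monomials, so uniqueness gives
  existence by linear algebra. Rational functions in \<alpha> form an ordered field with \<alpha>
  positive, which makes the \<alpha>-form positive definite on power sum coordinates; the orthogonal
  Jack functions of degree n are therefore independent, and the same count makes them a basis in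
  which the dual element can be expanded. On the Schur side, branching on the largest entry turns
  the sum over added cells into a comparison between adding a cell and removing a horizontal strip
  of size k. The contents of the cells that differ telescope to \<alpha> + k - 1, exactly the factor
  that the operator contributes in that variable.\<close>

lemma finite_placements: "finite B \<Longrightarrow> finite {S. S \<subseteq> B \<and> P S}"
  by (rule finite_subset[of _ "Pow B"]) auto

lemma rook_number_0: "finite B \<Longrightarrow> rook_number B 0 = 1"
proof -
  assume "finite B"
  then have "{S. S \<subseteq> B \<and> nonattacking S \<and> card S = 0} = {{}}"
    by (auto simp: nonattacking_def dest: finite_subset)
  then show ?thesis by (simp add: rook_number_def)
qed

lemma rook_number_eq_0:
  assumes "finite (fst ` B)" "card (fst ` B) < k \<or> finite (snd ` B) \<and> card (snd ` B) < k"
  shows "rook_number B k = 0"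
proof -
  have "False" if S: "S \<subseteq> B" "nonattacking S" "card S = k" for S
  proof -
    have "k = card (fst ` S)" "k = card (snd ` S)"
      using S by (auto simp: nonattacking_def card_image)
    moreover have "fst ` S \<subseteq> fst ` B" "snd ` S \<subseteq> snd ` B" using S by auto
    ultimately show False using assms card_mono leD by metis
  qed
  then have "{S. S \<subseteq> B \<and> nonattacking S \<and> card S = k} = {}" by blast
  then show ?thesis unfolding rook_number_def by (simp only: card.empty)
qed

section \<open>Rook numbers of boards built up column by column\<close>

abbreviation column_board :: "nat \<Rightarrow> (nat \<Rightarrow> nat) \<Rightarrow> (nat \<times> nat) set" where
  "column_board m h \<equiv> Sigma {1..m} (\<lambda>i. {1..h i})"

lemma column_board_bounds:
  assumes "\<And>i. 1 \<le> i \<Longrightarrow> i \<le> m \<Longrightarrow> h i \<le> H"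
  shows "fst ` column_board m h \<subseteq> {1..m}" "snd ` column_board m h \<subseteq> {1..H}"
  using assms by (auto, fastforce)

lemma rook_number_column_board_eq_0:
  assumes "\<And>i. 1 \<le> i \<Longrightarrow> i \<le> m \<Longrightarrow> h i \<le> H" "m < k \<or> H < k"
  shows "rook_number (column_board m h) k = 0"
proof (rule rook_number_eq_0)
  note * = column_board_bounds[OF assms(1)]
  show "finite (fst ` column_board m h)" by simp
  have "card (fst ` column_board m h) \<le> m" "card (snd ` column_board m h) \<le> H"
    using card_mono[OF _ *(1)] card_mono[OF _ *(2)] by simp_all
  then show "card (fst ` column_board m h) < k \<or>
      finite (snd ` column_board m h) \<and> card (snd ` column_board m h) < k"
    using assms(2) by auto
qed

text \<open>The last column is at least as tall as all others, so the k rows taken by rooks to its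
  left are all rows of that column. Exactly \<open>h (Suc m) - k\<close> of its cells stay free,
  whichever placement was chosen.\<close>

lemma rook_number_column_board_Suc:
  assumes h: "\<And>i. 1 \<le> i \<Longrightarrow> i \<le> m \<Longrightarrow> h i \<le> h (Suc m)"
  shows "rook_number (column_board (Suc m) h) (Suc k) =
    rook_number (column_board m h) (Suc k) + (h (Suc m) - k) * rook_number (column_board m h) k"
proof -
  let ?B = "column_board m h" and ?B' = "column_board (Suc m) h"
  let ?P = "\<lambda>B k. {S. S \<subseteq> B \<and> nonattacking S \<and> card S = k}"
  let ?I = "SIGMA S:?P ?B k. {1..h (Suc m)} - snd ` S"
  let ?f = "\<lambda>(S, j). insert (Suc m, j) S"
  have fin: "finite ?B" "finite ?B'" by auto
  have B'_eq: "?B' = ?B \<union> Pair (Suc m) ` {1..h (Suc m)}"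
    by (auto simp: le_Suc_eq)
  have split: "?P ?B' (Suc k) = ?P ?B (Suc k) \<union> ?f ` ?I"
  proof (intro equalityI subsetI)
    fix S assume "S \<in> ?P ?B' (Suc k)"
    then have S: "S \<subseteq> ?B'" "nonattacking S" "card S = Suc k" by auto
    show "S \<in> ?P ?B (Suc k) \<union> ?f ` ?I"
    proof (cases "S \<subseteq> ?B")
      case True then show ?thesis using S by auto
    next
      case False
      then obtain j where j: "(Suc m, j) \<in> S" "j \<in> {1..h (Suc m)}"
        using S(1) unfolding B'_eq by blast
      let ?S = "S - {(Suc m, j)}"
      have "?S \<subseteq> ?B"
      proof
        fix u assume u: "u \<in> ?S"
        with S(2) j(1) have "fst u \<noteq> Suc m" by (auto simp: nonattacking_def inj_on_def)
        with u S(1) B'_eq show "u \<in> ?B" by auto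
      qed
      moreover have "nonattacking ?S" using S(2) by (auto simp: nonattacking_def inj_on_def)
      moreover have "card ?S = k" using S(3) j(1) by simp
      moreover have "j \<notin> snd ` ?S" using S(2) j(1) by (force simp: nonattacking_def inj_on_def)
      moreover have "S = ?f (?S, j)" using j by auto
      ultimately have "S \<in> ?f ` ?I" using j(2) by (intro image_eqI[where x = "(?S, j)"]) auto
      then show ?thesis by simp
    qed
  next
    fix S assume S: "S \<in> ?P ?B (Suc k) \<union> ?f ` ?I"
    show "S \<in> ?P ?B' (Suc k)"
    proof (cases "S \<in> ?P ?B (Suc k)")
      case True then show ?thesis using B'_eq by auto
    next
      case False
      with S have "S \<in> ?f ` ?I" by blast
      then obtain u where "u \<in> ?I" "S = ?f u" by (rule imageE)
      then obtain T j where T: "S = insert (Suc m, j) T" "T \<subseteq> ?B" "nonattacking T" "card T = k"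
        "j \<in> {1..h (Suc m)}" "j \<notin> snd ` T" by (cases u) simp
      have "Suc m \<notin> fst ` T" using T(2) by auto
      then have "nonattacking S" "(Suc m, j) \<notin> T" using T(3,6) unfolding T(1) nonattacking_def
        by (force simp: inj_on_def)+
      then show ?thesis using T fin B'_eq by (auto simp: finite_subset card_insert_if)
    qed
  qed
  have card_free: "card ({1..h (Suc m)} - snd ` S) = h (Suc m) - k" if "S \<in> ?P ?B k" for S
  proof -
    have "snd ` S \<subseteq> {1..h (Suc m)}" using that column_board_bounds(2)[of m h "h (Suc m)"] h by blast
    moreover have "card (snd ` S) = k" using that by (auto simp: nonattacking_def card_image)
    ultimately show ?thesis by (simp add: card_Diff_subset finite_subset)
  qed
  have "card ?I = (\<Sum>S\<in>?P ?B k. card ({1..h (Suc m)} - snd ` S))"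
    by (intro card_SigmaI finite_placements fin ballI) auto
  also have "\<dots> = (h (Suc m) - k) * rook_number ?B k"
    unfolding rook_number_def by (subst sum.cong[OF refl card_free]) auto
  finally have card_I: "card ?I = (h (Suc m) - k) * rook_number ?B k" .
  have notin: "(Suc m, j) \<notin> T" if "T \<subseteq> ?B" for T j using that by auto
  have "inj_on ?f ?I"
  proof (intro inj_onI, clarify)
    fix S j T i
    assume *: "S \<subseteq> ?B" "T \<subseteq> ?B" and eq: "insert (Suc m, j) S = insert (Suc m, i) T"
    have "(Suc m, j) \<in> insert (Suc m, i) T" unfolding eq[symmetric] by simp
    then have "j = i" using notin[OF *(2)] by simp
    moreover have "S = T"
      using eq insert_ident[OF notin[OF *(1)] notin[OF *(2)]] unfolding calculation by simp
    ultimately show "S = T \<and> j = i" by simp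
  qed
  then have "card (?f ` ?I) = card ?I" by (rule card_image)
  moreover have "?P ?B (Suc k) \<inter> ?f ` ?I = {}" using notin by auto
  moreover have "finite ?I" using fin by (intro finite_SigmaI finite_placements) auto
  ultimately show ?thesis
    unfolding rook_number_def[of ?B'] split
    by (subst card_Un_disjoint) (use fin card_I in \<open>auto simp: rook_number_def intro!: finite_placements\<close>)
qed

text \<open>Goldman, Joichi and White.\<close>

lemma sum_rook_number_falling:
  fixes x :: "'a::field_char_0"
  assumes "\<And>i j. 1 \<le> i \<Longrightarrow> i \<le> j \<Longrightarrow> j \<le> m \<Longrightarrow> h i \<le> h j"
  shows "(\<Sum>k=0..m. of_nat (rook_number (column_board m h) k) * (\<Prod>i=0..<m - k. x - of_nat i))
    = (\<Prod>i=1..m. x + of_nat (h i) - of_nat i + 1)"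
  using assms
proof (induction m)
  case 0 then show ?case by (simp add: rook_number_0)
next
  case (Suc m)
  let ?r = "\<lambda>k. of_nat (rook_number (column_board m h) k) :: 'a"
  let ?r' = "\<lambda>k. of_nat (rook_number (column_board (Suc m) h) k) :: 'a"
  let ?ff = "\<lambda>k. \<Prod>i=0..<k. x - of_nat i"
  let ?H = "h (Suc m)"
  have H: "h i \<le> ?H" if "1 \<le> i" "i \<le> m" for i using Suc.prems[of i "Suc m"] that by simp
  have rec: "rook_number (column_board (Suc m) h) (Suc k) =
      rook_number (column_board m h) (Suc k) + (?H - k) * rook_number (column_board m h) k" for k
    by (rule rook_number_column_board_Suc) (rule H)
  \<comment> \<open>In the field the factor may be negative, whereas the recursion truncates it at
    0. Both agree because k rooks cannot stand on a board with fewer than k rows.\<close>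
  have step: "?r' (Suc k) = ?r (Suc k) + (of_nat ?H - of_nat k) * ?r k" for k
  proof (cases "k \<le> ?H")
    case True
    then show ?thesis unfolding rec by (simp add: of_nat_diff)
  next
    case False
    then have "?r k = 0" using rook_number_column_board_eq_0[of m h ?H k] H by simp
    then show ?thesis unfolding rec by simp
  qed
  have "?r (Suc m) = 0" using rook_number_column_board_eq_0[of m h ?H "Suc m"] H by simp
  have "(\<Sum>k=0..Suc m. ?r' k * ?ff (Suc m - k)) = ?r' 0 * ?ff (Suc m) + (\<Sum>k=0..m. ?r' (Suc k) * ?ff (m - k))"
    by (subst sum.atLeast0_atMost_Suc_shift) simp
  also have "\<dots> = (?r 0 * ?ff (Suc m) + (\<Sum>k=0..m. ?r (Suc k) * ?ff (m - k)))
      + (\<Sum>k=0..m. (of_nat ?H - of_nat k) * ?r k * ?ff (m - k))"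
    unfolding step distrib_right sum.distrib by (simp add: rook_number_0)
  also have "?r 0 * ?ff (Suc m) + (\<Sum>k=0..m. ?r (Suc k) * ?ff (m - k)) = (\<Sum>k=0..Suc m. ?r k * ?ff (Suc m - k))"
    by (subst sum.atLeast0_atMost_Suc_shift) simp
  also have "\<dots> = (\<Sum>k=0..m. ?r k * ?ff (Suc m - k))" using \<open>?r (Suc m) = 0\<close> by simp
  also have "\<dots> = (\<Sum>k=0..m. ?r k * ?ff (m - k) * (x - of_nat m + of_nat k))"
    by (intro sum.cong) (auto simp: Suc_diff_le of_nat_diff algebra_simps)
  \<comment> \<open>Now \<open>x - m + k\<close> and \<open>H - k\<close> add up to a factor that
    does not depend on k.\<close>
  also have "\<dots> + (\<Sum>k=0..m. (of_nat ?H - of_nat k) * ?r k * ?ff (m - k)) =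
      (\<Sum>k=0..m. ?r k * ?ff (m - k)) * (x + of_nat ?H - of_nat m)"
    unfolding sum_distrib_right sum.distrib[symmetric]
    by (intro sum.cong) (auto simp: algebra_simps)
  also have "(\<Sum>k=0..m. ?r k * ?ff (m - k)) = (\<Prod>i=1..m. x + of_nat (h i) - of_nat i + 1)"
    by (rule Suc.IH) (use Suc.prems in auto)
  finally show ?case by (simp add: algebra_simps)
qed

section \<open>Hit numbers and full placements\<close>

lemma card_full_placements_extending:
  assumes "T \<subseteq> {1..n} \<times> {1..n}" "nonattacking T"
  shows "card {S. S \<subseteq> {1..n} \<times> {1..n} \<and> nonattacking S \<and> card S = n \<and> T \<subseteq> S} = fact (n - card T)"
  using assms
proof (induction "n - card T" arbitrary: T)
  case 0
  have "card T = card (fst ` T)" using 0(3) by (simp add: nonattacking_def card_image)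
  also have "\<dots> \<le> n" using card_mono[of "{1..n}" "fst ` T"] 0(2) by fastforce
  finally have "card T = n" using 0(1) by simp
  then have "{S. S \<subseteq> {1..n} \<times> {1..n} \<and> nonattacking S \<and> card S = n \<and> T \<subseteq> S} = {T}"
    using 0 card_subset_eq[of _ T] finite_subset[of _ "{1..n} \<times> {1..n}"] by blast
  then show ?case using \<open>card T = n\<close> by simp
next
  case (Suc d)
  let ?F = "\<lambda>T. {S. S \<subseteq> {1..n} \<times> {1..n} \<and> nonattacking S \<and> card S = n \<and> T \<subseteq> S}"
  have fin: "finite T" using Suc.prems(1) finite_subset by blast
  have cf: "card (fst ` T) = card T" "card (snd ` T) = card T"
    using Suc.prems(2) by (simp_all add: nonattacking_def card_image)
  have sub: "fst ` T \<subseteq> {1..n}" "snd ` T \<subseteq> {1..n}" using Suc.prems(1) by auto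
  have "fst ` T \<noteq> {1..n}" using cf Suc.hyps(2) by (metis card_atLeastAtMost diff_Suc_1 diff_self_eq_0 nat.distinct(1))
  \<comment> \<open>Every full placement has exactly one rook in the empty column \<open>a\<close>;
    its row, any of the \<open>n - card T\<close> rows free of \<open>T\<close>, splits the
    extensions into disjoint classes.\<close>
  then obtain a where a: "a \<in> {1..n}" "a \<notin> fst ` T" using sub by blast
  let ?R = "{1..n} - snd ` T"
  have "?F T = (\<Union>b\<in>?R. ?F (insert (a, b) T))"
  proof (intro equalityI subsetI)
    fix S assume S: "S \<in> ?F T"
    then have "fst ` S = {1..n}"
      by (intro card_subset_eq) (auto simp: nonattacking_def card_image)
    then obtain b where b: "(a, b) \<in> S" using a(1) by force
    moreover have "b \<notin> snd ` T"
    proof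
      assume "b \<in> snd ` T"
      then obtain a' where "(a', b) \<in> T" by auto
      moreover from this have "(a', b) = (a, b)"
        using S b inj_onD[of snd S "(a', b)" "(a, b)"] unfolding nonattacking_def by auto
      ultimately show False using a(2) by force
    qed
    ultimately show "S \<in> (\<Union>b\<in>?R. ?F (insert (a, b) T))" using S by auto
  qed auto
  moreover have "card (\<Union>b\<in>?R. ?F (insert (a, b) T)) = (\<Sum>b\<in>?R. card (?F (insert (a, b) T)))"
  proof (rule card_UN_disjoint)
    show "\<forall>b\<in>?R. \<forall>b'\<in>?R. b \<noteq> b' \<longrightarrow> ?F (insert (a, b) T) \<inter> ?F (insert (a, b') T) = {}"
    proof (intro ballI impI equals0I)
      fix b b' S assume "b \<noteq> b'" "S \<in> ?F (insert (a, b) T) \<inter> ?F (insert (a, b') T)"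
      then show False using inj_onD[of fst S "(a, b)" "(a, b')"] unfolding nonattacking_def by auto
    qed
  qed (auto intro: finite_placements)
  moreover have "card (?F (insert (a, b) T)) = fact d" if b: "b \<in> ?R" for b
  proof -
    have "(a, b) \<notin> T" using a(2) by force
    then have "n - card (insert (a, b) T) = d" using Suc.hyps(2) fin by simp
    moreover have "insert (a, b) T \<subseteq> {1..n} \<times> {1..n}" using a b Suc.prems by auto
    moreover have "nonattacking (insert (a, b) T)"
      using a(2) b Suc.prems(2) unfolding nonattacking_def inj_on_insert by auto
    ultimately show ?thesis using Suc.hyps(1)[of "insert (a, b) T"] by simp
  qed
  moreover have "card ?R = Suc d" using Suc.hyps(2) sub cf fin by (simp add: card_Diff_subset)
  ultimately show ?case using Suc.hyps(2)[symmetric] by simp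
qed

text \<open>Both sides count pairs T \<subseteq> S of a full placement S and j of its rooks that lie
  on \<open>B\<close>: on the left by S, grouped by hits, on the right by T.\<close>

lemma sum_hit_number_choose:
  assumes "B \<subseteq> {1..n} \<times> {1..n}"
  shows "(\<Sum>k=0..n. hit_number n B k * (k choose j)) = rook_number B j * fact (n - j)"
proof -
  let ?F = "{S. S \<subseteq> {1..n} \<times> {1..n} \<and> nonattacking S \<and> card S = n}"
  let ?P = "{T. T \<subseteq> B \<and> nonattacking T \<and> card T = j}"
  have fin: "finite ?F" "finite ?P" "finite B"
    using assms by (auto intro!: finite_placements finite_subset[of B])
  have finS: "finite S" if "S \<in> ?F" for S using that by (auto intro: finite_subset)
  have "(\<Sum>k=0..n. hit_number n B k * (k choose j)) =
      (\<Sum>k=0..n. \<Sum>S | S \<in> ?F \<and> card (S \<inter> B) = k. card (S \<inter> B) choose j)"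
  proof (intro sum.cong refl)
    fix k
    have "(\<Sum>S | S \<in> ?F \<and> card (S \<inter> B) = k. card (S \<inter> B) choose j) =
        (\<Sum>S | S \<in> ?F \<and> card (S \<inter> B) = k. k choose j)"
      by (rule sum.cong) auto
    then show "hit_number n B k * (k choose j) =
        (\<Sum>S | S \<in> ?F \<and> card (S \<inter> B) = k. card (S \<inter> B) choose j)"
      by (simp add: hit_number_def)
  qed
  also have "\<dots> = (\<Sum>S\<in>?F. card (S \<inter> B) choose j)"
  proof (rule sum.group)
    show "(\<lambda>S. card (S \<inter> B)) ` ?F \<subseteq> {0..n}"
    proof (intro image_subsetI, elim CollectE conjE)
      fix S assume "S \<subseteq> {1..n} \<times> {1..n}" "card S = n"
      then show "card (S \<inter> B) \<in> {0..n}"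
        using card_mono[of S "S \<inter> B"] finite_subset[of S "{1..n} \<times> {1..n}"] by simp
    qed
  qed (use fin in auto)
  also have "\<dots> = (\<Sum>S\<in>?F. card {T \<in> ?P. T \<subseteq> S})"
  proof (intro sum.cong refl)
    fix S assume S: "S \<in> ?F"
    then have "{T \<in> ?P. T \<subseteq> S} = {T. T \<subseteq> S \<inter> B \<and> card T = j}"
      by (auto simp: nonattacking_def inj_on_subset)
    then show "card (S \<inter> B) choose j = card {T \<in> ?P. T \<subseteq> S}"
      using n_subsets[of "S \<inter> B" j] finS[OF S] by simp
  qed
  also have "\<dots> = (\<Sum>T\<in>?P. card {S \<in> ?F. T \<subseteq> S})"
    using fin by (intro sum_multicount_gen) auto
  also have "\<dots> = (\<Sum>T\<in>?P. fact (n - j))"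
  proof (intro sum.cong refl)
    fix T assume "T \<in> ?P"
    then show "card {S \<in> ?F. T \<subseteq> S} = fact (n - j)"
      using card_full_placements_extending[of T n] assms by (auto simp: conj_ac)
  qed
  finally show ?thesis by (simp add: rook_number_def)
qed

lemma sum_hit_number_gchoose:
  fixes x :: "'a::field_char_0"
  assumes "B \<subseteq> {1..n} \<times> {1..n}"
  shows "(\<Sum>k=0..n. of_nat (hit_number n B k) * ((x + of_nat k) gchoose n)) =
    (\<Sum>k=0..n. of_nat (rook_number B (n - k)) * (x gchoose k) * fact k)"
proof -
  have "(\<Sum>k=0..n. of_nat (hit_number n B k) * ((x + of_nat k) gchoose n)) =
      (\<Sum>k=0..n. \<Sum>j=0..n. of_nat (hit_number n B k * (k choose j)) * (x gchoose (n - j)))"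
    by (intro sum.cong refl)
      (simp add: add.commute[of x] gbinomial_Vandermonde[symmetric] sum_distrib_left binomial_gbinomial mult.assoc)
  also have "\<dots> = (\<Sum>j=0..n. of_nat (\<Sum>k=0..n. hit_number n B k * (k choose j)) * (x gchoose (n - j)))"
    by (subst sum.swap) (simp add: sum_distrib_right)
  also have "\<dots> = (\<Sum>j=0..n. of_nat (rook_number B j) * (x gchoose (n - j)) * fact (n - j))"
    unfolding sum_hit_number_choose[OF assms] by (simp add: mult_ac)
  also have "\<dots> = (\<Sum>k=0..n. of_nat (rook_number B (n - k)) * (x gchoose k) * fact k)"
    by (rule sum.reindex_bij_witness[of _ "\<lambda>k. n - k" "\<lambda>k. n - k"]) auto
  finally show ?thesis .
qed

section \<open>Tableaux and the content-weighted Pieri rule\<close>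

text \<open>Diagrams are sets of cells here, so that adding or removing a cell is
  \<open>insert\<close> or set difference; \<open>bij_betw_diagram\<close> connects them with
  partitions.\<close>

definition young :: "(nat \<times> nat) set \<Rightarrow> bool" where
  "young D \<longleftrightarrow> finite D \<and> (\<forall>i j. (i, j) \<in> D \<longrightarrow> 1 \<le> i \<and> 1 \<le> j) \<and>
     (\<forall>i j i' j'. (i, j) \<in> D \<and> 1 \<le> i' \<and> i' \<le> i \<and> 1 \<le> j' \<and> j' \<le> j \<longrightarrow> (i', j') \<in> D)"

definition shapes :: "nat \<Rightarrow> (nat \<times> nat) set set" where
  "shapes n = {D. young D \<and> card D = n}"

definition addable :: "(nat \<times> nat) set \<Rightarrow> (nat \<times> nat) set" where
  "addable D = {u. u \<notin> D \<and> young (insert u D)}"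

definition removable :: "(nat \<times> nat) set \<Rightarrow> (nat \<times> nat) set" where
  "removable D = {u \<in> D. young (D - {u})}"

text \<open>With at most one cell per column, \<open>D - E\<close> is a horizontal strip, the shape
  occupied by equal entries of a tableau.\<close>

definition strip_removals :: "(nat \<times> nat) set \<Rightarrow> nat \<Rightarrow> (nat \<times> nat) set set" where
  "strip_removals D k = {E. young E \<and> E \<subseteq> D \<and> inj_on fst (D - E) \<and> card (D - E) = k}"

definition semistandard :: "(nat \<times> nat) set \<Rightarrow> (nat \<times> nat \<Rightarrow> nat) \<Rightarrow> bool" where
  "semistandard D T \<longleftrightarrow>
     (\<forall>i i' j. (i, j) \<in> D \<and> (i', j) \<in> D \<and> i \<le> i' \<longrightarrow> T (i, j) \<le> T (i', j)) \<and>
     (\<forall>i j j'. (i, j) \<in> D \<and> (i, j') \<in> D \<and> j < j' \<longrightarrow> T (i, j) < T (i, j'))"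

definition tableaux :: "(nat \<times> nat) set \<Rightarrow> (nat \<Rightarrow> nat) \<Rightarrow> (nat \<times> nat \<Rightarrow> nat) set" where
  "tableaux D x = {T \<in> extensional D. semistandard D T \<and> (\<forall>k. card {u \<in> D. T u = k} = x k)}"

text \<open>The Kostka number for an arbitrary content \<open>x\<close>: the recursions lower or
  clear a single exponent, which does not keep \<open>x\<close> weakly decreasing.\<close>

definition kostka :: "(nat \<times> nat) set \<Rightarrow> (nat \<Rightarrow> nat) \<Rightarrow> nat" where
  "kostka D x = card (tableaux D x)"

lemma young_finite: "young D \<Longrightarrow> finite D"
  and young_pos: "young D \<Longrightarrow> (i, j) \<in> D \<Longrightarrow> 1 \<le> i \<and> 1 \<le> j"
  and young_down: "young D \<Longrightarrow> (i, j) \<in> D \<Longrightarrow> 1 \<le> i' \<Longrightarrow> i' \<le> i \<Longrightarrow> 1 \<le> j' \<Longrightarrow> j' \<le> j \<Longrightarrow> (i', j') \<in> D"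
  unfolding young_def by blast+

lemma young_bound:
  assumes "young D" "(i, j) \<in> D"
  shows "i \<le> card D" "j \<le> card D"
proof -
  have "(\<lambda>i'. (i', j)) ` {1..i} \<subseteq> D" "(\<lambda>j'. (i, j')) ` {1..j} \<subseteq> D"
    using young_down[OF assms] young_pos[OF assms] by auto
  then have "card ((\<lambda>i'. (i', j)) ` {1..i}) \<le> card D" "card ((\<lambda>j'. (i, j')) ` {1..j}) \<le> card D"
    using young_finite[OF assms(1)] card_mono by blast+
  then show "i \<le> card D" "j \<le> card D" by (simp_all add: card_image inj_on_def)
qed

lemma finite_shapes: "finite (shapes n)"
proof (rule finite_subset)
  show "shapes n \<subseteq> Pow ({0..n} \<times> {0..n})"
    using young_bound by (auto simp: shapes_def)
qed simp

lemma shapes_0: "shapes 0 = {{}}"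
  by (auto simp: shapes_def young_def)

lemma finite_removable: "finite D \<Longrightarrow> finite (removable D)"
  by (simp add: removable_def)

lemma finite_strip_removals: "finite D \<Longrightarrow> finite (strip_removals D k)"
  unfolding strip_removals_def by (rule finite_subset[of _ "Pow D"]) auto

lemma card_strip_removal:
  assumes "finite D" "E \<in> strip_removals D k"
  shows "card D = card E + k"
proof -
  have "card D = card (E \<union> (D - E))" using assms by (auto simp: strip_removals_def intro: arg_cong[of _ _ card])
  also have "\<dots> = card E + card (D - E)"
    using assms by (intro card_Un_disjoint) (auto simp: strip_removals_def dest: young_finite)
  finally show ?thesis using assms by (simp add: strip_removals_def)
qed

lemma semistandardD:
  assumes "semistandard D T"
  shows "(i, j) \<in> D \<Longrightarrow> (i', j) \<in> D \<Longrightarrow> i \<le> i' \<Longrightarrow> T (i, j) \<le> T (i', j)"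
    and "(i, j) \<in> D \<Longrightarrow> (i, j') \<in> D \<Longrightarrow> j < j' \<Longrightarrow> T (i, j) < T (i, j')"
  using assms unfolding semistandard_def by blast+

lemma tableaux_less:
  assumes "finite D" "T \<in> tableaux D x" "u \<in> D" "\<And>k. M \<le> k \<Longrightarrow> x k = 0"
  shows "T u < M"
proof (rule ccontr)
  assume "\<not> T u < M"
  then have "x (T u) = 0" using assms(4)[of "T u"] by simp
  then have "card {v \<in> D. T v = T u} = 0" using assms(2) by (simp add: tableaux_def)
  then have "{v \<in> D. T v = T u} = {}" using assms(1) by simp
  then show False using assms(3) by blast
qed

lemma finite_tableaux:
  assumes "finite D" "\<And>k. M \<le> k \<Longrightarrow> x k = 0"
  shows "finite (tableaux D x)"
proof (rule finite_subset)
  show "tableaux D x \<subseteq> D \<rightarrow>\<^sub>E {..<M}"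
  proof
    fix T assume T: "T \<in> tableaux D x"
    then have "T \<in> extensional D" by (simp add: tableaux_def)
    moreover have "\<forall>u\<in>D. T u < M" using tableaux_less[OF assms(1) T _ assms(2)] by blast
    ultimately show "T \<in> D \<rightarrow>\<^sub>E {..<M}" by (auto simp: PiE_def)
  qed
qed (use assms in \<open>auto intro: finite_PiE\<close>)

lemma kostka_empty: "kostka {} (\<lambda>_. 0) = 1"
  by (simp add: kostka_def tableaux_def semistandard_def)

lemma kostka_content_zero:
  assumes "finite D" "D \<noteq> {}"
  shows "kostka D (\<lambda>_. 0) = 0"
proof -
  obtain u where "u \<in> D" using assms(2) by blast
  then have "tableaux D (\<lambda>_. 0) = {}" using tableaux_less[of D _ "\<lambda>_. 0" u 0] assms(1) by fastforce
  then show ?thesis by (simp add: kostka_def)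
qed

text \<open>Branching: the cells filled with the largest entry form a horizontal strip.\<close>

lemma kostka_branch:
  assumes D: "young D" and x: "\<And>k. M < k \<Longrightarrow> x k = 0"
  shows "kostka D x = (\<Sum>E\<in>strip_removals D (x M). kostka E (x(M := 0)))"
proof -
  let ?x = "x(M := 0)"
  have x': "?x k = 0" if "M \<le> k" for k using x[of k] that by auto
  let ?E = "\<lambda>T. {u \<in> D. T u < M}"
  let ?ext = "\<lambda>(E, T). \<lambda>u\<in>D. if u \<in> E then T u else M"
  let ?S = "SIGMA E:strip_removals D (x M). tableaux E ?x"
  note finD = young_finite[OF D]
  have le: "T u \<le> M" if "T \<in> tableaux D x" "u \<in> D" for T u
    using tableaux_less[OF finD that, of "Suc M"] x by simp
  have lt: "T u < M" if "young E" "T \<in> tableaux E ?x" "u \<in> E" for E T u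
    using tableaux_less[OF young_finite that(2,3)] that(1) x' by blast
  have "bij_betw (\<lambda>T. (?E T, restrict T (?E T))) (tableaux D x) ?S"
  proof (rule bij_betw_byWitness[where f' = ?ext])
    show "\<forall>T\<in>tableaux D x. ?ext (?E T, restrict T (?E T)) = T"
    proof
      fix T assume T: "T \<in> tableaux D x"
      show "?ext (?E T, restrict T (?E T)) = T"
      proof
        fix u show "?ext (?E T, restrict T (?E T)) u = T u"
          using le[OF T, of u] T extensional_arb[of T D u]
            by (cases "u \<in> D") (auto simp: tableaux_def)
      qed
    qed
    show "\<forall>p\<in>?S. (?E (?ext p), restrict (?ext p) (?E (?ext p))) = p"
    proof
      fix p assume "p \<in> ?S"
      then obtain E T where p: "p = (E, T)" and *: "E \<in> strip_removals D (x M)" "T \<in> tableaux E ?x"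
        by blast
      have E: "?E (?ext (E, T)) = E"
        using lt[OF _ *(2)] *(1) by (auto simp: strip_removals_def)
      have "E \<subseteq> D" "T \<in> extensional E" using * by (auto simp: strip_removals_def tableaux_def)
      then have "restrict (?ext (E, T)) E = T"
        by (intro extensionalityI[where A = E]) auto
      with E show "(?E (?ext p), restrict (?ext p) (?E (?ext p))) = p"
        unfolding p by metis
    qed
    show "(\<lambda>T. (?E T, restrict T (?E T))) ` tableaux D x \<subseteq> ?S"
    proof (intro image_subsetI SigmaI)
      fix T assume T: "T \<in> tableaux D x"
      then have ss: "semistandard D T" by (simp add: tableaux_def)
      have "young (?E T)" unfolding young_def
      proof (intro conjI allI impI)
        fix i j i' j' assume *: "(i, j) \<in> ?E T \<and> 1 \<le> i' \<and> i' \<le> i \<and> 1 \<le> j' \<and> j' \<le> j"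
        then have in_D: "(i, j) \<in> D" "(i', j') \<in> D" "(i, j') \<in> D"
          using young_down[OF D, of i j] young_pos[OF D, of i j] by auto
        have "T (i', j') \<le> T (i, j')" using semistandardD(1)[OF ss] in_D * by blast
        also have "\<dots> \<le> T (i, j)"
          using semistandardD(2)[OF ss in_D(3,1)] * by (cases "j' = j") auto
        finally show "(i', j') \<in> ?E T" using * in_D by auto
      qed (use young_pos[OF D] finD in auto)
      moreover have "inj_on fst (D - ?E T)"
      proof (rule inj_onI)
        fix u v assume *: "u \<in> D - ?E T" "v \<in> D - ?E T" "fst u = fst v"
        then have "T u = M" "T v = M" using le[OF T, of u] le[OF T, of v] by auto
        then show "u = v"
          using * semistandardD(2)[OF ss, of "fst u" "snd u" "snd v"]
            semistandardD(2)[OF ss, of "fst u" "snd v" "snd u"]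
            nat_neq_iff[of "snd u" "snd v"]
          by (cases u; cases v) auto
      qed
      moreover have "D - ?E T = {u \<in> D. T u = M}" using le[OF T] by force
      then have "card (D - ?E T) = x M" using T by (simp add: tableaux_def)
      ultimately show "?E T \<in> strip_removals D (x M)" by (auto simp: strip_removals_def)
      show "restrict T (?E T) \<in> tableaux (?E T) ?x"
      proof -
        have "card {u \<in> ?E T. restrict T (?E T) u = k} = ?x k" for k
        proof (cases "k < M")
          case True
          then have "{u \<in> ?E T. restrict T (?E T) u = k} = {u \<in> D. T u = k}" by auto
          then show ?thesis using T True by (simp add: tableaux_def)
        next
          case False
          then have empty: "{u \<in> ?E T. restrict T (?E T) u = k} = {}" by auto
          show ?thesis unfolding empty using x'[of k] False by simp
        qed
        moreover have "semistandard (?E T) (restrict T (?E T))"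
          using ss by (simp add: semistandard_def)
        ultimately show ?thesis by (simp add: tableaux_def)
      qed
    qed
    show "?ext ` ?S \<subseteq> tableaux D x"
    proof
      fix T' assume "T' \<in> ?ext ` ?S"
      then obtain E T where T': "T' = ?ext (E, T)" and
        *: "E \<in> strip_removals D (x M)" "T \<in> tableaux E ?x" by blast
      let ?T = "?ext (E, T)"
      have E: "young E" "E \<subseteq> D" "inj_on fst (D - E)" "card (D - E) = x M"
        using *(1) by (auto simp: strip_removals_def)
      have ss: "semistandard E T" using *(2) by (simp add: tableaux_def)
      note lt = lt[OF E(1) *(2)]
      have "semistandard D ?T" unfolding semistandard_def
      proof (intro conjI allI impI)
        fix i i' j assume "(i, j) \<in> D \<and> (i', j) \<in> D \<and> i \<le> i'"
        then show "?T (i, j) \<le> ?T (i', j)"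
          using semistandardD(1)[OF ss, of i j i'] young_down[OF E(1), of i' j i j] lt[of "(i, j)"]
            young_pos[OF D, of i j] by auto
      next
        fix i j j' assume a: "(i, j) \<in> D \<and> (i, j') \<in> D \<and> j < j'"
        then have "(i, j') \<in> E \<Longrightarrow> (i, j) \<in> E"
          using young_down[OF E(1), of i j' i j] young_pos[OF D, of i j] by auto
        moreover have "(i, j) \<in> E \<or> (i, j') \<in> E"
          using inj_onD[OF E(3), of "(i, j)" "(i, j')"] a by auto
        ultimately show "?T (i, j) < ?T (i, j')"
          using a semistandardD(2)[OF ss, of i j j'] lt[of "(i, j)"] by auto
      qed
      moreover have "card {u \<in> D. ?T u = k} = x k" for k
      proof -
        consider "k < M" | "k = M" | "M < k" by linarith
        then show ?thesis
        proof cases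
          case 1
          then have "{u \<in> D. ?T u = k} = {u \<in> E. T u = k}" using E(2) by auto
          moreover have "card {u \<in> E. T u = k} = ?x k" using *(2) by (simp add: tableaux_def)
          ultimately show ?thesis using 1 by simp
        next
          case 2
          then have "{u \<in> D. ?T u = k} = D - E" using lt by force
          then show ?thesis using 2 E(4) by simp
        next
          case 3
          then have empty: "{u \<in> D. ?T u = k} = {}" using lt by force
          show ?thesis unfolding empty using x[OF 3] by simp
        qed
      qed
      ultimately show "T' \<in> tableaux D x" unfolding T' by (simp add: tableaux_def)
    qed
  qed
  then have "kostka D x = card ?S" unfolding kostka_def by (rule bij_betw_same_card)
  also have "\<dots> = (\<Sum>E\<in>strip_removals D (x M). kostka E ?x)"
    unfolding kostka_def
    by (intro card_SigmaI finite_strip_removals finD ballI finite_tableaux[where M = M] x')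
      (auto simp: strip_removals_def dest: young_finite)
  finally show ?thesis .
qed

section \<open>Corners of a diagram in terms of its row lengths\<close>

lemma young_rows:
  assumes "young D"
  obtains r N where "\<And>i j. (i, j) \<in> D \<longleftrightarrow> 1 \<le> i \<and> 1 \<le> j \<and> i \<le> r j"
    "\<And>i j. 1 \<le> i \<Longrightarrow> i \<le> j \<Longrightarrow> r j \<le> r i" "\<And>j. N < j \<Longrightarrow> r j = (0::nat)"
proof -
  note fin = young_finite[OF assms]
  let ?R = "\<lambda>j. {i. (i, j) \<in> D \<and> 1 \<le> j}"
  have finR: "finite (?R j)" for j
    by (rule finite_subset[of _ "fst ` D"]) (use fin in force)+
  define r where "r j = Max (insert 0 (?R j))" for j
  have r: "(i, j) \<in> D \<longleftrightarrow> 1 \<le> i \<and> 1 \<le> j \<and> i \<le> r j" for i j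
  proof
    assume "(i, j) \<in> D"
    then show "1 \<le> i \<and> 1 \<le> j \<and> i \<le> r j"
      using young_pos[OF assms, of i j] finR[of j] by (auto simp: r_def intro!: Max_ge)
  next
    assume *: "1 \<le> i \<and> 1 \<le> j \<and> i \<le> r j"
    have "r j \<in> insert 0 (?R j)" unfolding r_def by (rule Max_in) (use finR in auto)
    then have "(r j, j) \<in> D" using * by auto
    then show "(i, j) \<in> D" using young_down[OF assms, of "r j" j i j] * by auto
  qed
  moreover have "r j \<le> r i" if "1 \<le> i" "i \<le> j" for i j
  proof (cases "r j = 0")
    case False
    then have "(r j, j) \<in> D" using r that by simp
    then have "(r j, i) \<in> D" using young_down[OF assms, of "r j" j "r j" i] that False by simp
    then show ?thesis using r by simp
  qed simp
  moreover have "r j = 0" if "card D < j" for j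
  proof (rule ccontr)
    assume "r j \<noteq> 0"
    then have "(r j, j) \<in> D" using r that by simp
    then show False using young_bound(2)[OF assms] that by force
  qed
  ultimately show ?thesis using that by blast
qed

lemma card_rows:
  fixes D :: "(nat \<times> nat) set"
  assumes "\<And>i j. (i, j) \<in> D \<longleftrightarrow> 1 \<le> i \<and> 1 \<le> j \<and> i \<le> r j" "\<And>j. N < j \<Longrightarrow> r j = (0::nat)"
  shows "card D = (\<Sum>j=1..N. r j)"
proof -
  have "D = (\<lambda>(j, i). (i, j)) ` Sigma {1..N} (\<lambda>j. {1..r j})"
  proof (intro equalityI subsetI)
    fix u assume u: "u \<in> D"
    obtain i j where ij: "u = (i, j)" by (cases u)
    have "j \<le> N" using assms(1)[of i j] assms(2)[of j] u ij by (cases "N < j") auto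
    then show "u \<in> (\<lambda>(j, i). (i, j)) ` Sigma {1..N} (\<lambda>j. {1..r j})"
      using u assms(1)[of i j] unfolding ij by (intro image_eqI[where x = "(j, i)"]) auto
  qed (use assms(1) in auto)
  also have "card \<dots> = card (Sigma {1..N} (\<lambda>j. {1..r j}))"
    by (rule card_image) (auto simp: inj_on_def)
  finally show ?thesis by simp
qed

text \<open>A cell fits at the end of row j when the row below is longer. The first row has none
  below and always accepts a cell, which becomes the unmatched one in
  \<open>sum_weight_strip\<close>.\<close>

lemma addable_rows:
  assumes r: "\<And>i j. (i, j) \<in> D \<longleftrightarrow> 1 \<le> i \<and> 1 \<le> j \<and> i \<le> r j"
    and anti: "\<And>i j. 1 \<le> i \<Longrightarrow> i \<le> j \<Longrightarrow> r j \<le> r i" and fin: "finite D"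
  shows "addable D = (\<lambda>j. (Suc (r j), j)) ` {j. 1 \<le> j \<and> (j = 1 \<or> r j < r (j - 1))}"
proof (intro equalityI subsetI)
  fix u assume u: "u \<in> addable D"
  obtain i j where ij: "u = (i, j)" by (cases u)
  have *: "(i, j) \<notin> D" "young (insert (i, j) D)" using u ij by (auto simp: addable_def)
  have pos: "1 \<le> i" "1 \<le> j" using young_pos[OF *(2), of i j] by auto
  have "r j < i" using * r pos by auto
  moreover have "i \<le> Suc (r j)"
  proof (cases "i = 1")
    case False
    then have "1 \<le> i - 1" "i - 1 \<noteq> i" using pos by linarith+
    then have "(i - 1, j) \<in> D" using young_down[OF *(2), of i j "i - 1" j] pos by auto
    then show ?thesis using r by auto
  qed simp
  moreover have "j = 1 \<or> r j < r (j - 1)"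
  proof (cases "j = 1")
    case False
    then have "1 \<le> j - 1" "j - 1 \<noteq> j" using pos by linarith+
    then have "(i, j - 1) \<in> D" using young_down[OF *(2), of i j i "j - 1"] pos by auto
    then have "i \<le> r (j - 1)" using r by auto
    then show ?thesis using \<open>r j < i\<close> by simp
  qed simp
  ultimately show "u \<in> (\<lambda>j. (Suc (r j), j)) ` {j. 1 \<le> j \<and> (j = 1 \<or> r j < r (j - 1))}"
    using pos ij by (intro image_eqI[where x = j]) auto
next
  fix u assume "u \<in> (\<lambda>j. (Suc (r j), j)) ` {j. 1 \<le> j \<and> (j = 1 \<or> r j < r (j - 1))}"
  then obtain j where j: "u = (Suc (r j), j)" "1 \<le> j" "j = 1 \<or> r j < r (j - 1)" by auto
  have "(i', j') \<in> insert u D" if "(a, b) \<in> insert u D" "1 \<le> i'" "i' \<le> a" "1 \<le> j'" "j' \<le> b" for a b i' j'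
  proof (cases "(a, b) = u \<and> (i', j') \<noteq> u")
    case False
    then show ?thesis using that anti[of j' b] by (cases "(i', j') = u") (auto simp: r)
  next
    case True
    then have ab: "a = Suc (r j)" "b = j" and ne: "i' \<noteq> Suc (r j) \<or> j' \<noteq> j" using j by auto
    show ?thesis
    proof (cases "i' = Suc (r j)")
      case True
      then have "j' \<le> j - 1" "j \<noteq> 1" using ne that ab by auto
      then show ?thesis using anti[of j' "j - 1"] j True that by (auto simp: r)
    next
      case False
      then show ?thesis using anti[of j' j] that ab by (auto simp: r)
    qed
  qed
  moreover have "1 \<le> a \<and> 1 \<le> b" if "(a, b) \<in> insert u D" for a b
    using that r j by auto
  ultimately have "young (insert u D)" unfolding young_def using fin by blast
  moreover have "u \<notin> D" using r j by auto
  ultimately show "u \<in> addable D" by (simp add: addable_def)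
qed

lemma finite_addable:
  assumes D: "young D"
  shows "finite (addable D)"
proof -
  obtain r N where r: "\<And>i j. (i, j) \<in> D \<longleftrightarrow> 1 \<le> i \<and> 1 \<le> j \<and> i \<le> r j"
    "\<And>i j. 1 \<le> i \<Longrightarrow> i \<le> j \<Longrightarrow> r j \<le> r i" "\<And>j. N < j \<Longrightarrow> r j = (0::nat)"
    using young_rows[OF D] by blast
  have eq: "addable D = (\<lambda>j. (Suc (r j), j)) ` {j. 1 \<le> j \<and> (j = 1 \<or> r j < r (j - 1))}"
    by (rule addable_rows) (use r young_finite[OF D] in auto)
  have "{j. 1 \<le> j \<and> (j = 1 \<or> r j < r (j - 1))} \<subseteq> {..Suc N}"
  proof
    fix j assume j: "j \<in> {j. 1 \<le> j \<and> (j = 1 \<or> r j < r (j - 1))}"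
    show "j \<in> {..Suc N}" using r(3)[of "j - 1"] j by (cases "N < j - 1") auto
  qed
  then have "finite {j. 1 \<le> j \<and> (j = 1 \<or> r j < r (j - 1))}" by (rule finite_subset) simp
  then show ?thesis unfolding eq by (rule finite_imageI)
qed

lemma removable_rows:
  assumes r: "\<And>i j. (i, j) \<in> D \<longleftrightarrow> 1 \<le> i \<and> 1 \<le> j \<and> i \<le> r j"
    and anti: "\<And>i j. 1 \<le> i \<Longrightarrow> i \<le> j \<Longrightarrow> r j \<le> r i" and fin: "finite D"
  shows "removable D = (\<lambda>j. (r j, j)) ` {j. 1 \<le> j \<and> r (Suc j) < r j}"
proof (intro equalityI subsetI)
  fix u assume u: "u \<in> removable D"
  obtain i j where ij: "u = (i, j)" by (cases u)
  have *: "(i, j) \<in> D" "young (D - {(i, j)})" using u ij by (auto simp: removable_def)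
  have pos: "1 \<le> i" "1 \<le> j" "i \<le> r j" using * r by auto
  have "i = r j"
  proof (rule ccontr)
    assume "i \<noteq> r j"
    then have "(Suc i, j) \<in> D - {(i, j)}" using r pos by auto
    then show False using young_down[OF *(2), of "Suc i" j i j] pos by auto
  qed
  moreover have "r (Suc j) < r j"
  proof (rule ccontr)
    assume "\<not> r (Suc j) < r j"
    then have "(i, Suc j) \<in> D - {(i, j)}" using r pos by auto
    then show False using young_down[OF *(2), of i "Suc j" i j] pos by auto
  qed
  ultimately show "u \<in> (\<lambda>j. (r j, j)) ` {j. 1 \<le> j \<and> r (Suc j) < r j}" using pos ij by auto
next
  fix u assume "u \<in> (\<lambda>j. (r j, j)) ` {j. 1 \<le> j \<and> r (Suc j) < r j}"
  then obtain j where j: "u = (r j, j)" "1 \<le> j" "r (Suc j) < r j" by auto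
  have "(i', j') \<in> D - {u}" if "(a, b) \<in> D - {u}" "1 \<le> i'" "i' \<le> a" "1 \<le> j'" "j' \<le> b" for a b i' j'
  proof -
    have "(i', j') \<noteq> u"
    proof
      assume "(i', j') = u"
      then have *: "i' = r j" "j' = j" using j by auto
      then have "b \<noteq> j" using that j by (auto simp: r)
      then have "r b \<le> r (Suc j)" using anti[of "Suc j" b] that * by auto
      then show False using that j * by (auto simp: r)
    qed
    then show ?thesis using that anti[of j' b] by (auto simp: r)
  qed
  moreover have "1 \<le> a \<and> 1 \<le> b" if "(a, b) \<in> D - {u}" for a b
    using that r by auto
  ultimately have "young (D - {u})" unfolding young_def using fin by blast
  moreover have "u \<in> D" using r j by auto
  ultimately show "u \<in> removable D" by (simp add: removable_def)
qed

abbreviation weight :: "'a::comm_ring_1 \<Rightarrow> nat \<times> nat \<Rightarrow> 'a" where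
  "weight a u \<equiv> a + of_nat (fst u) - of_nat (snd u)"

text \<open>Row by row, a cell added in row \<open>j + 1\<close> of \<open>D\<close> is matched with the cell removed from row
  \<open>j\<close> of \<open>E\<close>; the cell added in the first row is left over.\<close>

lemma sum_weight_strip:
  fixes a :: "'a::comm_ring_1"
  assumes D: "young D" and E: "young E" and sub: "E \<subseteq> D" and inj: "inj_on fst (D - E)"
  shows "(\<Sum>u | u \<in> addable D \<and> fst u \<notin> fst ` (D - E). weight a u) =
    (\<Sum>v | v \<in> removable E \<and> fst v \<notin> fst ` (D - E). weight a v) + (a + of_nat (card (D - E)))"
proof -
  obtain r N1 where r: "\<And>i j. (i, j) \<in> D \<longleftrightarrow> 1 \<le> i \<and> 1 \<le> j \<and> i \<le> r j"
    "\<And>i j. 1 \<le> i \<Longrightarrow> i \<le> j \<Longrightarrow> r j \<le> r i" "\<And>j. N1 < j \<Longrightarrow> r j = (0::nat)"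
    using young_rows[OF D] by blast
  obtain m N2 where m: "\<And>i j. (i, j) \<in> E \<longleftrightarrow> 1 \<le> i \<and> 1 \<le> j \<and> i \<le> m j"
    "\<And>i j. 1 \<le> i \<Longrightarrow> i \<le> j \<Longrightarrow> m j \<le> m i" "\<And>j. N2 < j \<Longrightarrow> m j = (0::nat)"
    using young_rows[OF E] by blast
  define N where "N = Suc (N1 + N2)"
  have N: "r j = 0" "m j = 0" if "N \<le> j" for j using that r(3)[of j] m(3)[of j] by (auto simp: N_def)
  have mr: "m j \<le> r j" if "1 \<le> j" for j
    using that sub m(1)[of "m j" j] r(1)[of "m j" j] by (cases "m j = 0") auto
  \<comment> \<open>Interlacing: a cell of row j + 1 of \<open>D\<close> beyond \<open>m j\<close>
    would put two cells of the strip into one column.\<close>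
  have strip: "r (Suc j) \<le> m j" if "1 \<le> j" for j
  proof (rule ccontr)
    assume *: "\<not> r (Suc j) \<le> m j"
    then have "(r (Suc j), Suc j) \<in> D - E" "(r (Suc j), j) \<in> D - E"
      using that r(2)[of j "Suc j"] m(2)[of j "Suc j"] by (auto simp: r(1) m(1))
    then show False using inj_onD[OF inj, of "(r (Suc j), Suc j)" "(r (Suc j), j)"] by auto
  qed
  \<comment> \<open>Strict interlacing at j. One index set serves both sides: it marks the addable
    cells of \<open>D\<close> in row j + 1 and the removable cells of \<open>E\<close> in row j
    whose columns avoid the strip.\<close>
  let ?J = "{j. 1 \<le> j \<and> r (Suc j) < m j}"
  have JN: "?J \<subseteq> {1..<N}" using N by (force simp: not_less[symmetric])
  have finJ: "finite ?J" using JN finite_subset by blast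
  have addD: "addable D = (\<lambda>j. (Suc (r j), j)) ` {j. 1 \<le> j \<and> (j = 1 \<or> r j < r (j - 1))}"
    by (rule addable_rows) (use r young_finite[OF D] in auto)
  have remE: "removable E = (\<lambda>j. (m j, j)) ` {j. 1 \<le> j \<and> m (Suc j) < m j}"
    by (rule removable_rows) (use m young_finite[OF E] in auto)
  have S1: "{u. u \<in> addable D \<and> fst u \<notin> fst ` (D - E)} =
      insert (Suc (r 1), 1) ((\<lambda>j. (Suc (r (Suc j)), Suc j)) ` ?J)"
  proof (intro equalityI subsetI)
    fix u assume u: "u \<in> {u. u \<in> addable D \<and> fst u \<notin> fst ` (D - E)}"
    then have "u \<in> (\<lambda>j. (Suc (r j), j)) ` {j. 1 \<le> j \<and> (j = 1 \<or> r j < r (j - 1))}"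
      unfolding addD by blast
    then obtain j where j: "u = (Suc (r j), j)" "1 \<le> j" "j = 1 \<or> r j < r (j - 1)"
      by blast
    have j4: "Suc (r j) \<notin> fst ` (D - E)" using u j(1) by simp
    show "u \<in> insert (Suc (r 1), 1) ((\<lambda>j. (Suc (r (Suc j)), Suc j)) ` ?J)"
    proof (cases "j = 1")
      case False
      then obtain l where l: "j = Suc l" "1 \<le> l" using j(2) by (cases j) auto
      have "r (Suc l) < m l"
      proof (rule ccontr)
        assume "\<not> r (Suc l) < m l"
        then have "(Suc (r j), l) \<in> D - E" using j(3) l by (auto simp: r(1) m(1))
        then show False using j4 by force
      qed
      then show ?thesis using j l by auto
    qed (use j in simp)
  next
    fix u assume u: "u \<in> insert (Suc (r 1), 1) ((\<lambda>j. (Suc (r (Suc j)), Suc j)) ` ?J)"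
    have "u \<in> addable D"
      unfolding addD
    proof (cases "u = (Suc (r 1), 1)")
      case False
      then obtain l where "u = (Suc (r (Suc l)), Suc l)" "1 \<le> l" "r (Suc l) < m l" using u by auto
      then show "u \<in> (\<lambda>j. (Suc (r j), j)) ` {j. 1 \<le> j \<and> (j = 1 \<or> r j < r (j - 1))}"
        using mr[of l] by (intro image_eqI[where x = "Suc l"]) auto
    qed auto
    moreover have "fst u \<notin> fst ` (D - E)"
    proof
      assume "fst u \<in> fst ` (D - E)"
      then obtain b where b: "(fst u, b) \<in> D" "(fst u, b) \<notin> E" by force
      then have b': "1 \<le> b" "fst u \<le> r b" "m b < fst u" by (auto simp: r(1) m(1))
      show False
      proof (cases "u = (Suc (r 1), 1)")
        case True
        then show False using b' r(2)[of 1 b] by auto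
      next
        case False
        then obtain l where l: "u = (Suc (r (Suc l)), Suc l)" "1 \<le> l" "r (Suc l) < m l" using u by auto
        then have "b \<le> l" using b' r(2)[of "Suc l" b] by (cases "b \<le> l") auto
        then show False using m(2)[of b l] b' l by auto
      qed
    qed
    ultimately show "u \<in> {u. u \<in> addable D \<and> fst u \<notin> fst ` (D - E)}" by simp
  qed
  have S2: "{v. v \<in> removable E \<and> fst v \<notin> fst ` (D - E)} = (\<lambda>j. (m j, j)) ` ?J"
  proof (intro equalityI subsetI)
    fix v assume "v \<in> {v. v \<in> removable E \<and> fst v \<notin> fst ` (D - E)}"
    then obtain j where j: "v = (m j, j)" "1 \<le> j" "m (Suc j) < m j" "m j \<notin> fst ` (D - E)"
      unfolding remE by auto
    have "r (Suc j) < m j"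
    proof (rule ccontr)
      assume "\<not> r (Suc j) < m j"
      then have "(m j, Suc j) \<in> D - E" using j by (auto simp: r(1) m(1))
      then show False using j(4) by force
    qed
    then show "v \<in> (\<lambda>j. (m j, j)) ` ?J" using j by auto
  next
    fix v assume "v \<in> (\<lambda>j. (m j, j)) ` ?J"
    then obtain j where j: "v = (m j, j)" "1 \<le> j" "r (Suc j) < m j" by auto
    then have "v \<in> removable E"
      unfolding remE using mr[of "Suc j"] by auto
    moreover have "m j \<notin> fst ` (D - E)"
    proof
      assume "m j \<in> fst ` (D - E)"
      then obtain b where b: "(m j, b) \<in> D" "(m j, b) \<notin> E" by force
      then have b': "1 \<le> b" "m j \<le> r b" "m b < m j" by (auto simp: r(1) m(1))
      then have "b \<le> j" using j r(2)[of "Suc j" b] by (cases "b \<le> j") auto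
      then show False using m(2)[of b j] b' by auto
    qed
    ultimately show "v \<in> {v. v \<in> removable E \<and> fst v \<notin> fst ` (D - E)}" using j by simp
  qed
  have "card D = (\<Sum>j=1..N. r j)" by (rule card_rows[OF r(1)]) (use N in auto)
  also have "\<dots> = r 1 + (\<Sum>j=1..<N. r (Suc j))"
    unfolding N_def atLeastLessThanSuc_atLeastAtMost
    using sum.atLeast_Suc_atMost_Suc_shift[of r 1 "N1 + N2"]
    by (subst sum.atLeast_Suc_atMost) (simp_all del: sum.cl_ivl_Suc)
  finally have cD: "card D = r 1 + (\<Sum>j=1..<N. r (Suc j))" .
  have "card E = (\<Sum>j=1..N. m j)" by (rule card_rows[OF m(1)]) (use N in auto)
  also have "\<dots> = (\<Sum>j=1..<N. m j)" using N(2)[of N] by (cases N) (auto simp: atLeastLessThanSuc_atLeastAtMost)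
  finally have cE: "card E = (\<Sum>j=1..<N. m j)" .
  have cDE: "card (D - E) + card E = card D"
    using card_Diff_subset[OF young_finite[OF E] sub] card_mono[OF young_finite[OF D] sub] by simp
  have "(\<Sum>u | u \<in> addable D \<and> fst u \<notin> fst ` (D - E). weight a u) =
      (a + of_nat (r 1)) + (\<Sum>j\<in>?J. weight a (Suc (r (Suc j)), Suc j))"
    unfolding S1 using finJ
    by (subst sum.insert) (auto simp: sum.reindex inj_on_def)
  also have "(\<Sum>j\<in>?J. weight a (Suc (r (Suc j)), Suc j)) =
      (\<Sum>j\<in>?J. weight a (m j, j)) + (\<Sum>j\<in>?J. of_nat (r (Suc j)) - of_nat (m j))"
    unfolding sum.distrib[symmetric] by (intro sum.cong) auto
  also have "(\<Sum>j\<in>?J. weight a (m j, j)) = (\<Sum>v | v \<in> removable E \<and> fst v \<notin> fst ` (D - E). weight a v)"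
    unfolding S2 by (simp add: sum.reindex inj_on_def)
  \<comment> \<open>By interlacing the terms outside \<open>?J\<close> vanish, so the differences
    sum over all rows, to the size of \<open>D\<close> without its first row minus the size of
    \<open>E\<close>. Together with \<open>r 1\<close> this is \<open>card (D - E)\<close>.\<close>
  also have "(\<Sum>j\<in>?J. of_nat (r (Suc j)) - of_nat (m j)) = (\<Sum>j=1..<N. of_nat (r (Suc j)) - of_nat (m j) :: 'a)"
  proof (rule sum.mono_neutral_left[OF _ JN])
    show "\<forall>j\<in>{1..<N} - ?J. of_nat (r (Suc j)) - of_nat (m j) = (0 :: 'a)"
    proof
      fix j assume "j \<in> {1..<N} - ?J"
      then have "r (Suc j) = m j" using strip[of j] by auto
      then show "of_nat (r (Suc j)) - of_nat (m j) = (0 :: 'a)" by simp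
    qed
  qed simp
  also have "\<dots> = of_nat (\<Sum>j=1..<N. r (Suc j)) - of_nat (card E)"
    unfolding cE by (simp add: sum_subtractf)
  finally have sum_eq: "(\<Sum>u | u \<in> addable D \<and> fst u \<notin> fst ` (D - E). weight a u) =
      a + of_nat (r 1) + ((\<Sum>v | v \<in> removable E \<and> fst v \<notin> fst ` (D - E). weight a v) +
      (of_nat (\<Sum>j=1..<N. r (Suc j)) - of_nat (card E)))" .
  have cDE': "of_nat (card (D - E)) = of_nat (r 1) + of_nat (\<Sum>j=1..<N. r (Suc j)) - (of_nat (card E) :: 'a)"
    using arg_cong[OF cDE, of "of_nat :: nat \<Rightarrow> 'a"] unfolding cD of_nat_add
    by (simp only: eq_diff_eq)
  show ?thesis unfolding sum_eq cDE' by (simp add: algebra_simps)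
qed

text \<open>Two routes from \<open>D\<close> to \<open>E\<close> are compared: adding a cell and
  then removing a k-strip, or removing a k-strip and then adding a cell. If \<open>E\<close> leaves
  \<open>D\<close>, both routes can only add the single cell of \<open>E - D\<close>, with the same
  weight. If \<open>E\<close> lies inside \<open>D\<close>, the strip \<open>D - E\<close> has k - 1
  cells and \<open>sum_weight_strip\<close> gives the discrepancy.\<close>

lemma strip_commute:
  fixes a :: "'a::comm_ring_1"
  assumes D: "young D" and E: "young E"
  shows "(\<Sum>u | u \<in> addable D \<and> E \<in> strip_removals (insert u D) k. weight a u) =
    (\<Sum>v | v \<in> removable E \<and> E - {v} \<in> strip_removals D k. weight a v) +
    (if 0 < k \<and> E \<in> strip_removals D (k - 1) then a + of_nat k - 1 else 0)"
proof (cases "E \<subseteq> D")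
  case False
  have *: "u \<in> addable D \<and> E \<in> strip_removals (insert u D) k \<longleftrightarrow>
      u \<in> removable E \<and> E - {u} \<in> strip_removals D k" for u
  proof (cases "E - D = {u}")
    case True
    then have u: "u \<in> E" "u \<notin> D" "E \<subseteq> insert u D" "E - {u} \<subseteq> D" by auto
    have "young (insert u D)" unfolding young_def
    proof (intro conjI allI impI)
      fix i1 j1 i' j'
      assume "(i1, j1) \<in> insert u D \<and> 1 \<le> i' \<and> i' \<le> i1 \<and> 1 \<le> j' \<and> j' \<le> j1"
      then show "(i', j') \<in> insert u D"
        using young_down[OF D, of i1 j1 i' j'] young_down[OF E, of i1 j1 i' j'] u by auto
    qed (use young_pos[OF D] young_pos[OF E] young_finite[OF D] u in auto)
    moreover have "young (E - {u})" unfolding young_def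
    proof (intro conjI allI impI)
      fix i1 j1 i' j'
      assume *: "(i1, j1) \<in> E - {u} \<and> 1 \<le> i' \<and> i' \<le> i1 \<and> 1 \<le> j' \<and> j' \<le> j1"
      then have "(i1, j1) \<in> D" using u by auto
      then show "(i', j') \<in> E - {u}"
        using young_down[OF D, of i1 j1 i' j'] young_down[OF E, of i1 j1 i' j'] u * by auto
    qed (use young_pos[OF E] young_finite[OF E] in auto)
    moreover have "insert u D - E = D - (E - {u})" using u by auto
    ultimately show ?thesis
      using u E by (simp add: addable_def removable_def strip_removals_def)
  next
    case neq: False
    have "\<not> E \<subseteq> insert u D" using False neq by blast
    moreover have "\<not> (u \<in> E \<and> E - {u} \<subseteq> D)" using False neq by blast
    ultimately show ?thesis by (auto simp: removable_def strip_removals_def)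
  qed
  show ?thesis unfolding * using False by (simp add: strip_removals_def)
next
  case sub: True
  note finD = young_finite[OF D] and finE = young_finite[OF E]
  have add: "E \<in> strip_removals (insert u D) k \<longleftrightarrow>
      inj_on fst (D - E) \<and> Suc (card (D - E)) = k \<and> fst u \<notin> fst ` (D - E)" if "u \<in> addable D" for u
  proof -
    have u: "u \<notin> D" using that by (simp add: addable_def)
    then have "insert u D - E = insert u (D - E)" "u \<notin> D - E" "D - E - {u} = D - E" using sub by auto
    then show ?thesis using sub finD E unfolding strip_removals_def by auto
  qed
  have rem: "E - {v} \<in> strip_removals D k \<longleftrightarrow>
      inj_on fst (D - E) \<and> Suc (card (D - E)) = k \<and> fst v \<notin> fst ` (D - E)" if "v \<in> removable E" for v
  proof -
    have v: "v \<in> E" "young (E - {v})" using that by (simp_all add: removable_def)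
    then have "D - (E - {v}) = insert v (D - E)" "v \<notin> D - E" "D - E - {v} = D - E" "E - {v} \<subseteq> D"
      using sub by auto
    then show ?thesis using sub finD v unfolding strip_removals_def by auto
  qed
  show ?thesis
  proof (cases "inj_on fst (D - E) \<and> Suc (card (D - E)) = k")
    case True
    then have "E \<in> strip_removals D (k - 1)" "0 < k" "of_nat k = (1 + of_nat (card (D - E)) :: 'a)"
      using sub E by (auto simp: strip_removals_def)
    moreover have "{u. u \<in> addable D \<and> E \<in> strip_removals (insert u D) k} =
        {u. u \<in> addable D \<and> fst u \<notin> fst ` (D - E)}" using add True by blast
    moreover have "{v. v \<in> removable E \<and> E - {v} \<in> strip_removals D k} =
        {v. v \<in> removable E \<and> fst v \<notin> fst ` (D - E)}" using rem True by blast
    ultimately show ?thesis using sum_weight_strip[OF D E sub, of a] True by simp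
  next
    case False
    then have "{u. u \<in> addable D \<and> E \<in> strip_removals (insert u D) k} = {}"
      "{v. v \<in> removable E \<and> E - {v} \<in> strip_removals D k} = {}" using add rem by blast+
    moreover have "\<not> (0 < k \<and> E \<in> strip_removals D (k - 1))"
      using False by (auto simp: strip_removals_def)
    ultimately show ?thesis by (simp only: sum.empty if_False add_0)
  qed
qed

text \<open>The content-weighted Pieri rule. On Schur functions it says that adding a cell of content
  \<open>c\<close> with coefficient \<open>a + c\<close> is the differential operator
  \<open>\<Sum>\<^sub>i (a x\<^sub>i + x\<^sub>i\<^sup>2 \<partial>\<^sub>i)\<close>.\<close>

lemma content_pieri:
  fixes a :: "'a::comm_ring_1"
  assumes "young D" "\<And>k. M \<le> k \<Longrightarrow> x k = 0"
  shows "(\<Sum>u\<in>addable D. weight a u * of_nat (kostka (insert u D) x)) =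
    (\<Sum>k | k < M \<and> 0 < x k. (a + of_nat (x k) - 1) * of_nat (kostka D (x(k := x k - 1))))"
  using assms
proof (induction M arbitrary: D x)
  case 0
  have "kostka (insert u D) x = 0" if "u \<in> addable D" for u
  proof -
    have "x = (\<lambda>_. 0)" using 0 by auto
    then show ?thesis using kostka_content_zero[of "insert u D"] young_finite[OF 0(1)] by simp
  qed
  then show ?case by simp
next
  case (Suc M)
  note D = Suc.prems(1)
  let ?x = "x(M := 0)" and ?k = "x M"
  let ?K = "\<lambda>E x. of_nat (kostka E x) :: 'a"
  \<comment> \<open>All shapes reached by adding a cell to \<open>D\<close> and removing a strip of
    size \<open>?k\<close> lie in this finite set, so sums over cells and over shapes can be
    exchanged.\<close>
  let ?Z = "shapes (card D + 1 - ?k)"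
  have x: "x k = 0" if "M < k" for k using Suc.prems(2)[of k] that by simp
  have branch: "?K E y = (\<Sum>F\<in>strip_removals E (y M). ?K F (y(M := 0)))"
    if "young E" "\<And>k. M < k \<Longrightarrow> y k = 0" for E y
    using kostka_branch[OF that, of M] by simp
  have Z: "E \<in> ?Z" if "E \<in> strip_removals (insert u D) ?k" "u \<in> addable D" for E u
    using card_strip_removal[of "insert u D" E ?k] that young_finite[OF D]
    by (auto simp: shapes_def addable_def strip_removals_def)
  have "(\<Sum>u\<in>addable D. weight a u * ?K (insert u D) x) =
      (\<Sum>u\<in>addable D. \<Sum>E | E \<in> ?Z \<and> E \<in> strip_removals (insert u D) ?k. weight a u * ?K E ?x)"
  proof (intro sum.cong refl)
    fix u assume u: "u \<in> addable D"
    have "{E. E \<in> ?Z \<and> E \<in> strip_removals (insert u D) ?k} = strip_removals (insert u D) ?k"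
      using Z u by blast
    moreover have "?K (insert u D) x = (\<Sum>E\<in>strip_removals (insert u D) ?k. ?K E ?x)"
      using branch[of "insert u D" x] x u by (simp add: addable_def)
    ultimately show "weight a u * ?K (insert u D) x =
        (\<Sum>E | E \<in> ?Z \<and> E \<in> strip_removals (insert u D) ?k. weight a u * ?K E ?x)"
      by (simp add: sum_distrib_left)
  qed
  also have "\<dots> = (\<Sum>E\<in>?Z. \<Sum>u | u \<in> addable D \<and> E \<in> strip_removals (insert u D) ?k. weight a u * ?K E ?x)"
    by (rule sum.swap_restrict) (simp_all add: finite_addable D finite_shapes)
  also have "\<dots> = (\<Sum>E\<in>?Z. (\<Sum>v | v \<in> removable E \<and> E - {v} \<in> strip_removals D ?k. weight a v * ?K E ?x) +
      (if 0 < ?k \<and> E \<in> strip_removals D (?k - 1) then (a + of_nat ?k - 1) * ?K E ?x else 0))"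
  proof (intro sum.cong refl)
    fix E assume "E \<in> ?Z"
    then have "young E" by (simp add: shapes_def)
    from strip_commute[OF D this, where k = ?k and a = a]
    show "(\<Sum>u | u \<in> addable D \<and> E \<in> strip_removals (insert u D) ?k. weight a u * ?K E ?x) =
        (\<Sum>v | v \<in> removable E \<and> E - {v} \<in> strip_removals D ?k. weight a v * ?K E ?x) +
        (if 0 < ?k \<and> E \<in> strip_removals D (?k - 1) then (a + of_nat ?k - 1) * ?K E ?x else 0)"
      unfolding sum_distrib_right[symmetric] by (simp add: distrib_right)
  qed
  also have "\<dots> = (\<Sum>E\<in>?Z. \<Sum>v | v \<in> removable E \<and> E - {v} \<in> strip_removals D ?k. weight a v * ?K E ?x) +
      (\<Sum>E\<in>?Z. if 0 < ?k \<and> E \<in> strip_removals D (?k - 1) then (a + of_nat ?k - 1) * ?K E ?x else 0)"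
    by (rule sum.distrib)
  \<comment> \<open>The correction terms run over strips of size \<open>?k - 1\<close> and
    recombine, by branching, to the Kostka number with the last exponent lowered by one.\<close>
  also have "(\<Sum>E\<in>?Z. if 0 < ?k \<and> E \<in> strip_removals D (?k - 1) then (a + of_nat ?k - 1) * ?K E ?x else 0) =
      (if 0 < ?k then (a + of_nat ?k - 1) * ?K D (x(M := ?k - 1)) else 0)"
  proof (cases "0 < ?k")
    case True
    have "strip_removals D (?k - 1) \<subseteq> ?Z"
      using card_strip_removal[OF young_finite[OF D]] True
      by (auto simp: shapes_def strip_removals_def)
    then have "?Z \<inter> strip_removals D (?k - 1) = strip_removals D (?k - 1)" by blast
    moreover have "?K D (x(M := ?k - 1)) = (\<Sum>F\<in>strip_removals D (?k - 1). ?K F ?x)"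
      using branch[OF D, of "x(M := ?k - 1)"] x by simp
    ultimately show ?thesis using True finite_shapes
      by (simp add: sum.inter_restrict[symmetric] sum_distrib_left)
  qed simp
  also have "(\<Sum>E\<in>?Z. \<Sum>v | v \<in> removable E \<and> E - {v} \<in> strip_removals D ?k. weight a v * ?K E ?x) =
      (\<Sum>(E, v)\<in>(SIGMA E:?Z. {v. v \<in> removable E \<and> E - {v} \<in> strip_removals D ?k}). weight a v * ?K E ?x)"
    by (rule sum.Sigma[OF finite_shapes]) (auto simp: shapes_def removable_def dest: young_finite)
  also have "\<dots> = (\<Sum>(F, v)\<in>(SIGMA F:strip_removals D ?k. addable F). weight a v * ?K (insert v F) ?x)"
  proof (rule sum.reindex_bij_witness[where i = "\<lambda>(F, v). (insert v F, v)" and j = "\<lambda>(E, v). (E - {v}, v)"], goal_cases)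
    case (4 p)
    then obtain F v where p: "p = (F, v)" "F \<in> strip_removals D ?k" "v \<in> addable F" by auto
    then have v: "v \<notin> F" "young (insert v F)" "young F" "finite F"
      using young_finite by (auto simp: addable_def strip_removals_def)
    have "card D = card F + ?k" using card_strip_removal[OF young_finite[OF D] p(2)] .
    then show ?case using p v by (auto simp: shapes_def removable_def)
  qed (auto simp: shapes_def removable_def addable_def insert_absorb)
  also have "\<dots> = (\<Sum>F\<in>strip_removals D ?k. \<Sum>v\<in>addable F. weight a v * ?K (insert v F) ?x)"
    by (rule sum.Sigma[symmetric])
      (auto simp: finite_strip_removals young_finite D strip_removals_def intro: finite_addable)
  \<comment> \<open>With the strip removed first, the added cell concerns only entries below
    \<open>M\<close>, where the induction hypothesis applies to \<open>F\<close>.\<close>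
  also have "\<dots> = (\<Sum>F\<in>strip_removals D ?k. \<Sum>k | k < M \<and> 0 < ?x k. (a + of_nat (?x k) - 1) * ?K F (?x(k := ?x k - 1)))"
  proof (intro sum.cong refl)
    fix F assume "F \<in> strip_removals D ?k"
    then have "young F" by (simp add: strip_removals_def)
    moreover have "?x k = 0" if "M \<le> k" for k using x[of k] that by auto
    ultimately show "(\<Sum>v\<in>addable F. weight a v * ?K (insert v F) ?x) =
        (\<Sum>k | k < M \<and> 0 < ?x k. (a + of_nat (?x k) - 1) * ?K F (?x(k := ?x k - 1)))"
      by (rule Suc.IH)
  qed
  also have "\<dots> = (\<Sum>k | k < M \<and> 0 < ?x k. \<Sum>F\<in>strip_removals D ?k. (a + of_nat (?x k) - 1) * ?K F (?x(k := ?x k - 1)))"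
    by (rule sum.swap)
  also have "\<dots> = (\<Sum>k | k < M \<and> 0 < x k. (a + of_nat (x k) - 1) * ?K D (x(k := x k - 1)))"
  proof (intro sum.cong)
    fix k assume "k \<in> {k. k < M \<and> 0 < x k}"
    then have k: "k < M" by simp
    then have "?x(k := ?x k - 1) = (x(k := x k - 1))(M := 0)" by auto
    moreover have "?K D (x(k := x k - 1)) = (\<Sum>F\<in>strip_removals D ?k. ?K F ((x(k := x k - 1))(M := 0)))"
      using branch[OF D, of "x(k := x k - 1)"] x k by simp
    ultimately show "(\<Sum>F\<in>strip_removals D ?k. (a + of_nat (?x k) - 1) * ?K F (?x(k := ?x k - 1))) =
        (a + of_nat (x k) - 1) * ?K D (x(k := x k - 1))"
      using k by (simp add: sum_distrib_left)
  qed auto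
  also have "\<dots> + (if 0 < ?k then (a + of_nat ?k - 1) * ?K D (x(M := ?k - 1)) else 0) =
      (\<Sum>k | k < Suc M \<and> 0 < x k. (a + of_nat (x k) - 1) * ?K D (x(k := x k - 1)))"
  proof (cases "0 < ?k")
    case True
    then have "{k. k < Suc M \<and> 0 < x k} = insert M {k. k < M \<and> 0 < x k}" by auto
    then show ?thesis using True by (simp add: add.commute)
  next
    case False
    then have "{k. k < Suc M \<and> 0 < x k} = {k. k < M \<and> 0 < x k}" by (auto simp: less_Suc_eq)
    then show ?thesis using False by simp
  qed
  finally show ?case .
qed

section \<open>Standard tableaux and content products\<close>

definition syt_number :: "(nat \<times> nat) set \<Rightarrow> nat" where
  "syt_number D = kostka D (\<lambda>k. if k \<in> {1..card D} then 1 else 0)"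

lemma strip_removals_1: "strip_removals D 1 = (\<lambda>v. D - {v}) ` removable D"
proof (intro equalityI subsetI)
  fix E assume "E \<in> strip_removals D 1"
  then have E: "young E" "E \<subseteq> D" "card (D - E) = 1" by (auto simp: strip_removals_def)
  then obtain v where v: "D - E = {v}" by (auto simp: card_1_singleton_iff)
  then have "E = D - {v}" "v \<in> D" using E by auto
  then show "E \<in> (\<lambda>v. D - {v}) ` removable D" using E by (auto simp: removable_def)
next
  fix E assume "E \<in> (\<lambda>v. D - {v}) ` removable D"
  then obtain v where v: "E = D - {v}" "v \<in> D" "young (D - {v})" by (auto simp: removable_def)
  then have "D - E = {v}" by auto
  then show "E \<in> strip_removals D 1" using v by (auto simp: strip_removals_def)
qed

lemma syt_number_rec:
  assumes "young D" "D \<noteq> {}"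
  shows "syt_number D = (\<Sum>v\<in>removable D. syt_number (D - {v}))"
proof -
  let ?x = "\<lambda>n k. if k \<in> {1..n} then 1 else 0 :: nat"
  obtain n where n: "card D = Suc n"
    using assms young_finite[OF assms(1)] by (cases "card D") auto
  have "syt_number D = (\<Sum>E\<in>strip_removals D 1. kostka E ((?x (Suc n))(Suc n := 0)))"
    using kostka_branch[OF assms(1), of "Suc n" "?x (Suc n)"] by (simp add: syt_number_def n)
  also have "(?x (Suc n))(Suc n := 0) = ?x n" by auto
  also have "(\<Sum>E\<in>strip_removals D 1. kostka E (?x n)) = (\<Sum>v\<in>removable D. kostka (D - {v}) (?x n))"
    unfolding strip_removals_1 by (rule sum.reindex_cong) (auto simp: removable_def inj_on_def)
  also have "\<dots> = (\<Sum>v\<in>removable D. syt_number (D - {v}))"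
    using n young_finite[OF assms(1)] by (intro sum.cong) (auto simp: removable_def syt_number_def)
  finally show ?thesis .
qed

definition content_coeff :: "'a::comm_ring_1 \<Rightarrow> (nat \<times> nat) set \<Rightarrow> 'a" where
  "content_coeff a D = of_nat (syt_number D) * (\<Prod>u\<in>D. weight a u)"

lemma content_coeff_rec:
  assumes "young D" "D \<noteq> {}"
  shows "content_coeff a D = (\<Sum>v\<in>removable D. content_coeff a (D - {v}) * weight a v)"
proof -
  have "(\<Prod>u\<in>D. weight a u) = weight a v * (\<Prod>u\<in>D - {v}. weight a u)" if "v \<in> removable D" for v
    using that young_finite[OF assms(1)] by (intro prod.remove) (auto simp: removable_def)
  then show ?thesis
    unfolding content_coeff_def syt_number_rec[OF assms] of_nat_sum sum_distrib_right
    by (intro sum.cong) (simp_all only: mult_ac)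
qed

lemma sum_content_coeff_kostka:
  fixes a :: "'a::field_char_0"
  assumes "\<And>k. M \<le> k \<Longrightarrow> x k = 0" "(\<Sum>k<M. x k) = n"
  shows "(\<Sum>D\<in>shapes n. content_coeff a D * of_nat (kostka D x)) =
    fact n * (\<Prod>k<M. pochhammer a (x k) / fact (x k))"
  using assms
proof (induction n arbitrary: x)
  case 0
  then have x0: "x = (\<lambda>_. 0)" by (intro ext) (metis finite_lessThan leI lessThan_iff sum_eq_0_iff)
  have "syt_number {} = 1" using kostka_empty by (simp add: syt_number_def)
  then show ?case unfolding x0 by (simp add: shapes_0 content_coeff_def kostka_empty)
next
  case (Suc n)
  let ?K = "\<lambda>E x. of_nat (kostka E x) :: 'a"
  let ?g = "\<lambda>x. \<Prod>k<M. pochhammer a (x k) / fact (x k)"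
  let ?x = "\<lambda>k. x(k := x k - 1)"
  have finsh: "D \<in> shapes m \<Longrightarrow> finite D" for D m by (auto simp: shapes_def dest: young_finite)
  have "(\<Sum>D\<in>shapes (Suc n). content_coeff a D * ?K D x) =
      (\<Sum>D\<in>shapes (Suc n). \<Sum>v\<in>removable D. content_coeff a (D - {v}) * weight a v * ?K D x)"
  proof (intro sum.cong refl)
    fix D assume "D \<in> shapes (Suc n)"
    then have "young D" "D \<noteq> {}" by (auto simp: shapes_def)
    then show "content_coeff a D * ?K D x = (\<Sum>v\<in>removable D. content_coeff a (D - {v}) * weight a v * ?K D x)"
      by (simp add: content_coeff_rec sum_distrib_right)
  qed
  also have "\<dots> = (\<Sum>(D, v)\<in>(SIGMA D:shapes (Suc n). removable D). content_coeff a (D - {v}) * weight a v * ?K D x)"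
    by (rule sum.Sigma) (auto simp: finite_shapes intro: finite_removable finsh)
  \<comment> \<open>A removable cell of \<open>D\<close> is read as an addable cell of the smaller
    shape: the recursion of the coefficients is traded for the Pieri rule.\<close>
  also have "\<dots> = (\<Sum>(E, u)\<in>(SIGMA E:shapes n. addable E). content_coeff a E * weight a u * ?K (insert u E) x)"
    by (rule sum.reindex_bij_witness[where i = "\<lambda>(E, v). (insert v E, v)" and j = "\<lambda>(D, v). (D - {v}, v)"])
      (auto simp: shapes_def addable_def removable_def insert_absorb dest: young_finite)
  also have "\<dots> = (\<Sum>E\<in>shapes n. \<Sum>u\<in>addable E. content_coeff a E * weight a u * ?K (insert u E) x)"
    by (rule sum.Sigma[OF finite_shapes, symmetric]) (auto simp: shapes_def intro: finite_addable)
  also have "\<dots> = (\<Sum>E\<in>shapes n. \<Sum>k | k < M \<and> 0 < x k. content_coeff a E * ((a + of_nat (x k) - 1) * ?K E (?x k)))"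
  proof (intro sum.cong refl)
    fix E assume "E \<in> shapes n"
    then have "young E" by (simp add: shapes_def)
    from content_pieri[OF this, where M = M and x = x and a = a] Suc.prems(1)
    show "(\<Sum>u\<in>addable E. content_coeff a E * weight a u * ?K (insert u E) x) =
        (\<Sum>k | k < M \<and> 0 < x k. content_coeff a E * ((a + of_nat (x k) - 1) * ?K E (?x k)))"
      unfolding sum_distrib_left[symmetric] mult.assoc by simp
  qed
  also have "\<dots> = (\<Sum>k | k < M \<and> 0 < x k. \<Sum>E\<in>shapes n. content_coeff a E * ((a + of_nat (x k) - 1) * ?K E (?x k)))"
    by (rule sum.swap)
  also have "\<dots> = (\<Sum>k | k < M \<and> 0 < x k. fact n * of_nat (x k) * ?g x)"
  proof (intro sum.cong refl)
    fix k assume "k \<in> {k. k < M \<and> 0 < x k}"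
    then have k: "k < M" "0 < x k" by auto
    then obtain y where y: "x k = Suc y" by (cases "x k") auto
    have "(\<Sum>E\<in>shapes n. content_coeff a E * ((a + of_nat (x k) - 1) * ?K E (?x k))) =
        (a + of_nat (x k) - 1) * (\<Sum>E\<in>shapes n. content_coeff a E * ?K E (?x k))"
      by (simp add: sum_distrib_left mult_ac)
    also have "(\<Sum>E\<in>shapes n. content_coeff a E * ?K E (?x k)) = fact n * ?g (?x k)"
    proof (rule Suc.IH)
      have "(\<Sum>j<M. x j) = x k + (\<Sum>j\<in>{..<M} - {k}. x j)"
        using k by (intro sum.remove) auto
      moreover have "(\<Sum>j<M. ?x k j) = (x k - 1) + (\<Sum>j\<in>{..<M} - {k}. x j)"
        using k by (subst sum.remove[of _ k]) auto
      ultimately show "(\<Sum>j<M. ?x k j) = n" using Suc.prems(2) k by simp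
    qed (use Suc.prems(1) k in auto)
    also have "(a + of_nat (x k) - 1) * (fact n * ?g (?x k)) = fact n * ((a + of_nat (x k) - 1) * ?g (?x k))"
      by (simp only: mult_ac)
    \<comment> \<open>Lowering \<open>x k\<close> by one divides the k-th factor by
      \<open>(a + x k - 1) / x k\<close>.\<close>
    also have "(a + of_nat (x k) - 1) * ?g (?x k) = of_nat (x k) * ?g x"
    proof -
      let ?P = "\<Prod>j\<in>{..<M} - {k}. pochhammer a (x j) / fact (x j)"
      have g: "?g x = pochhammer a (x k) / fact (x k) * ?P" using k by (intro prod.remove) auto
      have g': "?g (?x k) = pochhammer a y / fact y * ?P"
        using k by (subst prod.remove[of _ k]) (auto simp: y)
      have "pochhammer a (x k) / fact (x k) * of_nat (x k) = (a + of_nat (x k) - 1) * (pochhammer a y / fact y)"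
        using of_nat_neq_0[of y, where 'a = 'a]
        by (simp add: y pochhammer_Suc field_simps del: of_nat_Suc) (simp add: algebra_simps)
      then have "(a + of_nat (x k) - 1) * (pochhammer a y / fact y) * ?P =
          pochhammer a (x k) / fact (x k) * of_nat (x k) * ?P" by (rule arg_cong[OF sym])
      then show ?thesis unfolding g g' by (simp only: mult_ac)
    qed
    finally show "(\<Sum>E\<in>shapes n. content_coeff a E * ((a + of_nat (x k) - 1) * ?K E (?x k))) =
        fact n * of_nat (x k) * ?g x" by (simp only: mult_ac)
  qed
  \<comment> \<open>The exponents add up to \<open>Suc n\<close>, which turns \<open>fact n\<close>
    into \<open>fact (Suc n)\<close>.\<close>
  also have "\<dots> = fact n * ?g x * of_nat (\<Sum>k | k < M \<and> 0 < x k. x k)"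
    by (simp add: sum_distrib_left mult_ac)
  also have "(\<Sum>k | k < M \<and> 0 < x k. x k) = Suc n"
    unfolding Suc.prems(2)[symmetric] by (rule sum.mono_neutral_left) auto
  finally show ?case by (simp add: mult_ac)
qed

section \<open>Schur expansions\<close>

text \<open>Take a partition of least rank \<open>r\<close> at which two expansions differ and
  compare coefficients at its test monomial: all other terms agree or vanish there. Only finitely
  many partitions are involved, so an integer rank is enough, and minus the length can serve for
  power sums.\<close>

lemma has_expansion_unique:
  fixes b :: "nat list \<Rightarrow> 'a::idom series" and r :: "nat list \<Rightarrow> int"
  assumes tri: "\<And>la mu. is_partition la \<Longrightarrow> is_partition mu \<Longrightarrow> b mu (pt la) \<noteq> 0 \<Longrightarrow> mu = la \<or> r mu < r la"
    and diag: "\<And>la. is_partition la \<Longrightarrow> b la (pt la) \<noteq> 0"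
    and c: "has_expansion b c f" and c': "has_expansion b c' f"
  shows "c = c'"
proof (rule ccontr)
  assume "c \<noteq> c'"
  let ?U = "{la. c la \<noteq> 0} \<union> {la. c' la \<noteq> 0}"
  let ?S = "{la. c la \<noteq> c' la}"
  have fin: "finite ?U" using c c' by (simp add: has_expansion_def)
  have "?S \<subseteq> ?U" by auto
  then have finS: "finite ?S" using fin finite_subset by blast
  have "?S \<noteq> {}" using \<open>c \<noteq> c'\<close> by auto
  define R where "R = Min (r ` ?S)"
  have "R \<in> r ` ?S" unfolding R_def using finS \<open>?S \<noteq> {}\<close> by (intro Min_in) auto
  then obtain la where la: "la \<in> ?S" "r la = R" by auto
  have min: "r la \<le> r mu" if "mu \<in> ?S" for mu
    unfolding la(2) R_def using finS that by (intro Min_le) auto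
  have part: "is_partition mu" if "mu \<in> ?U" for mu using c c' that by (auto simp: has_expansion_def)
  have la_U: "la \<in> ?U" using la(1) by auto
  have "f (pt la) = (\<Sum>mu | c mu \<noteq> 0. c mu * b mu (pt la))"
    using c unfolding has_expansion_def by metis
  also have "\<dots> = (\<Sum>mu\<in>?U. c mu * b mu (pt la))" by (rule sum.mono_neutral_left) (use fin in auto)
  finally have f1: "f (pt la) = (\<Sum>mu\<in>?U. c mu * b mu (pt la))" .
  have "f (pt la) = (\<Sum>mu | c' mu \<noteq> 0. c' mu * b mu (pt la))"
    using c' unfolding has_expansion_def by metis
  also have "\<dots> = (\<Sum>mu\<in>?U. c' mu * b mu (pt la))" by (rule sum.mono_neutral_left) (use fin in auto)
  finally have "0 = (\<Sum>mu\<in>?U. (c mu - c' mu) * b mu (pt la))"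
    unfolding f1 left_diff_distrib sum_subtractf by simp
  also have "\<dots> = (\<Sum>mu\<in>?U. if mu = la then (c la - c' la) * b la (pt la) else 0)"
  proof (intro sum.cong refl)
    fix mu assume mu: "mu \<in> ?U"
    show "(c mu - c' mu) * b mu (pt la) = (if mu = la then (c la - c' la) * b la (pt la) else 0)"
      using tri[OF part[OF la_U] part[OF mu]] min[of mu] by (cases "c mu = c' mu") auto
  qed
  also have "\<dots> = (c la - c' la) * b la (pt la)" using fin la_U by (subst sum.delta) auto
  finally show False using la(1) diag[OF part[OF la_U]] by simp
qed

lemma has_expansion_single:
  "is_partition la \<Longrightarrow> has_expansion b (\<lambda>mu. if mu = la then 1 else 0) (b la)"
  by (auto simp: has_expansion_def)

lemma has_expansionI:
  assumes "finite A" "\<And>la. la \<in> A \<Longrightarrow> is_partition la" "\<And>la. la \<notin> A \<Longrightarrow> c la = 0"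
    and "\<And>x. f x = (\<Sum>la\<in>A. c la * b la x)"
  shows "has_expansion b c f"
proof -
  have sub: "{la. c la \<noteq> 0} \<subseteq> A" using assms(3) by auto
  have "f x = (\<Sum>la | c la \<noteq> 0. c la * b la x)" for x
    unfolding assms(4) by (rule sum.mono_neutral_right) (use sub assms(1) in auto)
  then show ?thesis using sub assms finite_subset[OF sub] by (auto simp: has_expansion_def)
qed

lemma coords_eqI:
  assumes "has_expansion b c f" "\<And>c'. has_expansion b c' f \<Longrightarrow> c' = c"
  shows "coords b f = c"
  unfolding coords_def using assms by (rule the_equality)

section \<open>Partitions as lists and as diagrams\<close>

lemma nth_default_nonzero_iff: "is_partition la \<Longrightarrow> 0 < nth_default 0 la k \<longleftrightarrow> k < length la"
  by (auto simp: nth_default_def is_partition_def intro!: gr0I dest: nth_mem)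

lemma nth_default_antimono:
  assumes "is_partition la" "i \<le> j"
  shows "nth_default 0 la j \<le> nth_default 0 la i"
  using assms sorted_wrt_nth_less[of "(\<ge>)" la i j]
  by (cases "i = j") (auto simp: nth_default_def is_partition_def)

lemma is_partition_eqI:
  assumes "is_partition la" "is_partition mu" "\<And>k. nth_default 0 la k = nth_default 0 mu k"
  shows "la = mu"
proof -
  have "length la = length mu"
    using nth_default_nonzero_iff[OF assms(1)] nth_default_nonzero_iff[OF assms(2)] assms(3)
    by (metis linorder_neqE_nat less_irrefl)
  then show ?thesis using assms(3) by (intro nth_equalityI) (auto simp: nth_default_def split: if_splits, metis)
qed

lemma diagram_rows: "(i, j) \<in> diagram la \<longleftrightarrow> 1 \<le> i \<and> 1 \<le> j \<and> i \<le> nth_default 0 la (j - 1)"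
  by (auto simp: diagram_def nth_default_def)

lemma card_diagram: "card (diagram la) = sum_list la"
proof -
  have "card (diagram la) = (\<Sum>j=1..length la. nth_default 0 la (j - 1))"
    by (rule card_rows[OF diagram_rows]) (auto simp: nth_default_def)
  also have "\<dots> = (\<Sum>j<length la. la ! j)"
    by (rule sum.reindex_bij_witness[of _ Suc "\<lambda>j. j - 1"]) (auto simp: nth_default_def)
  finally show ?thesis by (simp add: sum_list_sum_nth atLeast0LessThan)
qed

lemma young_diagram:
  assumes "is_partition la"
  shows "young (diagram la)"
proof -
  have "diagram la \<subseteq> {0..sum_list la} \<times> {0..length la}"
  proof clarify
    fix i j assume "(i, j) \<in> diagram la"
    then show "i \<in> {0..sum_list la} \<and> j \<in> {0..length la}"
      using elem_le_sum_list[of "j - 1" la] by (cases j) (auto simp: diagram_def)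
  qed
  then have "finite (diagram la)" by (rule finite_subset) simp
  moreover have "(i', j') \<in> diagram la"
    if "(i, j) \<in> diagram la" "1 \<le> i'" "i' \<le> i" "1 \<le> j'" "j' \<le> j" for i j i' j'
    using that nth_default_antimono[OF assms, of "j' - 1" "j - 1"]
    by (auto simp: diagram_rows diff_le_mono)
  ultimately show ?thesis unfolding young_def by (auto simp: diagram_rows)
qed

abbreviation partitions :: "nat \<Rightarrow> nat list set" where
  "partitions n \<equiv> {la. is_partition la \<and> sum_list la = n}"

lemma bij_betw_diagram: "bij_betw diagram (partitions n) (shapes n)"
proof (rule bij_betw_imageI)
  show "inj_on diagram (partitions n)"
  proof (intro inj_onI is_partition_eqI)
    fix la mu k assume *: "la \<in> partitions n" "mu \<in> partitions n" "diagram la = diagram mu"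
    have "i \<le> nth_default 0 la k \<longleftrightarrow> i \<le> nth_default 0 mu k" if "1 \<le> i" for i
      using diagram_rows[of i "Suc k" la] diagram_rows[of i "Suc k" mu] *(3) that by simp
    then show "nth_default 0 la k = nth_default 0 mu k"
      by (metis One_nat_def Suc_leI le_antisym le_zero_eq neq0_conv order_refl)
  qed auto
  show "diagram ` partitions n = shapes n"
  proof (intro equalityI subsetI)
    fix D assume "D \<in> shapes n"
    then have D: "young D" "card D = n" by (auto simp: shapes_def)
    obtain r N where r: "\<And>i j. (i, j) \<in> D \<longleftrightarrow> 1 \<le> i \<and> 1 \<le> j \<and> i \<le> r j"
      "\<And>i j. 1 \<le> i \<Longrightarrow> i \<le> j \<Longrightarrow> r j \<le> r i" "\<And>j. N < j \<Longrightarrow> r j = (0::nat)"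
      using young_rows[OF D(1)] by blast
    define L where "L = (LEAST L. r (Suc L) = 0)"
    have L0: "r (Suc L) = 0" unfolding L_def by (rule LeastI[of _ N]) (use r(3) in simp)
    have Lpos: "0 < r (Suc j)" if "j < L" for j
      using not_less_Least[of j "\<lambda>L. r (Suc L) = 0"] that by (simp add: L_def)
    define la where "la = map (\<lambda>j. r (Suc j)) [0..<L]"
    have nth: "nth_default 0 la j = r (Suc j)" for j
    proof (cases "j < L")
      case False
      then have "r (Suc j) \<le> r (Suc L)" by (intro r(2)) auto
      then show ?thesis using False L0 by (simp add: la_def nth_default_def)
    qed (simp add: la_def nth_default_def)
    have "is_partition la"
      using Lpos by (force simp: is_partition_def la_def sorted_wrt_iff_nth_less intro!: r(2))
    moreover have "diagram la = D"
      by (auto simp: diagram_rows nth r(1))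
    ultimately show "D \<in> diagram ` partitions n" using D(2) card_diagram[of la] by auto
  qed (auto simp: shapes_def young_diagram card_diagram)
qed

section \<open>Triangularity of Schur functions\<close>

lemma SSYT_eq: "SSYT la = {T \<in> extensional (diagram la). semistandard (diagram la) T}"
  by (auto simp: SSYT_def semistandard_def)

lemma schur_eq_kostka: "schur la x = of_nat (kostka (diagram la) (Poly_Mapping.lookup x))"
  by (simp add: schur_def kostka_def tableaux_def SSYT_eq conj_ac)

lemma sum_by_fibres:
  fixes T :: "'b \<Rightarrow> nat"
  assumes "finite D" "T ` D \<subseteq> {..<M}"
  shows "(\<Sum>u\<in>D. g (T u)) = (\<Sum>k<M. card {u \<in> D. T u = k} * (g k :: nat))"
proof -
  have "(\<Sum>u\<in>D. g (T u)) = (\<Sum>k<M. \<Sum>u | u \<in> D \<and> T u = k. g (T u))"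
    using assms by (intro sum.group[symmetric]) auto
  also have "\<dots> = (\<Sum>k<M. card {u \<in> D. T u = k} * g k)"
  proof (intro sum.cong refl)
    fix k
    have "(\<Sum>u | u \<in> D \<and> T u = k. g (T u)) = (\<Sum>u | u \<in> D \<and> T u = k. g k)" by (intro sum.cong) auto
    then show "(\<Sum>u | u \<in> D \<and> T u = k. g (T u)) = card {u \<in> D. T u = k} * g k" by simp
  qed
  finally show ?thesis .
qed

lemma sum_tableau:
  assumes "finite D" "T \<in> tableaux D x" "\<And>k. M \<le> k \<Longrightarrow> x k = 0"
  shows "(\<Sum>u\<in>D. g (T u)) = (\<Sum>k<M. x k * (g k :: nat))"
proof -
  have "T ` D \<subseteq> {..<M}" using tableaux_less[OF assms(1,2) _ assms(3)] by blast
  then show ?thesis using sum_by_fibres[OF assms(1), of T M g] assms(2) by (simp add: tableaux_def)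
qed

lemma kostka_nonzero_card:
  assumes "finite D" "kostka D x \<noteq> 0" "\<And>k. M \<le> k \<Longrightarrow> x k = 0"
  shows "card D = (\<Sum>k<M. x k)"
proof -
  have "tableaux D x \<noteq> {}" using assms(2) unfolding kostka_def by (metis card.empty)
  then obtain T where "T \<in> tableaux D x" by blast
  from sum_tableau[OF assms(1) this assms(3), where g = "\<lambda>_. 1"] show ?thesis by simp
qed

text \<open>Entries may start at 0, so strict increase up a column gives the lower bound j - 1 in
  row j.\<close>

lemma row_le_tableau:
  assumes D: "young D" and T: "semistandard D T"
  shows "(i, j) \<in> D \<Longrightarrow> j - 1 \<le> T (i, j)"
proof (induction j)
  case (Suc j)
  show ?case
  proof (cases "j = 0")
    case False
    then have "(i, j) \<in> D" using young_down[OF D Suc.prems, of i j] young_pos[OF D Suc.prems] by auto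
    then show ?thesis using Suc semistandardD(2)[OF T, of i j "Suc j"] by fastforce
  qed simp
qed simp

text \<open>The rank n(mu), the sum of (row - 1) over all cells, takes the place of dominance. A
  tableau of shape \<open>mu\<close> and content \<open>la\<close> has entry sum n(la), while each
  entry is at least its row minus 1; equality makes every entry minimal, and then the content gives
  the row lengths.\<close>

lemma schur_triangular:
  assumes la: "is_partition la" and mu: "is_partition mu"
    and nz: "schur mu (Poly_Mapping.nth la) \<noteq> (0 :: 'a::semiring_char_0)"
  shows "mu = la \<or> (\<Sum>u\<in>diagram mu. snd u - 1) < (\<Sum>u\<in>diagram la. snd u - 1)"
proof -
  let ?x = "nth_default 0 la"
  note fin = young_finite[OF young_diagram[OF mu]] young_finite[OF young_diagram[OF la]]
  have x0: "?x k = 0" if "length la \<le> k" for k using that by (simp add: nth_default_def)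
  have row: "card {u \<in> diagram nu. snd u - 1 = k} = nth_default 0 nu k" for nu k
  proof -
    have "{u \<in> diagram nu. snd u - 1 = k} = (\<lambda>i. (i, Suc k)) ` {1..nth_default 0 nu k}"
      by (auto simp: diagram_rows)
    then show ?thesis by (simp add: card_image inj_on_def)
  qed
  have "(\<lambda>u. snd u - 1) ` diagram la \<subseteq> {..<length la}" by (auto simp: diagram_def)
  then have "(\<Sum>u\<in>diagram la. snd u - 1) = (\<Sum>k<length la. ?x k * k)"
    using sum_by_fibres[of "diagram la" "\<lambda>u. snd u - 1" "length la" "\<lambda>k. k"] fin
    unfolding row by simp
  moreover have "tableaux (diagram mu) ?x \<noteq> {}"
    using nz unfolding schur_eq_kostka kostka_def lookup_nth by (metis card.empty of_nat_0)
  then obtain T where T: "T \<in> tableaux (diagram mu) ?x" by blast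
  moreover have "(\<Sum>u\<in>diagram mu. T u) = (\<Sum>k<length la. ?x k * k)"
    using sum_tableau[OF fin(1) T x0, where g = "\<lambda>k. k"] by simp
  moreover have "semistandard (diagram mu) T" using T by (simp add: tableaux_def)
  then have le: "snd u - 1 \<le> T u" if "u \<in> diagram mu" for u
    using row_le_tableau[OF young_diagram[OF mu], of T "fst u" "snd u"] that by simp
  then have "(\<Sum>u\<in>diagram mu. snd u - 1) \<le> (\<Sum>u\<in>diagram mu. T u)" by (intro sum_mono)
  moreover have "mu = la" if eq: "(\<Sum>u\<in>diagram mu. snd u - 1) = (\<Sum>u\<in>diagram mu. T u)"
  proof (rule is_partition_eqI[OF mu la])
    fix k
    have "T u = snd u - 1" if "u \<in> diagram mu" for u
      using sum_mono_inv[OF eq le that fin(1)] by simp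
    then have eq_set: "{u \<in> diagram mu. T u = k} = {u \<in> diagram mu. snd u - 1 = k}" by auto
    have "card {u \<in> diagram mu. T u = k} = nth_default 0 la k" using T by (simp add: tableaux_def)
    then show "nth_default 0 mu k = nth_default 0 la k" unfolding eq_set row .
  qed
  ultimately show ?thesis by linarith
qed

text \<open>The filling that puts j - 1 in row j has content \<open>la\<close>. Finiteness of the
  set of tableaux matters because \<open>card\<close> is 0 on infinite sets.\<close>

lemma schur_diagonal:
  assumes la: "is_partition la"
  shows "schur la (Poly_Mapping.nth la) \<noteq> (0 :: 'a::semiring_char_0)"
proof -
  let ?x = "nth_default 0 la" and ?T = "\<lambda>u\<in>diagram la. snd u - 1"
  note fin = young_finite[OF young_diagram[OF la]]
  have "card {u \<in> diagram la. ?T u = k} = ?x k" for k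
  proof -
    have "{u \<in> diagram la. ?T u = k} = (\<lambda>i. (i, Suc k)) ` {1..?x k}"
      by (auto simp: diagram_rows)
    then show ?thesis by (simp add: card_image inj_on_def)
  qed
  moreover have "semistandard (diagram la) ?T"
    by (auto simp: semistandard_def diagram_rows)
  ultimately have "?T \<in> tableaux (diagram la) ?x" by (simp add: tableaux_def)
  moreover have "finite (tableaux (diagram la) ?x)"
    by (rule finite_tableaux[OF fin, of "length la"]) (simp add: nth_default_def)
  ultimately show ?thesis by (auto simp: schur_eq_kostka kostka_def)
qed

lemma coords_schur:
  fixes f :: "'a::field_char_0 series"
  assumes "has_expansion schur c f"
  shows "coords schur f = c"
proof (rule coords_eqI[OF assms])
  fix c' assume c': "has_expansion schur c' f"
  show "c' = c"
  proof (rule has_expansion_unique[OF _ _ c' assms])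
    fix la mu
    assume "is_partition la" "is_partition mu" "schur mu (Poly_Mapping.nth la) \<noteq> (0 :: 'a)"
    then show "mu = la \<or> int (\<Sum>u\<in>diagram mu. snd u - 1) < int (\<Sum>u\<in>diagram la. snd u - 1)"
      unfolding of_nat_less_iff by (rule schur_triangular)
  qed (rule schur_diagonal)
qed

lemma hall_schur:
  fixes f :: "'a::field_char_0 series"
  assumes "has_expansion schur c f" "is_partition la"
  shows "hall f (schur la) = c la"
proof -
  have "finite {mu. c mu \<noteq> 0}" using assms(1) by (simp add: has_expansion_def)
  then show ?thesis
    unfolding hall_def coords_schur[OF assms(1)] coords_schur[OF has_expansion_single[OF assms(2)]]
    by (simp add: if_distrib[of "(*) _"] cong: if_cong)
qed

section \<open>The Schur expansion with content-product coefficients\<close>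

abbreviation mdeg :: "(nat \<Rightarrow>\<^sub>0 nat) \<Rightarrow> nat" where
  "mdeg x \<equiv> \<Sum>i\<in>Poly_Mapping.keys x. Poly_Mapping.lookup x i"

lemma finite_partitions: "finite (partitions n)"
  using bij_betw_finite[OF bij_betw_diagram] finite_shapes by blast

lemma keys_bound:
  obtains M where "\<And>k. M \<le> k \<Longrightarrow> Poly_Mapping.lookup x k = (0 :: 'b :: zero)"
    "Poly_Mapping.keys x \<subseteq> {..<M :: nat}"
proof -
  obtain M where M: "Poly_Mapping.keys x \<subseteq> {..<M}"
    using finite_nat_iff_bounded[of "Poly_Mapping.keys x"] by auto
  then have "Poly_Mapping.lookup x k = 0" if "M \<le> k" for k
    using that by (meson in_keys_iff leD lessThan_iff subsetD)
  with M show ?thesis using that by blast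
qed

text \<open>In degree n this is \<open>sum_content_coeff_kostka\<close> at every monomial; in any
  other degree no tableau with n cells has the required content. The series has the form in which
  \<open>J_tilde_row\<close> delivers the Jack side.\<close>

lemma has_expansion_schur_content:
  fixes a :: "'a::field_char_0"
  shows "has_expansion schur (\<lambda>la. if la \<in> partitions n then content_coeff a (diagram la) else 0)
    (\<lambda>x. if mdeg x = n then fact n * (\<Prod>i\<in>Poly_Mapping.keys x.
      pochhammer a (Poly_Mapping.lookup x i) / fact (Poly_Mapping.lookup x i)) else 0)"
proof (rule has_expansionI[OF finite_partitions[of n]])
  fix x :: "nat \<Rightarrow>\<^sub>0 nat"
  let ?x = "Poly_Mapping.lookup x"
  obtain M where M: "\<And>k. M \<le> k \<Longrightarrow> ?x k = 0" "Poly_Mapping.keys x \<subseteq> {..<M}"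
    by (rule keys_bound[of x]) blast
  have deg: "mdeg x = (\<Sum>k<M. ?x k)" using M(2) by (intro sum.mono_neutral_left) (auto simp: in_keys_iff)
  have "(\<Sum>la\<in>partitions n. (if la \<in> partitions n then content_coeff a (diagram la) else 0) * schur la x) =
      (\<Sum>la\<in>partitions n. content_coeff a (diagram la) * of_nat (kostka (diagram la) ?x))"
    by (intro sum.cong) (auto simp: schur_eq_kostka)
  also have "\<dots> = (\<Sum>D\<in>shapes n. content_coeff a D * of_nat (kostka D ?x))"
    by (rule sum.reindex_bij_betw[OF bij_betw_diagram])
  also have "\<dots> = (if mdeg x = n then fact n * (\<Prod>i\<in>Poly_Mapping.keys x.
      pochhammer a (?x i) / fact (?x i)) else 0)"
  proof (cases "mdeg x = n")
    case True
    have "(\<Prod>i\<in>Poly_Mapping.keys x. pochhammer a (?x i) / fact (?x i)) = (\<Prod>i<M. pochhammer a (?x i) / fact (?x i))"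
      using M(2) by (intro prod.mono_neutral_left) (auto simp: in_keys_iff)
    then show ?thesis using sum_content_coeff_kostka[where M = M and x = ?x and n = n, OF M(1)] deg True by simp
  next
    case False
    have "kostka D ?x = 0" if "D \<in> shapes n" for D
      using kostka_nonzero_card[where D = D and x = ?x and M = M] M(1) that False deg
      by (auto simp: shapes_def dest: young_finite)
    then show ?thesis using False by simp
  qed
  finally show "(if mdeg x = n then fact n * (\<Prod>i\<in>Poly_Mapping.keys x.
      pochhammer a (?x i) / fact (?x i)) else 0) =
    (\<Sum>la\<in>partitions n. (if la \<in> partitions n then content_coeff a (diagram la) else 0) * schur la x)" ..
qed auto

lemma card_SYT:
  assumes "is_partition la"
  shows "card (SYT la) = syt_number (diagram la)"
proof -
  let ?D = "diagram la" and ?n = "sum_list la"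
  note fin = young_finite[OF young_diagram[OF assms]]
  have "bij_betw T ?D {1..?n} \<longleftrightarrow> (\<forall>k. card {u \<in> ?D. T u = k} = (if k \<in> {1..?n} then 1 else 0))" for T
  proof
    assume T: "bij_betw T ?D {1..?n}"
    show "\<forall>k. card {u \<in> ?D. T u = k} = (if k \<in> {1..?n} then 1 else 0)"
    proof
      fix k
      show "card {u \<in> ?D. T u = k} = (if k \<in> {1..?n} then 1 else 0)"
      proof (cases "k \<in> {1..?n}")
        case True
        then have "k \<in> T ` ?D" using T by (simp add: bij_betw_def)
        then obtain u where "u \<in> ?D" "T u = k" by blast
        then have "{u \<in> ?D. T u = k} = {u}" using T by (auto simp: bij_betw_def inj_on_def)
        then show ?thesis using True by simp
      next
        case False
        then have empty: "{u \<in> ?D. T u = k} = {}" using T by (auto simp: bij_betw_def)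
        show ?thesis unfolding empty using False by simp
      qed
    qed
  next
    assume T: "\<forall>k. card {u \<in> ?D. T u = k} = (if k \<in> {1..?n} then 1 else 0)"
    have "inj_on T ?D"
    proof (rule inj_onI)
      fix u v assume uv: "u \<in> ?D" "v \<in> ?D" "T u = T v"
      have "card {w \<in> ?D. T w = T v} \<le> Suc 0" using T by simp
      moreover have "finite {w \<in> ?D. T w = T v}" using fin by simp
      ultimately have "\<forall>w\<in>{w \<in> ?D. T w = T v}. \<forall>w'\<in>{w \<in> ?D. T w = T v}. w = w'"
        by (simp only: card_le_Suc0_iff_eq)
      then show "u = v" using uv by blast
    qed
    moreover have "T u \<in> {1..?n}" if "u \<in> ?D" for u
    proof (rule ccontr)
      assume "T u \<notin> {1..?n}"
      then have "card {w \<in> ?D. T w = T u} = 0" using T by simp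
      then have "{w \<in> ?D. T w = T u} = {}" using fin by simp
      then show False using that by blast
    qed
    moreover have "k \<in> T ` ?D" if "k \<in> {1..?n}" for k
    proof -
      have "card {u \<in> ?D. T u = k} = 1" using T that by simp
      then have "{u \<in> ?D. T u = k} \<noteq> {}" by (metis card.empty zero_neq_one)
      then show ?thesis by blast
    qed
    ultimately show "bij_betw T ?D {1..?n}" by (auto simp: bij_betw_def)
  qed
  then show ?thesis
    by (simp add: SYT_def SSYT_eq syt_number_def kostka_def tableaux_def card_diagram conj_ac)
qed

section \<open>Power sums\<close>

abbreviation part_mset :: "(nat \<Rightarrow>\<^sub>0 nat) \<Rightarrow> nat multiset" where
  "part_mset x \<equiv> image_mset (Poly_Mapping.lookup x) (mset_set (Poly_Mapping.keys x))"

lemma mdeg_eq: "mdeg x = \<Sum>\<^sub># (part_mset x)"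
  by (simp add: sum_unfold_sum_mset)

lemma finite_lookup_ge: "0 < k \<Longrightarrow> finite {i. k \<le> Poly_Mapping.lookup x i}"
  for x :: "'b \<Rightarrow>\<^sub>0 nat"
  by (rule finite_subset[of _ "Poly_Mapping.keys x"]) (auto simp: in_keys_iff)

text \<open>\<open>series_mult\<close> sums over this set, and a sum over an infinite set would be 0
  by convention.\<close>

lemma finite_add_decompositions: "finite {(y, z). y + z = x}"
  for x :: "nat \<Rightarrow>\<^sub>0 nat"
proof -
  let ?F = "{f. \<forall>i. (i \<in> Poly_Mapping.keys x \<longrightarrow> f i \<in> {..mdeg x}) \<and> (i \<notin> Poly_Mapping.keys x \<longrightarrow> f i = (0::nat))}"
  have "finite ?F" by (rule finite_set_of_finite_funs) auto
  moreover have "Poly_Mapping.lookup ` fst ` {(y, z). y + z = x} \<subseteq> ?F"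
  proof
    fix f assume "f \<in> Poly_Mapping.lookup ` fst ` {(y, z). y + z = x}"
    then obtain y z where f: "f = Poly_Mapping.lookup y" and x: "x = y + z" by auto
    have le: "f i \<le> Poly_Mapping.lookup x i" for i by (simp add: f x lookup_add)
    have "Poly_Mapping.lookup x i \<le> mdeg x" if "i \<in> Poly_Mapping.keys x" for i
      using that by (intro member_le_sum) auto
    then have "f i \<le> mdeg x" if "i \<in> Poly_Mapping.keys x" for i using that le order_trans by blast
    moreover have "f i = 0" if "i \<notin> Poly_Mapping.keys x" for i using le[of i] that by (simp add: in_keys_iff)
    ultimately show "f \<in> ?F" by auto
  qed
  ultimately have "finite (Poly_Mapping.lookup ` fst ` {(y, z). y + z = x})" using finite_subset by blast
  moreover have "inj_on (Poly_Mapping.lookup \<circ> fst) {(y, z). y + z = x}"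
    by (auto simp: inj_on_def lookup_inject)
  ultimately show ?thesis by (metis finite_imageD image_comp)
qed

lemma single_add_diff:
  "k \<le> Poly_Mapping.lookup x i \<Longrightarrow> Poly_Mapping.single i k + (x - Poly_Mapping.single i k) = x"
  for x :: "nat \<Rightarrow>\<^sub>0 nat"
  by (rule poly_mapping_eqI) (auto simp: lookup_add lookup_minus lookup_single when_def)

lemma power_sum_Nil: "power_sum [] x = (if x = 0 then 1 else 0)"
  by (simp add: power_sum_def series_one_def)

text \<open>Multiplication by p_k removes a power x_i^k from the monomial in every possible way.
  Positivity of \<open>k\<close> keeps the choices distinct: every \<open>single i 0\<close> is the
  zero exponent.\<close>

lemma power_sum_Cons:
  assumes "0 < k"
  shows "power_sum (k # la) x =
    (\<Sum>i | k \<le> Poly_Mapping.lookup x i. power_sum la (x - Poly_Mapping.single i k))"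
proof -
  let ?s = "\<lambda>i. Poly_Mapping.single i k"
  let ?g = "power_sum la"
  have "power_sum (k # la) x = (\<Sum>p | fst p + snd p = x. power_sum1 k (fst p) * ?g (snd p))"
    by (simp add: power_sum_def series_mult_def case_prod_unfold)
  also have "\<dots> = (\<Sum>p\<in>(\<lambda>i. (?s i, x - ?s i)) ` {i. k \<le> Poly_Mapping.lookup x i}. power_sum1 k (fst p) * ?g (snd p))"
  proof (rule sum.mono_neutral_right)
    show "finite {p. fst p + snd p = x}"
      using finite_add_decompositions[of x] by (simp add: case_prod_unfold)
    show "(\<lambda>i. (?s i, x - ?s i)) ` {i. k \<le> Poly_Mapping.lookup x i} \<subseteq> {p. fst p + snd p = x}"
      using single_add_diff by auto
    show "\<forall>p\<in>{p. fst p + snd p = x} - (\<lambda>i. (?s i, x - ?s i)) ` {i. k \<le> Poly_Mapping.lookup x i}.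
        power_sum1 k (fst p) * ?g (snd p) = 0"
    proof
      fix p assume p: "p \<in> {p. fst p + snd p = x} - (\<lambda>i. (?s i, x - ?s i)) ` {i. k \<le> Poly_Mapping.lookup x i}"
      have "fst p \<noteq> ?s i" for i
      proof
        assume "fst p = ?s i"
        then have x: "x = ?s i + snd p" using p by auto
        then have "p = (?s i, x - ?s i)" "k \<le> Poly_Mapping.lookup x i"
          using \<open>fst p = ?s i\<close> by (auto simp: lookup_add intro: prod_eqI)
        then show False using p by blast
      qed
      then show "power_sum1 k (fst p) * ?g (snd p) = 0" by (simp add: power_sum1_def)
    qed
  qed
  also have "\<dots> = (\<Sum>i | k \<le> Poly_Mapping.lookup x i. power_sum1 k (?s i) * ?g (x - ?s i))"
  proof (subst sum.reindex)
    show "inj_on (\<lambda>i. (?s i, x - ?s i)) {i. k \<le> Poly_Mapping.lookup x i}"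
    proof (rule inj_onI)
      fix i j assume "(?s i, x - ?s i) = (?s j, x - ?s j)"
      then have "Poly_Mapping.lookup (?s i) i = Poly_Mapping.lookup (?s j) i" by simp
      then show "i = j" using assms by (simp add: lookup_single when_def split: if_splits)
    qed
  qed simp
  also have "\<dots> = (\<Sum>i | k \<le> Poly_Mapping.lookup x i. ?g (x - ?s i))"
    by (intro sum.cong) (auto simp: power_sum1_def)
  finally show ?thesis .
qed

lemma part_mset_add_single:
  fixes z :: "nat \<Rightarrow>\<^sub>0 nat"
  assumes "0 < k"
  shows "Poly_Mapping.keys (Poly_Mapping.single i k + z) = insert i (Poly_Mapping.keys z)"
    and "mdeg (Poly_Mapping.single i k + z) = k + mdeg z"
    and "i \<notin> Poly_Mapping.keys z \<Longrightarrow> part_mset (Poly_Mapping.single i k + z) = add_mset k (part_mset z)"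
proof -
  let ?x = "Poly_Mapping.single i k + z"
  have lk: "Poly_Mapping.lookup ?x j = (if j = i then k else 0) + Poly_Mapping.lookup z j" for j
    by (simp add: lookup_add lookup_single when_def)
  show keys: "Poly_Mapping.keys ?x = insert i (Poly_Mapping.keys z)"
    using assms by (auto simp: in_keys_iff lk split: if_splits)
  have "mdeg ?x = (\<Sum>j\<in>insert i (Poly_Mapping.keys z). if j = i then k else 0) +
      (\<Sum>j\<in>insert i (Poly_Mapping.keys z). Poly_Mapping.lookup z j)"
    unfolding keys lk by (rule sum.distrib)
  also have "(\<Sum>j\<in>insert i (Poly_Mapping.keys z). Poly_Mapping.lookup z j) = mdeg z"
    by (rule sum.mono_neutral_right) (auto simp: in_keys_iff)
  finally show "mdeg ?x = k + mdeg z" by simp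
  assume i: "i \<notin> Poly_Mapping.keys z"
  have "image_mset (Poly_Mapping.lookup ?x) (mset_set (Poly_Mapping.keys z)) = part_mset z"
    using i by (intro image_mset_cong) (auto simp: lk)
  then show "part_mset ?x = add_mset k (part_mset z)"
    using i unfolding keys by (simp add: lk in_keys_iff)
qed

text \<open>A monomial of a product of power sums arises by assigning each part to a variable. Parts
  may merge in one variable, so at most \<open>length la\<close> variables occur, and equality means
  that nothing merged.\<close>

lemma power_sum_nonzero:
  assumes "power_sum la x \<noteq> (0 :: 'a::comm_semiring_1)" "0 \<notin> set la"
  shows "mdeg x = sum_list la \<and> card (Poly_Mapping.keys x) \<le> length la \<and>
    (card (Poly_Mapping.keys x) = length la \<longrightarrow> part_mset x = mset la)"
  using assms
proof (induction la arbitrary: x)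
  case Nil then show ?case by (auto simp: power_sum_Nil split: if_splits)
next
  case (Cons k la)
  then have k: "0 < k" "0 \<notin> set la" by auto
  obtain i where "i \<in> {i. k \<le> Poly_Mapping.lookup x i}"
    and nz: "power_sum la (x - Poly_Mapping.single i k) \<noteq> (0 :: 'a)"
    using Cons.prems(1) unfolding power_sum_Cons[OF k(1)] by (rule sum.not_neutral_contains_not_neutral)
  then have i: "k \<le> Poly_Mapping.lookup x i" by simp
  define z where "z = x - Poly_Mapping.single i k"
  have x: "x = Poly_Mapping.single i k + z" unfolding z_def using single_add_diff[OF i] by simp
  have IH: "mdeg z = sum_list la" "card (Poly_Mapping.keys z) \<le> length la"
    "card (Poly_Mapping.keys z) = length la \<longrightarrow> part_mset z = mset la"
    using Cons.IH[of z] nz k by (simp_all add: z_def)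
  have "mdeg x = k + mdeg z" "Poly_Mapping.keys x = insert i (Poly_Mapping.keys z)"
    "i \<notin> Poly_Mapping.keys z \<Longrightarrow> part_mset x = add_mset k (part_mset z)"
    unfolding x using part_mset_add_single[OF k(1)] by blast+
  then show ?case using IH by (auto simp: card_insert_if)
qed

lemma power_sum_nonneg: "0 \<notin> set la \<Longrightarrow> 0 \<le> (power_sum la x :: 'a::linordered_idom)"
  by (induction la arbitrary: x) (auto simp: power_sum_Nil power_sum_Cons intro!: sum_nonneg)

text \<open>In an ordered ring the contributions are nonnegative and cannot cancel, so a single
  assignment without merging suffices.\<close>

lemma power_sum_pos:
  assumes "part_mset x = mset la" "0 \<notin> set la"
  shows "0 < (power_sum la x :: 'a::linordered_idom)"
  using assms
proof (induction la arbitrary: x)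
  case Nil then show ?case by (simp add: power_sum_Nil mset_set_empty_iff)
next
  case (Cons k la)
  then have k: "0 < k" "0 \<notin> set la" by auto
  have "k \<in># part_mset x" using Cons.prems by simp
  then obtain i where i: "i \<in> Poly_Mapping.keys x" "Poly_Mapping.lookup x i = k" by auto
  define z where "z = x - Poly_Mapping.single i k"
  have x: "x = Poly_Mapping.single i k + z" unfolding z_def using single_add_diff[of k x i] i by simp
  have "i \<notin> Poly_Mapping.keys z" using i by (simp add: z_def in_keys_iff lookup_minus)
  then have "part_mset z = mset la"
    using part_mset_add_single(3)[OF k(1), of i z] Cons.prems(1) x by simp
  then have "0 < (power_sum la z :: 'a)" by (rule Cons.IH[OF _ k(2)])
  also have "power_sum la z \<le> (power_sum (k # la) x :: 'a)"
    unfolding power_sum_Cons[OF k(1)] z_def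
    by (rule member_le_sum[where f = "\<lambda>i. power_sum la (x - Poly_Mapping.single i k)"])
      (use i k finite_lookup_ge power_sum_nonneg in auto)
  finally show ?case .
qed

lemma power_sum_map_key:
  assumes "bij \<pi>" "0 \<notin> set la"
  shows "power_sum la (Poly_Mapping.map_key \<pi> x) = (power_sum la x :: 'a::comm_semiring_1)"
  using assms(2)
proof (induction la arbitrary: x)
  case Nil
  have "Poly_Mapping.map_key \<pi> x = 0 \<longleftrightarrow> x = 0"
    using assms(1) by (auto simp: poly_mapping_eq_iff map_key.rep_eq bij_is_inj fun_eq_iff) (metis bij_pointE)
  then show ?case by (simp add: power_sum_Nil)
next
  case (Cons k la)
  then have k: "0 < k" "0 \<notin> set la" by auto
  note [simp] = map_key.rep_eq[OF bij_is_inj[OF assms(1)]]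
  have "Poly_Mapping.map_key \<pi> x - Poly_Mapping.single i k = Poly_Mapping.map_key \<pi> (x - Poly_Mapping.single (\<pi> i) k)" for i
    using bij_is_inj[OF assms(1)]
    by (intro poly_mapping_eqI) (auto simp: lookup_minus lookup_single when_def inj_eq)
  then have "(power_sum (k # la) (Poly_Mapping.map_key \<pi> x) :: 'a) =
      (\<Sum>i | k \<le> Poly_Mapping.lookup x (\<pi> i). power_sum la (x - Poly_Mapping.single (\<pi> i) k))"
    by (simp add: power_sum_Cons[OF k(1)] Cons.IH k)
  also have "\<dots> = (\<Sum>i | k \<le> Poly_Mapping.lookup x i. power_sum la (x - Poly_Mapping.single i k))"
    by (rule sum.reindex_bij_witness[of _ "inv \<pi>" \<pi>])
      (use assms(1) in \<open>auto simp: bij_is_inj bij_is_surj surj_f_inv_f\<close>)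
  finally show ?case by (simp add: power_sum_Cons[OF k(1)])
qed

lemma power_sum_swap:
  assumes "0 < k" "0 < l"
  shows "power_sum (k # l # la) = (power_sum (l # k # la) :: 'a::comm_semiring_1 series)"
proof
  fix x
  let ?s = "\<lambda>i k. Poly_Mapping.single i k"
  have expand: "(power_sum (k # l # la) x :: 'a) =
      (\<Sum>(i, j)\<in>(SIGMA i:{i. k \<le> Poly_Mapping.lookup x i}. {j. l \<le> Poly_Mapping.lookup (x - ?s i k) j}).
        power_sum la (x - ?s i k - ?s j l))" if "0 < k" "0 < l" for k l
    unfolding power_sum_Cons[OF that(1)] power_sum_Cons[OF that(2)]
    using that by (intro sum.Sigma) (auto intro: finite_lookup_ge)
  show "power_sum (k # l # la) x = (power_sum (l # k # la) x :: 'a)"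
    unfolding expand[OF assms] expand[OF assms(2,1)]
    by (rule sum.reindex_bij_witness[of _ "\<lambda>(i, j). (j, i)" "\<lambda>(i, j). (j, i)"])
      (auto simp: lookup_minus lookup_single when_def diff_diff_add add.commute split: if_splits)
qed

lemma power_sum_cong:
  assumes "power_sum la = (power_sum mu :: 'a::comm_semiring_1 series)"
  shows "power_sum (k # la) = (power_sum (k # mu) :: 'a series)"
  using assms by (simp add: power_sum_def)

lemma power_sum_remove1:
  assumes "k \<in> set la" "0 \<notin> set la"
  shows "power_sum la = (power_sum (k # remove1 k la) :: 'a::comm_semiring_1 series)"
  using assms
proof (induction la)
  case (Cons l la)
  show ?case
  proof (cases "l = k")
    case False
    then have "power_sum la = (power_sum (k # remove1 k la) :: 'a series)" using Cons by auto
    then have "power_sum (l # la) = (power_sum (l # k # remove1 k la) :: 'a series)" by (rule power_sum_cong)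
    also have "\<dots> = power_sum (k # l # remove1 k la)"
      using Cons.prems by (intro power_sum_swap) (auto intro: gr0I)
    finally show ?thesis using False by simp
  qed simp
qed simp

text \<open>Hence the coefficient of \<open>x_0^n\<close> in a combination of power sums of degree n
  is the plain sum of its coordinates, which is how \<open>jack_row\<close> reads it off.\<close>

lemma power_sum_one_variable:
  "0 \<notin> set la \<Longrightarrow> power_sum la (Poly_Mapping.single 0 (sum_list la)) = 1"
proof (induction la)
  case (Cons k la)
  then have "0 < k" by auto
  then have "{i. k \<le> Poly_Mapping.lookup (Poly_Mapping.single (0::nat) (k + sum_list la)) i} = {0}"
    by (auto simp: lookup_single when_def split: if_splits)
  then show ?case using Cons \<open>0 < k\<close> by (simp add: power_sum_Cons single_diff[symmetric])
qed (simp add: power_sum_Nil)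

section \<open>Removing a part from a partition\<close>

lemma is_partition_iff_sorted: "is_partition la \<longleftrightarrow> sorted (rev la) \<and> 0 \<notin> set la"
  by (simp add: is_partition_def sorted_wrt_rev)

lemma is_partition_mset_eq:
  assumes "is_partition la" "is_partition mu" "mset la = mset mu"
  shows "la = mu"
proof -
  have "sort (rev mu) = rev la" "sort (rev mu) = rev mu"
    using assms by (auto simp: is_partition_iff_sorted intro!: properties_for_sort)
  then show ?thesis by simp
qed

lemma is_partition_rev_sort: "0 \<notin># M \<Longrightarrow> is_partition (rev (sorted_list_of_multiset M))"
  by (simp add: is_partition_iff_sorted)

lemma is_partition_remove1:
  assumes "is_partition la"
  shows "is_partition (remove1 k la)"
proof -
  have "sorted_wrt (\<ge>) (remove1 k mu)" if "sorted_wrt (\<ge>) mu" for mu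
    using that by (induction mu) (auto dest: set_remove1_subset[THEN subsetD])
  then show ?thesis
    using assms set_remove1_subset[of k la] unfolding is_partition_def by blast
qed

text \<open>The factor \<open>k * count_list la k\<close> also appears when the size of
  \<open>la\<close> is written as a sum over its distinct parts, so it cancels in
  \<open>power_sum_series_rec\<close>.\<close>

lemma z_num_remove1:
  assumes "k \<in> set la"
  shows "z_num la = k * count_list la k * z_num (remove1 k la)"
proof -
  let ?t = "\<lambda>mu i. i ^ count_list mu i * fact (count_list mu i) :: nat"
  obtain c where c: "count_list la k = Suc c" using assms by (metis count_list_0_iff not0_implies_Suc)
  have "z_num (remove1 k la) = (\<Prod>i\<in>set la. ?t (remove1 k la) i)"
    unfolding z_num_def using set_remove1_subset[of k la]
    by (intro prod.mono_neutral_left) (auto simp: count_list_0_iff[symmetric])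
  also have "\<dots> = ?t (remove1 k la) k * (\<Prod>i\<in>set la - {k}. ?t (remove1 k la) i)"
    using assms by (intro prod.remove) auto
  also have "(\<Prod>i\<in>set la - {k}. ?t (remove1 k la) i) = (\<Prod>i\<in>set la - {k}. ?t la i)"
    by (intro prod.cong) auto
  finally have "z_num (remove1 k la) = k ^ c * fact c * (\<Prod>i\<in>set la - {k}. ?t la i)"
    using c by simp
  moreover have "z_num la = ?t la k * (\<Prod>i\<in>set la - {k}. ?t la i)"
    unfolding z_num_def using assms by (intro prod.remove) auto
  ultimately show ?thesis unfolding c power_Suc fact_Suc of_nat_id by (simp only: mult_ac)
qed

lemma z_num_pos: "0 \<notin> set la \<Longrightarrow> 0 < z_num la"
  unfolding z_num_def by (intro prod_pos ballI) (metis fact_gt_zero gr0I mult_pos_pos zero_less_power)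

lemma bij_betw_remove_part:
  "bij_betw (\<lambda>(la, k). (k, remove1 k la)) (SIGMA la:partitions n. set la) (SIGMA k:{1..n}. partitions (n - k))"
proof -
  define ins where "ins k mu = rev (sorted_list_of_multiset (add_mset k (mset mu)))" for k :: nat and mu
  have mset_ins: "mset (ins k mu) = add_mset k (mset mu)" for k mu
    by (simp add: ins_def del: sorted_list_of_multiset_insert)
  have part_ins: "is_partition (ins k mu)" if "0 < k" "is_partition mu" for k mu
    unfolding ins_def using that by (intro is_partition_rev_sort) (auto simp: is_partition_def)
  have sum_ins: "sum_list (ins k mu) = k + sum_list mu" for k mu
    unfolding sum_mset_sum_list[symmetric] mset_ins by simp
  have sum_remove: "sum_list la = k + sum_list (remove1 k la)" if "k \<in> set la" for k and la :: "nat list"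
    using that by (induction la) auto
  have pos: "0 < k" if "is_partition la" "k \<in> set la" for la k
    using that by (metis gr0I is_partition_def)
  show ?thesis
  proof (rule bij_betw_byWitness[where f' = "\<lambda>(k, mu). (ins k mu, k)"])
    have "ins k (remove1 k la) = la" if "is_partition la" "k \<in> set la" for la k
      using part_ins[OF pos[OF that] is_partition_remove1[OF that(1)]] that(1)
      by (rule is_partition_mset_eq) (simp add: mset_ins that)
    then show "\<forall>p\<in>SIGMA la:partitions n. set la. (\<lambda>(k, mu). (ins k mu, k)) ((\<lambda>(la, k). (k, remove1 k la)) p) = p"
      by auto
    have "remove1 k (ins k mu) = mu" if "0 < k" "is_partition mu" for mu k
      using is_partition_remove1[OF part_ins[OF that]] that(2)
      by (rule is_partition_mset_eq) (simp add: mset_ins)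
    then show "\<forall>p\<in>SIGMA k:{1..n}. partitions (n - k). (\<lambda>(la, k). (k, remove1 k la)) ((\<lambda>(k, mu). (ins k mu, k)) p) = p"
      by auto
    show "(\<lambda>(la, k). (k, remove1 k la)) ` (SIGMA la:partitions n. set la) \<subseteq> (SIGMA k:{1..n}. partitions (n - k))"
      using is_partition_remove1 sum_remove pos by (fastforce simp: Suc_le_eq)
    show "(\<lambda>(k, mu). (ins k mu, k)) ` (SIGMA k:{1..n}. partitions (n - k)) \<subseteq> (SIGMA la:partitions n. set la)"
    proof
      fix p assume "p \<in> (\<lambda>(k, mu). (ins k mu, k)) ` (SIGMA k:{1..n}. partitions (n - k))"
      then obtain k mu where p: "p = (ins k mu, k)"
        and *: "k \<in> {1..n}" "is_partition mu" "sum_list mu = n - k" by auto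
      moreover have "k \<in> set (ins k mu)" unfolding set_mset_mset[symmetric] mset_ins by simp
      ultimately show "p \<in> (SIGMA la:partitions n. set la)"
        using part_ins[of k mu] by (simp add: sum_ins)
    qed
  qed
qed

text \<open>For \<open>b = 1\<close> these are the complete homogeneous functions, for \<open>b = 1 / \<alpha>\<close> the
  multiples of the one-row Jack functions dual to the monomial functions.\<close>

definition power_sum_series :: "'a::field_char_0 \<Rightarrow> nat \<Rightarrow> 'a series" where
  "power_sum_series b n x = (\<Sum>la\<in>partitions n. b ^ length la / of_nat (z_num la) * power_sum la x)"

text \<open>The coefficient form of \<open>n g_n = b (p_1 g_(n-1) + ... + p_n g_0)\<close>, the
  logarithmic derivative of \<open>exp(b (p_1/1 + p_2/2 + ...))\<close>. It follows by writing n as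
  the sum of \<open>k * count_list la k\<close> and removing one part k from each partition.\<close>

lemma power_sum_series_rec:
  "of_nat n * power_sum_series b n x =
    b * (\<Sum>k=1..n. \<Sum>i | k \<le> Poly_Mapping.lookup x i. power_sum_series b (n - k) (x - Poly_Mapping.single i k))"
proof -
  let ?w = "\<lambda>la. b ^ length la / of_nat (z_num la)"
  have fin: "finite (partitions m)" for m by (rule finite_partitions)
  have "of_nat n * power_sum_series b n x = (\<Sum>la\<in>partitions n. of_nat (sum_list la) * (?w la * power_sum la x))"
    unfolding power_sum_series_def sum_distrib_left by (intro sum.cong) auto
  also have "\<dots> = (\<Sum>la\<in>partitions n. \<Sum>k\<in>set la. of_nat (k * count_list la k) * ?w la * power_sum la x)"
  proof (intro sum.cong refl)
    fix la
    have "sum_list la = (\<Sum>k\<in>set la. k * count_list la k)"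
      using sum_list_map_eq_sum_count[of "\<lambda>k. k" la] by (simp add: mult.commute)
    then show "of_nat (sum_list la) * (?w la * power_sum la x) =
        (\<Sum>k\<in>set la. of_nat (k * count_list la k) * ?w la * power_sum la x)"
      by (simp only: of_nat_sum sum_distrib_right mult.assoc)
  qed
  also have "\<dots> = (\<Sum>(la, k)\<in>(SIGMA la:partitions n. set la). of_nat (k * count_list la k) * ?w la * power_sum la x)"
    by (rule sum.Sigma) (use fin in auto)
  also have "\<dots> = (\<Sum>(la, k)\<in>(SIGMA la:partitions n. set la). b * ?w (remove1 k la) * power_sum (k # remove1 k la) x)"
  proof (intro sum.cong refl, clarify)
    fix la k assume *: "is_partition la" "k \<in> set la"
    have "0 < z_num la" using * by (intro z_num_pos) (simp add: is_partition_def)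
    then have "k * count_list la k \<noteq> 0" "z_num (remove1 k la) \<noteq> 0" using z_num_remove1[OF *(2)] by auto
    then have nz: "of_nat (k * count_list la k) \<noteq> (0 :: 'a)" by (simp only: of_nat_eq_0_iff not_False_eq_True)
    have len: "length la = Suc (length (remove1 k la))"
      using * by (simp add: length_remove1) (metis Suc_pred length_pos_if_in_set)
    have "of_nat (k * count_list la k) * ?w la = b * ?w (remove1 k la)"
      unfolding z_num_remove1[OF *(2)] of_nat_mult[of "k * count_list la k"] len power_Suc
      using nz by (simp del: of_nat_mult)
    moreover have "power_sum la x = (power_sum (k # remove1 k la) x :: 'a)"
      using power_sum_remove1[OF *(2), where 'a = 'a] * by (simp add: is_partition_def)
    ultimately show "of_nat (k * count_list la k) * ?w la * power_sum la x =
        b * ?w (remove1 k la) * power_sum (k # remove1 k la) x" by (simp only:)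
  qed
  also have "\<dots> = (\<Sum>p\<in>(SIGMA k:{1..n}. partitions (n - k)). b * ?w (snd p) * power_sum (fst p # snd p) x)"
    unfolding sum.reindex_bij_betw[OF bij_betw_remove_part, symmetric]
    by (intro sum.cong) auto
  also have "\<dots> = (\<Sum>k=1..n. \<Sum>mu\<in>partitions (n - k). b * ?w mu * power_sum (k # mu) x)"
    by (subst sum.Sigma) (use fin in \<open>auto simp: case_prod_unfold\<close>)
  also have "\<dots> = (\<Sum>k=1..n. b * (\<Sum>i | k \<le> Poly_Mapping.lookup x i. power_sum_series b (n - k) (x - Poly_Mapping.single i k)))"
  proof (intro sum.cong refl)
    fix k assume "k \<in> {1..n}"
    then have "0 < k" by simp
    then show "(\<Sum>mu\<in>partitions (n - k). b * ?w mu * power_sum (k # mu) x) =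
        b * (\<Sum>i | k \<le> Poly_Mapping.lookup x i. power_sum_series b (n - k) (x - Poly_Mapping.single i k))"
      unfolding power_sum_series_def power_sum_Cons[OF \<open>0 < k\<close>] sum_distrib_left
      by (subst sum.swap) (simp only: mult.assoc)
  qed
  finally show ?thesis by (simp only: sum_distrib_left)
qed

text \<open>Comparison of coefficients in the differential equation f' = b f / (1 - t) for f = (1 -
  t)^(-b).\<close>

lemma sum_pochhammer_div_fact:
  fixes b :: "'a::field_char_0"
  shows "b * (\<Sum>j<m. pochhammer b j / fact j) = of_nat m * (pochhammer b m / fact m)"
proof (induction m)
  case (Suc m)
  have "b * (\<Sum>j<Suc m. pochhammer b j / fact j) = (of_nat m + b) * (pochhammer b m / fact m)"
    unfolding sum.lessThan_Suc distrib_left distrib_right Suc.IH ..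
  also have "\<dots> = of_nat (Suc m) * (pochhammer b (Suc m) / fact (Suc m))"
    using of_nat_neq_0[of m, where 'a = 'a]
    by (simp add: pochhammer_Suc field_simps del: of_nat_Suc)
  finally show ?case .
qed simp

text \<open>The coefficients of \<open>\<Prod>\<^sub>i (1 - x\<^sub>i)\<^sup>-\<^sup>b\<close>.\<close>

abbreviation binomial_coeff_prod :: "'a::field_char_0 \<Rightarrow> (nat \<Rightarrow>\<^sub>0 nat) \<Rightarrow> 'a" where
  "binomial_coeff_prod b x \<equiv>
    \<Prod>i\<in>Poly_Mapping.keys x. pochhammer b (Poly_Mapping.lookup x i) / fact (Poly_Mapping.lookup x i)"

lemma mdeg_diff_single:
  assumes "0 < k" "k \<le> Poly_Mapping.lookup x i"
  shows "mdeg x = k + mdeg (x - Poly_Mapping.single i k)"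
  using part_mset_add_single(2)[OF assms(1), of i "x - Poly_Mapping.single i k"] single_add_diff[OF assms(2)] by simp

text \<open>Both sides obey \<open>power_sum_series_rec\<close>. In the product, removing a power of
  x_i changes one factor only, so the sum over k reduces to \<open>sum_pochhammer_div_fact\<close>
  and yields the exponent of x_i; the exponents add up to n.\<close>

lemma power_sum_series_eq:
  "power_sum_series b n x = (if mdeg x = n then binomial_coeff_prod b x else 0)"
proof (induction n arbitrary: x rule: less_induct)
  case (less n)
  let ?x = "Poly_Mapping.lookup x" and ?s = "\<lambda>i k. Poly_Mapping.single i k"
  show ?case
  proof (cases "n = 0")
    case True
    have "partitions 0 = {[]}"
    proof (intro equalityI subsetI)
      fix la :: "nat list" assume "la \<in> partitions 0"
      then have "\<forall>k\<in>set la. k = 0" "0 \<notin> set la" by (auto simp: is_partition_def)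
      then show "la \<in> {[]}" by (cases la) auto
    qed (simp add: is_partition_def)
    then show ?thesis using True by (auto simp: power_sum_series_def power_sum_Nil z_num_def poly_mapping_eq_iff in_keys_iff fun_eq_iff)
  next
    case False
    have IH: "power_sum_series b (n - k) (x - ?s i k) =
        (if mdeg x = n then binomial_coeff_prod b (x - ?s i k) else 0)"
      if "k \<in> {1..n}" "k \<le> ?x i" for k i
      using less[of "n - k" "x - ?s i k"] mdeg_diff_single[of k x i] that by auto
    have "of_nat n * power_sum_series b n x = b * (\<Sum>k=1..n. \<Sum>i | k \<le> ?x i.
        if mdeg x = n then binomial_coeff_prod b (x - ?s i k) else 0)"
      unfolding power_sum_series_rec[of n b x] using IH by (intro arg_cong[of _ _ "(*) b"] sum.cong) auto
    also have "\<dots> = (if mdeg x = n then of_nat n * binomial_coeff_prod b x else 0)"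
    proof (cases "mdeg x = n")
      case True
      let ?q = "\<lambda>m. pochhammer b m / fact m"
      have le: "?x i \<le> n" if "i \<in> Poly_Mapping.keys x" for i
        unfolding True[symmetric] using that by (intro member_le_sum) auto
      have "b * (\<Sum>k=1..n. \<Sum>i | k \<le> ?x i. binomial_coeff_prod b (x - ?s i k)) =
          b * (\<Sum>k=1..n. \<Sum>i | i \<in> Poly_Mapping.keys x \<and> k \<le> ?x i. binomial_coeff_prod b (x - ?s i k))"
        by (intro arg_cong[of _ _ "(*) b"] sum.cong) (auto simp: in_keys_iff)
      also have "\<dots> = b * (\<Sum>i\<in>Poly_Mapping.keys x. \<Sum>k | k \<in> {1..n} \<and> k \<le> ?x i. binomial_coeff_prod b (x - ?s i k))"
        by (subst sum.swap_restrict) auto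
      also have "\<dots> = (\<Sum>i\<in>Poly_Mapping.keys x. of_nat (?x i) * binomial_coeff_prod b x)"
        unfolding sum_distrib_left[of b]
      proof (intro sum.cong refl)
        fix i assume i: "i \<in> Poly_Mapping.keys x"
        let ?P = "\<Prod>j\<in>Poly_Mapping.keys x - {i}. ?q (?x j)"
        have "binomial_coeff_prod b (x - ?s i k) = ?q (?x i - k) * ?P" for k
        proof -
          have "binomial_coeff_prod b (x - ?s i k) = (\<Prod>j\<in>Poly_Mapping.keys x. ?q (Poly_Mapping.lookup (x - ?s i k) j))"
            by (intro prod.mono_neutral_left) (auto simp: in_keys_iff lookup_minus)
          also have "\<dots> = ?q (Poly_Mapping.lookup (x - ?s i k) i) *
              (\<Prod>j\<in>Poly_Mapping.keys x - {i}. ?q (Poly_Mapping.lookup (x - ?s i k) j))"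
            using i by (intro prod.remove) auto
          also have "(\<Prod>j\<in>Poly_Mapping.keys x - {i}. ?q (Poly_Mapping.lookup (x - ?s i k) j)) = ?P"
            by (intro prod.cong) (auto simp: lookup_minus lookup_single when_def)
          finally show ?thesis by (simp add: lookup_minus)
        qed
        then have "(\<Sum>k | k \<in> {1..n} \<and> k \<le> ?x i. b * binomial_coeff_prod b (x - ?s i k)) =
            b * (\<Sum>k | k \<in> {1..n} \<and> k \<le> ?x i. ?q (?x i - k)) * ?P"
          by (simp add: sum_distrib_left sum_distrib_right mult_ac)
        also have "(\<Sum>k | k \<in> {1..n} \<and> k \<le> ?x i. ?q (?x i - k)) = (\<Sum>j<?x i. ?q j)"
          by (rule sum.reindex_bij_witness[of _ "\<lambda>j. ?x i - j" "\<lambda>k. ?x i - k"]) (use le[OF i] in auto)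
        also have "b * (\<Sum>j<?x i. ?q j) * ?P = of_nat (?x i) * (?q (?x i) * ?P)"
          unfolding sum_pochhammer_div_fact by (simp only: mult.assoc)
        also have "?q (?x i) * ?P = binomial_coeff_prod b x"
          using i by (intro prod.remove[symmetric]) auto
        finally show "(\<Sum>k | k \<in> {1..n} \<and> k \<le> ?x i. b * binomial_coeff_prod b (x - ?s i k)) =
            of_nat (?x i) * binomial_coeff_prod b x" .
      qed
      also have "\<dots> = of_nat n * binomial_coeff_prod b x"
        unfolding sum_distrib_right[symmetric] of_nat_sum[symmetric] True ..
      finally show ?thesis using True by simp
    qed simp
    finally show ?thesis using False by (auto split: if_splits)
  qed
qed

section \<open>One-row Jack functions\<close>

text \<open>The \<open>card P\<close> vectors \<open>M j\<close> are independent and lie in the span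
  of \<open>card P\<close> unit vectors, so they span that space. The lemma is applied to power sums
  and to Jack functions.\<close>

lemma square_system_solvable:
  fixes M :: "'i \<Rightarrow> 'i \<Rightarrow> 'k::field"
  assumes fin: "finite P"
    and inj: "\<And>c. (\<And>i. i \<in> P \<Longrightarrow> (\<Sum>j\<in>P. c j * M j i) = 0) \<Longrightarrow> \<forall>j\<in>P. c j = 0"
  shows "\<exists>c. \<forall>i\<in>P. (\<Sum>j\<in>P. c j * M j i) = b i"
proof -
  interpret vs: vector_space "\<lambda>(a::'k) (f::'i \<Rightarrow> 'k) i. a * f i"
    by unfold_locales (auto simp: fun_eq_iff algebra_simps)
  let ?v = "\<lambda>j i. if i \<in> P then M j i else 0"
  let ?d = "\<lambda>j i. if i = j then 1 else 0 :: 'k"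
  let ?b = "\<lambda>i. if i \<in> P then b i else 0"
  have sum_apply: "(\<Sum>x\<in>A. g x) i = (\<Sum>x\<in>A. g x i)" for A and g :: "'z \<Rightarrow> 'i \<Rightarrow> 'k" and i
    by (induction A rule: infinite_finite_induct) auto
  \<comment> \<open>Equal vectors at distinct indices would be a nontrivial relation; injectivity
    gives the set of vectors as many elements as \<open>P\<close>.\<close>
  have inj_v: "inj_on ?v P"
  proof (rule inj_onI, rule ccontr)
    fix j l assume *: "j \<in> P" "l \<in> P" "?v j = ?v l" "j \<noteq> l"
    let ?c = "\<lambda>k. if k = j then 1 else if k = l then - 1 else 0 :: 'k"
    have "(\<Sum>k\<in>P. ?c k * M k i) = 0" if "i \<in> P" for i
    proof -
      have "(\<Sum>k\<in>P. ?c k * M k i) = (\<Sum>k\<in>P. (if k = j then M j i else 0) - (if k = l then M l i else 0))"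
        using *(4) by (intro sum.cong) auto
      also have "\<dots> = M j i - M l i" using fin *(1,2) by (simp add: sum_subtractf)
      also have "\<dots> = 0" using fun_cong[OF *(3), of i] that by simp
      finally show ?thesis .
    qed
    then have "\<forall>k\<in>P. ?c k = 0" by (rule inj)
    then show False using *(1) by auto
  qed
  have indep: "vs.independent (?v ` P)"
  proof (rule vs.independent_if_scalars_zero)
    fix f x assume *: "(\<Sum>x\<in>?v ` P. (\<lambda>i. f x * x i)) = 0" "x \<in> ?v ` P"
    have "(\<Sum>j\<in>P. f (?v j) * M j i) = 0" if "i \<in> P" for i
      using fun_cong[OF *(1), of i] that by (simp add: sum_apply sum.reindex[OF inj_v])
    then have "\<forall>j\<in>P. f (?v j) = 0" by (rule inj)
    then show "f x = 0" using *(2) by auto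
  qed (use fin in simp)
  have span: "f \<in> vs.span (?d ` P)" if "\<And>i. i \<notin> P \<Longrightarrow> f i = 0" for f
  proof -
    have "f = (\<Sum>j\<in>P. (\<lambda>i. f j * ?d j i))"
      using that fin by (auto simp: fun_eq_iff sum_apply if_distrib[of "(*) _"] cong: if_cong)
    moreover have "(\<Sum>j\<in>P. (\<lambda>i. f j * ?d j i)) \<in> vs.span (?d ` P)"
      by (intro vs.span_sum vs.span_scale vs.span_base) auto
    ultimately show ?thesis by simp
  qed
  have "?b \<in> vs.span (?v ` P)"
  proof (rule ccontr)
    assume nin: "?b \<notin> vs.span (?v ` P)"
    then have "vs.independent (insert ?b (?v ` P))" using indep by (rule vs.independent_insertI)
    moreover have "insert ?b (?v ` P) \<subseteq> vs.span (?d ` P)" by (auto intro!: span)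
    ultimately have "card (insert ?b (?v ` P)) \<le> card (?d ` P)"
      using vs.independent_span_bound[of "?d ` P"] fin by blast
    also have "\<dots> \<le> card P" using fin by (rule card_image_le)
    finally show False
      using nin vs.span_base[of ?b "?v ` P"] fin card_image[OF inj_v] by (auto simp: card_insert_if split: if_splits)
  qed
  then obtain u where u: "?b = (\<Sum>x\<in>?v ` P. (\<lambda>i. u x * x i))"
    unfolding vs.span_finite[OF finite_imageI[OF fin]] by auto
  have "(\<Sum>j\<in>P. u (?v j) * M j i) = b i" if "i \<in> P" for i
    using fun_cong[OF u, of i] that by (simp add: sum_apply sum.reindex[OF inj_v])
  then show ?thesis by (intro exI[of _ "\<lambda>j. u (?v j)"]) blast
qed

section \<open>Symmetric series determined by their values at partitions\<close>

declare Poly_Mapping.lookup_nth [simp del] Poly_Mapping.keys_nth [simp del]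

lemma part_mset_nth:
  assumes "is_partition la"
  shows "part_mset (Poly_Mapping.nth la) = mset la"
proof -
  have "Poly_Mapping.keys (Poly_Mapping.nth la) = {..<length la}"
  proof (rule set_eqI)
    fix k show "k \<in> Poly_Mapping.keys (Poly_Mapping.nth la) \<longleftrightarrow> k \<in> {..<length la}"
      using nth_default_nonzero_iff[OF assms, of k] by (simp add: in_keys_iff lookup_nth)
  qed
  moreover have "image_mset (nth_default 0 la) (mset_set {..<length la}) = image_mset ((!) la) (mset_set {..<length la})"
    by (intro image_mset_cong) (auto simp: nth_default_def)
  moreover have "\<dots> = mset (map ((!) la) [0..<length la])"
    unfolding mset_map mset_upt atLeast0LessThan ..
  ultimately show ?thesis by (simp add: map_nth lookup_nth)
qed

lemma zero_notin_part_mset: "0 \<notin># part_mset x"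
  by (auto simp: in_keys_iff)

text \<open>Symmetry speaks of bijections of the variables, partitions of multisets of exponents.
  Padding both exponent vectors with zeros to a common length turns equal multisets into lists that
  differ by a permutation.\<close>

lemma part_mset_rearrange:
  assumes "part_mset x = part_mset y"
  obtains \<pi> where "bij \<pi>" "Poly_Mapping.map_key \<pi> x = y"
proof -
  obtain M1 where M1: "\<And>k. M1 \<le> k \<Longrightarrow> Poly_Mapping.lookup x k = 0" "Poly_Mapping.keys x \<subseteq> {..<M1}"
    by (rule keys_bound[of x]) blast
  obtain M2 where M2: "\<And>k. M2 \<le> k \<Longrightarrow> Poly_Mapping.lookup y k = 0" "Poly_Mapping.keys y \<subseteq> {..<M2}"
    by (rule keys_bound[of y]) blast
  define M where "M = max M1 M2"
  let ?l = "\<lambda>x. map (Poly_Mapping.lookup x) [0..<M]"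
  have mset_l: "mset (?l x) = part_mset x + replicate_mset (M - size (part_mset x)) 0"
    if "Poly_Mapping.keys x \<subseteq> {..<M}" for x
  proof -
    have "mset (?l x) = image_mset (Poly_Mapping.lookup x) (mset_set {..<M})"
      by (simp add: atLeast0LessThan)
    also have "{..<M} = Poly_Mapping.keys x \<union> ({..<M} - Poly_Mapping.keys x)" using that by blast
    also have "mset_set \<dots> = mset_set (Poly_Mapping.keys x) + mset_set ({..<M} - Poly_Mapping.keys x)"
      by (rule mset_set_Union) auto
    also have "image_mset (Poly_Mapping.lookup x) \<dots> =
        part_mset x + image_mset (Poly_Mapping.lookup x) (mset_set ({..<M} - Poly_Mapping.keys x))"
      by simp
    also have "image_mset (Poly_Mapping.lookup x) (mset_set ({..<M} - Poly_Mapping.keys x)) =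
        image_mset (\<lambda>_. 0) (mset_set ({..<M} - Poly_Mapping.keys x))"
      by (intro image_mset_cong) (auto simp: in_keys_iff)
    finally show ?thesis using that
      by (simp add: image_mset_const_eq card_Diff_subset)
  qed
  have "Poly_Mapping.keys x \<subseteq> {..<M}" "Poly_Mapping.keys y \<subseteq> {..<M}"
    using M1(2) M2(2) by (auto simp: M_def)
  then have "mset (?l y) = mset (?l x)" by (simp only: mset_l assms)
  then obtain p where p: "p permutes {..<length (?l x)}" "permute_list p (?l x) = ?l y"
    by (rule mset_eq_permutation)
  have "bij p" using p(1) by (rule permutes_bij)
  moreover have "Poly_Mapping.map_key p x = y"
  proof (rule poly_mapping_eqI)
    fix i
    have "Poly_Mapping.lookup x (p i) = Poly_Mapping.lookup y i"
    proof (cases "i < M")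
      case True
      then have "p i < M" using permutes_in_image[OF p(1), of i] by simp
      then show ?thesis using permute_list_nth[OF p(1), of i] True p(2) by simp
    next
      case False
      then have "p i = i" using p(1) by (simp add: permutes_def)
      then show ?thesis using False M1(1)[of i] M2(1)[of i] by (simp add: M_def)
    qed
    then show "Poly_Mapping.lookup (Poly_Mapping.map_key p x) i = Poly_Mapping.lookup y i"
      by (simp add: map_key.rep_eq[OF permutes_inj[OF p(1)]])
  qed
  ultimately show ?thesis by (rule that)
qed

lemma bij_invariant_eq:
  assumes "\<And>\<pi> x. bij \<pi> \<Longrightarrow> f (Poly_Mapping.map_key \<pi> x) = f x" "part_mset x = part_mset y"
  shows "f x = f y"
  using part_mset_rearrange[OF assms(2)] assms(1) by metis

lemma obtain_partition:
  obtains la where "is_partition la" "mset la = part_mset x"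
  using is_partition_rev_sort[OF zero_notin_part_mset[of x]]
  by (metis mset_rev mset_sorted_list_of_multiset)

text \<open>Each monomial occurs in exactly one monomial symmetric function, so the coordinates are
  values of \<open>f\<close>. The degree bound in \<open>symmetric_function\<close> makes the
  expansion finite.\<close>

lemma coords_monomial:
  fixes f :: "'a::idom series"
  assumes "symmetric_function f" "is_partition la"
  shows "coords monomial_sym f la = f (Poly_Mapping.nth la)"
proof -
  let ?c = "\<lambda>la. if is_partition la then f (Poly_Mapping.nth la) else 0"
  obtain d where d: "\<And>x. f x \<noteq> 0 \<Longrightarrow> mdeg x \<le> d"
    using assms(1) by (auto simp: symmetric_function_def)
  have m: "monomial_sym la (Poly_Mapping.nth mu) = (if mu = la then 1 else 0 :: 'a)"
    if "is_partition la" "is_partition mu" for la mu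
    using is_partition_mset_eq[OF that(2,1)] unfolding monomial_sym_def part_mset_nth[OF that(2)] by auto
  have "has_expansion monomial_sym ?c f"
  proof (rule has_expansionI)
    let ?A = "\<Union>n\<in>{..d}. partitions n"
    show finA: "finite ?A" using finite_partitions by blast
    show c0: "?c mu = 0" if "mu \<notin> ?A" for mu
    proof (rule ccontr)
      assume *: "?c mu \<noteq> 0"
      then have "mdeg (Poly_Mapping.nth mu) \<le> d" "is_partition mu" using d by (auto split: if_splits)
      then show False using that by (auto simp: mdeg_eq part_mset_nth sum_mset_sum_list)
    qed
    fix x
    obtain la where la: "is_partition la" "mset la = part_mset x" by (rule obtain_partition)
    have fx: "f x = f (Poly_Mapping.nth la)"
      by (rule bij_invariant_eq[of f])
        (use assms(1) la in \<open>auto simp: symmetric_function_def part_mset_nth\<close>)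
    have "(\<Sum>mu\<in>?A. ?c mu * monomial_sym mu x) = (\<Sum>mu\<in>?A. if mu = la then ?c la else 0)"
    proof (intro sum.cong refl)
      fix mu assume "mu \<in> ?A"
      then have "is_partition mu" by auto
      then have "monomial_sym mu x = (if mu = la then 1 else 0 :: 'a)"
        using is_partition_mset_eq[OF la(1)] unfolding monomial_sym_def la(2)[symmetric] by auto
      then show "?c mu * monomial_sym mu x = (if mu = la then ?c la else 0)" by simp
    qed
    also have "\<dots> = ?c la" using finA c0[of la] by (simp only: sum.delta split: if_splits) auto
    finally show "f x = (\<Sum>mu\<in>?A. ?c mu * monomial_sym mu x)" using fx la by simp
  qed auto
  then have "coords monomial_sym f = ?c"
  proof (rule coords_eqI)
    fix c' assume c': "has_expansion monomial_sym c' f"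
    show "c' = ?c"
      by (rule has_expansion_unique[where pt = Poly_Mapping.nth and r = "\<lambda>_. 0", OF _ _ c' \<open>has_expansion monomial_sym ?c f\<close>])
        (auto simp: m split: if_splits)
  qed
  then show ?thesis using assms(2) by simp
qed

section \<open>Power sums as a basis in each degree\<close>

lemma power_sum_triangular:
  assumes "is_partition la" "is_partition mu" "power_sum mu (Poly_Mapping.nth la) \<noteq> (0 :: 'a::comm_semiring_1)"
  shows "sum_list la = sum_list mu \<and> (mu = la \<or> length la < length mu)"
proof -
  let ?x = "Poly_Mapping.nth la"
  have "card (Poly_Mapping.keys ?x) = size (part_mset ?x)" by simp
  then have "card (Poly_Mapping.keys ?x) = length la" unfolding part_mset_nth[OF assms(1)] by simp
  moreover have "mdeg ?x = sum_list la" unfolding mdeg_eq part_mset_nth[OF assms(1)] by (rule sum_mset_sum_list)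
  moreover have "0 \<notin> set mu" using assms(2) by (simp add: is_partition_def)
  ultimately have "sum_list la = sum_list mu" "length la \<le> length mu"
      "length la = length mu \<longrightarrow> mset la = mset mu"
    using power_sum_nonzero[OF assms(3)] unfolding part_mset_nth[OF assms(1)] by metis+
  then show ?thesis using is_partition_mset_eq[OF assms(1,2)] by (metis le_neq_implies_less)
qed

lemma power_sum_diagonal:
  assumes "is_partition la"
  shows "power_sum la (Poly_Mapping.nth la) \<noteq> (0 :: 'a::linordered_idom)"
proof -
  have "0 < (power_sum la (Poly_Mapping.nth la) :: 'a)"
    using assms by (intro power_sum_pos part_mset_nth) (auto simp: is_partition_def)
  then show ?thesis by simp
qed

lemma power_sum_expansion_unique:
  fixes f :: "'a::linordered_idom series"
  assumes "has_expansion power_sum c f" "has_expansion power_sum c' f"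
  shows "c = c'"
proof (rule has_expansion_unique[OF _ _ assms])
  fix la mu assume "is_partition la" "is_partition mu" "power_sum mu (Poly_Mapping.nth la) \<noteq> (0 :: 'a)"
  then show "mu = la \<or> - int (length mu) < - int (length la)"
    using power_sum_triangular by fastforce
qed (rule power_sum_diagonal)

lemma coords_power_sum:
  fixes f :: "'a::linordered_idom series"
  assumes "has_expansion power_sum c f"
  shows "coords power_sum f = c"
  by (rule coords_eqI[OF assms]) (rule power_sum_expansion_unique[OF _ assms])

text \<open>Uniqueness of coordinates says that the square matrix of values of power sums at
  partitions has trivial kernel, so the system is solvable for every right-hand side. By symmetry,
  agreement at partitions extends to all monomials; \<open>eq_all\<close> states this and is applied
  to 0 and to \<open>f\<close>.\<close>

lemma ex_power_sum_expansion:
  fixes f :: "'a::linordered_field series"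
  assumes sym: "\<And>\<pi> x. bij \<pi> \<Longrightarrow> f (Poly_Mapping.map_key \<pi> x) = f x"
    and deg: "\<And>x. f x \<noteq> 0 \<Longrightarrow> mdeg x = n"
  shows "\<exists>c. has_expansion power_sum c f \<and> (\<forall>la. la \<notin> partitions n \<longrightarrow> c la = 0)"
proof -
  let ?P = "partitions n"
  note fin = finite_partitions[of n]
  let ?M = "\<lambda>mu la. power_sum mu (Poly_Mapping.nth la) :: 'a"
  have eq_all: "g x = (\<Sum>mu\<in>?P. c mu * power_sum mu x)"
    if "\<And>\<pi> x. bij \<pi> \<Longrightarrow> g (Poly_Mapping.map_key \<pi> x) = g x" "\<And>x. g x \<noteq> 0 \<Longrightarrow> mdeg x = n"
      "\<forall>la\<in>?P. (\<Sum>mu\<in>?P. c mu * ?M mu la) = g (Poly_Mapping.nth la)" for g c x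
  proof (cases "mdeg x = n")
    case True
    obtain la where la: "is_partition la" "mset la = part_mset x" by (rule obtain_partition)
    then have x: "part_mset x = part_mset (Poly_Mapping.nth la)" by (simp add: part_mset_nth)
    have "la \<in> ?P" using la True by (simp add: mdeg_eq[symmetric] sum_mset_sum_list[symmetric])
    moreover have "power_sum mu x = ?M mu la" if "mu \<in> ?P" for mu
      by (rule bij_invariant_eq[OF power_sum_map_key x]) (use that in \<open>auto simp: is_partition_def\<close>)
    ultimately show ?thesis using bij_invariant_eq[of g, OF that(1) x] that(3) by simp
  next
    case False
    then have "power_sum mu x = (0 :: 'a)" if "mu \<in> ?P" for mu
      using power_sum_nonzero[of mu x] that by (auto simp: is_partition_def)
    moreover have "g x = 0" using that(2)[of x] False by blast
    ultimately show ?thesis by simp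
  qed
  have "\<exists>c. \<forall>la\<in>?P. (\<Sum>mu\<in>?P. c mu * ?M mu la) = f (Poly_Mapping.nth la)"
  proof (rule square_system_solvable[OF fin])
    fix c assume c: "\<And>la. la \<in> ?P \<Longrightarrow> (\<Sum>mu\<in>?P. c mu * ?M mu la) = 0"
    let ?c = "\<lambda>mu. if mu \<in> ?P then c mu else 0"
    have "0 = (\<Sum>mu\<in>?P. c mu * power_sum mu x)" for x
      by (rule eq_all[of "\<lambda>_. 0"]) (use c in auto)
    then have "has_expansion power_sum ?c (\<lambda>_. 0)" by (intro has_expansionI[OF fin]) auto
    moreover have "has_expansion power_sum (\<lambda>_. 0) (\<lambda>_. 0 :: 'a)" by (simp add: has_expansion_def)
    ultimately have "?c = (\<lambda>_. 0)" by (rule power_sum_expansion_unique)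
    then show "\<forall>mu\<in>?P. c mu = 0" by (metis (no_types, lifting))
  qed
  then obtain c where c: "\<forall>la\<in>?P. (\<Sum>mu\<in>?P. c mu * ?M mu la) = f (Poly_Mapping.nth la)" by blast
  have "has_expansion power_sum (\<lambda>mu. if mu \<in> ?P then c mu else 0) f"
    by (rule has_expansionI[OF fin]) (use eq_all[OF sym deg c] in auto)
  then show ?thesis by (intro exI[of _ "\<lambda>mu. if mu \<in> ?P then c mu else 0"]) simp
qed

text \<open>Polynomials are ordered by the sign of the leading coefficient, and fractions
  accordingly. Positivity of \<alpha> makes all weights of the form positive in
  \<open>jack_row\<close>.\<close>

lemma alpha_pos: "0 < alpha"
proof -
  have "0 < ([:0, 1:] :: rat poly)" by (simp add: less_poly_def pos_poly_pCons)
  then show ?thesis by (simp add: alpha_def to_fract_def zero_less_Fract_iff)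
qed

lemma jack_row:
  assumes J: "integral_jack_family J" and n: "n \<ge> 1"
  shows "J [n] x = (if mdeg x = n then fact n * alpha ^ n * binomial_coeff_prod (1 / alpha) x else 0)"
proof -
  let ?P = "partitions n"
  note fin = finite_partitions[of n]
  have sym: "symmetric_function (J mu)" if "mu \<in> ?P" for mu
    using J that by (simp add: integral_jack_family_def)
  then have inv: "J mu (Poly_Mapping.map_key \<pi> x) = J mu x" if "mu \<in> ?P" "bij \<pi>" for mu \<pi> x
    using that by (simp add: symmetric_function_def)
  have tri: "dominance_le la mu" if "mu \<in> ?P" "is_partition la" "J mu (Poly_Mapping.nth la) \<noteq> 0" for mu la
    using J that coords_monomial[OF sym] unfolding integral_jack_family_def by auto
  have ones: "is_partition (replicate n 1)" by (simp add: is_partition_def sorted_wrt_iff_nth_less)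
  have norm: "J mu (Poly_Mapping.nth (replicate n 1)) = fact n" if "mu \<in> ?P" for mu
    using J that coords_monomial[OF sym[OF that] ones] unfolding integral_jack_family_def by auto
  \<comment> \<open>Dominance relates only partitions of equal size, so triangularity already forces
    homogeneity.\<close>
  have deg: "mdeg x = n" if "mu \<in> ?P" "J mu x \<noteq> 0" for mu x
  proof -
    obtain la where la: "is_partition la" "mset la = part_mset x" by (rule obtain_partition)
    then have "J mu x = J mu (Poly_Mapping.nth la)"
      using bij_invariant_eq[of "J mu", OF inv[OF that(1)]] part_mset_nth[of la] by metis
    then have "sum_list la = sum_list mu" using tri[OF that(1) la(1)] that(2) by (simp add: dominance_le_def)
    then show ?thesis using that(1) la by (simp add: mdeg_eq flip: sum_mset_sum_list)
  qed
  \<comment> \<open>Among the partitions of n only \<open>[n]\<close> dominates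
    \<open>[n]\<close>.\<close>
  have row: "J mu (Poly_Mapping.single 0 n) = 0" if mu: "mu \<in> ?P" "mu \<noteq> [n]" for mu
  proof (rule ccontr)
    assume "J mu (Poly_Mapping.single 0 n) \<noteq> 0"
    then have "dominance_le [n] mu"
      using tri[OF mu(1), of "[n]"] n by (simp add: is_partition_def nth_singleton)
    then have "sum_list (take 1 [n]) \<le> sum_list (take 1 mu)" by (simp only: dominance_le_def)
    then show False using mu n by (cases mu) (auto simp: is_partition_def neq_Nil_conv)
  qed
  have "\<forall>mu\<in>?P. \<exists>c. has_expansion power_sum c (J mu) \<and> (\<forall>la. la \<notin> ?P \<longrightarrow> c la = 0)"
  proof
    fix mu assume "mu \<in> ?P"
    then show "\<exists>c. has_expansion power_sum c (J mu) \<and> (\<forall>la. la \<notin> ?P \<longrightarrow> c la = 0)"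
      using inv deg by (intro ex_power_sum_expansion) blast+
  qed
  from bchoice[OF this] obtain C
    where "\<forall>mu\<in>?P. has_expansion power_sum (C mu) (J mu) \<and> (\<forall>la. la \<notin> ?P \<longrightarrow> C mu la = 0)" ..
  then have C: "\<And>mu. mu \<in> ?P \<Longrightarrow> has_expansion power_sum (C mu) (J mu)"
      "\<And>mu la. mu \<in> ?P \<Longrightarrow> la \<notin> ?P \<Longrightarrow> C mu la = 0"
    by blast+
  have expand: "g x = (\<Sum>la\<in>?P. c la * power_sum la x)"
    if "has_expansion power_sum c g" "\<And>la. la \<notin> ?P \<Longrightarrow> c la = 0" for c and g :: "rat_fun series" and x
  proof -
    have "g x = (\<Sum>la | c la \<noteq> 0. c la * power_sum la x)"
      using that(1) unfolding has_expansion_def by metis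
    also have "\<dots> = (\<Sum>la\<in>?P. c la * power_sum la x)"
      by (rule sum.mono_neutral_left[OF fin]) (use that(2) in auto)
    finally show ?thesis .
  qed
  define w :: "nat list \<Rightarrow> rat_fun" where "w la = of_nat (z_num la) * alpha ^ length la" for la
  have w_pos: "0 < w la" if "la \<in> ?P" for la
    using that z_num_pos[of la] alpha_pos by (simp add: w_def is_partition_def)
  define B where "B c d = (\<Sum>la\<in>?P. c la * d la * w la)" for c d
  have orth: "B (C mu) (C nu) = 0" if "mu \<in> ?P" "nu \<in> ?P" "mu \<noteq> nu" for mu nu
  proof -
    have "0 = alpha_product (J mu) (J nu)" using J that by (simp add: integral_jack_family_def)
    also have "\<dots> = (\<Sum>la | C mu la \<noteq> 0. C mu la * C nu la * w la)"
      unfolding alpha_product_def coords_power_sum[OF C(1)[OF that(1)]]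
        coords_power_sum[OF C(1)[OF that(2)]] w_def ..
    also have "\<dots> = B (C mu) (C nu)"
      unfolding B_def by (rule sum.mono_neutral_left[OF fin]) (use C(2)[OF that(1)] in auto)
    finally show ?thesis ..
  qed
  \<comment> \<open>The norm is a sum of squares with positive weights, so if it vanished then so
    would \<open>J mu\<close>, against its normalised coefficient \<open>fact n\<close>.\<close>
  have norm_pos: "B (C mu) (C mu) \<noteq> 0" if mu: "mu \<in> ?P" for mu
  proof
    assume "B (C mu) (C mu) = 0"
    moreover have "0 \<le> C mu la * C mu la * w la" if "la \<in> ?P" for la
      using w_pos[OF that] by simp
    ultimately have "\<forall>la\<in>?P. C mu la * C mu la * w la = 0"
      unfolding B_def using sum_nonneg_eq_0_iff[OF fin, of "\<lambda>la. C mu la * C mu la * w la"] by blast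
    then have "C mu la = 0" if "la \<in> ?P" for la using that w_pos[OF that] by fastforce
    then have "J mu x = 0" for x using expand[OF C(1)[OF mu] C(2)[OF mu]] by simp
    then show False using norm[OF mu] by simp
  qed
  have B_sum: "B (\<lambda>i. \<Sum>mu\<in>?P. a mu * C mu i) (C nu) = a nu * B (C nu) (C nu)" if "nu \<in> ?P" for a nu
  proof -
    have "B (\<lambda>i. \<Sum>mu\<in>?P. a mu * C mu i) (C nu) = (\<Sum>mu\<in>?P. a mu * B (C mu) (C nu))"
      unfolding B_def sum_distrib_right sum_distrib_left by (subst sum.swap) (simp only: mult.assoc)
    also have "\<dots> = (\<Sum>mu\<in>?P. if mu = nu then a nu * B (C nu) (C nu) else 0)"
      using orth that by (intro sum.cong) auto
    finally show ?thesis using fin that by simp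
  qed
  \<comment> \<open>Power sum coordinates of the dual element. Its coefficient at x_0 ... x_(n-1) is
    \<open>(1 / alpha) ^ n\<close>, and the factor \<open>fact n * alpha ^ n\<close> adjusts it to
    the Jack normalisation.\<close>
  define cG where "cG la = (if la \<in> ?P then fact n * alpha ^ n * ((1 / alpha) ^ length la / of_nat (z_num la)) else 0)" for la
  have "\<exists>a. \<forall>i\<in>?P. (\<Sum>mu\<in>?P. a mu * C mu i) = cG i"
  proof (rule square_system_solvable[OF fin])
    fix a assume a: "\<And>i. i \<in> ?P \<Longrightarrow> (\<Sum>mu\<in>?P. a mu * C mu i) = 0"
    have "B (\<lambda>i. \<Sum>mu\<in>?P. a mu * C mu i) d = 0" for d unfolding B_def by (simp add: a)
    then show "\<forall>nu\<in>?P. a nu = 0" using B_sum norm_pos by (metis (no_types, lifting) mult_eq_0_iff)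
  qed
  then obtain a where a: "\<And>i. i \<in> ?P \<Longrightarrow> (\<Sum>mu\<in>?P. a mu * C mu i) = cG i" by blast
  have a0: "a nu = 0" if nu: "nu \<in> ?P" "nu \<noteq> [n]" for nu
  proof -
    have "a nu * B (C nu) (C nu) = B cG (C nu)"
      using B_sum[OF nu(1), of a] a by (simp add: B_def)
    \<comment> \<open>The weight of the form cancels the coordinate of the dual element, leaving the
      plain sum of the coordinates of \<open>J nu\<close>.\<close>
    also have "\<dots> = (\<Sum>la\<in>?P. fact n * alpha ^ n * C nu la)"
      unfolding B_def
    proof (intro sum.cong refl)
      fix la assume la: "la \<in> ?P"
      then have "of_nat (z_num la) \<noteq> (0 :: rat_fun)" "alpha \<noteq> 0"
        using z_num_pos[of la] alpha_pos by (auto simp: is_partition_def)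
      then show "cG la * C nu la * w la = fact n * alpha ^ n * C nu la"
        using la by (simp add: cG_def w_def power_one_over)
    qed
    also have "\<dots> = fact n * alpha ^ n * (\<Sum>la\<in>?P. C nu la * power_sum la (Poly_Mapping.single 0 n))"
      unfolding sum_distrib_left[symmetric]
      by (intro arg_cong[of _ _ "(*) _"] sum.cong) (auto simp: power_sum_one_variable is_partition_def)
    also have "\<dots> = 0" using expand[OF C(1)[OF nu(1)] C(2)[OF nu(1)]] row[OF nu] by simp
    finally show ?thesis using norm_pos[OF nu(1)] by simp
  qed
  have n_P: "[n] \<in> ?P" using n by (simp add: is_partition_def)
  have cG_eq: "cG i = a [n] * C [n] i" if "i \<in> ?P" for i
  proof -
    have "cG i = (\<Sum>mu\<in>?P. if mu = [n] then a [n] * C [n] i else 0)"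
      unfolding a[OF that, symmetric] using a0 by (intro sum.cong) auto
    then show ?thesis using fin n_P by simp
  qed
  have G: "(if mdeg x = n then fact n * alpha ^ n * binomial_coeff_prod (1 / alpha) x else 0) = a [n] * J [n] x" for x
  proof -
    have "a [n] * J [n] x = (\<Sum>la\<in>?P. a [n] * C [n] la * power_sum la x)"
      using expand[OF C(1)[OF n_P] C(2)[OF n_P]] by (simp add: sum_distrib_left mult.assoc)
    also have "\<dots> = (\<Sum>la\<in>?P. fact n * alpha ^ n * ((1 / alpha) ^ length la / of_nat (z_num la) * power_sum la x))"
    proof (intro sum.cong refl)
      fix la assume "la \<in> ?P"
      then show "a [n] * C [n] la * power_sum la x =
          fact n * alpha ^ n * ((1 / alpha) ^ length la / of_nat (z_num la) * power_sum la x)"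
        unfolding cG_eq[OF \<open>la \<in> ?P\<close>, symmetric] cG_def by (simp only: if_True mult.assoc)
    qed
    also have "\<dots> = fact n * alpha ^ n * power_sum_series (1 / alpha) n x"
      unfolding power_sum_series_def sum_distrib_left ..
    finally show ?thesis by (simp add: power_sum_series_eq)
  qed
  have "a [n] = 1"
  proof -
    let ?x = "Poly_Mapping.nth (replicate n 1) :: nat \<Rightarrow>\<^sub>0 nat"
    have keys: "Poly_Mapping.keys ?x = {..<n}" by (auto simp: in_keys_iff nth_default_def lookup_nth split: if_splits)
    have "Poly_Mapping.lookup ?x i = 1" if "i < n" for i using that by (simp add: nth_default_def lookup_nth)
    then have "mdeg ?x = n" "binomial_coeff_prod (1 / alpha) ?x = (1 / alpha) ^ n" unfolding keys by auto
    then have "fact n = a [n] * fact n" using G[of ?x] norm[OF n_P] alpha_pos by (simp add: power_one_over)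
    then show ?thesis by simp
  qed
  then show ?thesis using G[of x] by simp
qed

section \<open>Evaluation of coefficients at 1/\<alpha>\<close>

lemma rat_eval_pCons:
  "poly (map_poly of_rat (pCons a p)) t = of_rat a + t * poly (map_poly of_rat p) t"
  for t :: "'a::field_char_0"
  by (simp add: map_poly_pCons)

lemma rat_eval_add:
  "poly (map_poly of_rat (p + q)) t = poly (map_poly of_rat p) t + poly (map_poly of_rat q) t"
  for t :: "'a::field_char_0"
  by (induction p q rule: poly_induct2) (auto simp: rat_eval_pCons of_rat_add algebra_simps)

lemma rat_eval_smult:
  "poly (map_poly of_rat (smult a p)) t = of_rat a * poly (map_poly of_rat p) t"
  for t :: "'a::field_char_0"
  by (induction p) (auto simp: rat_eval_pCons of_rat_mult algebra_simps)

lemma rat_eval_mult: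
  "poly (map_poly of_rat (p * q)) t = poly (map_poly of_rat p) t * poly (map_poly of_rat q) t"
  for t :: "'a::field_char_0"
  by (induction p) (auto simp: rat_eval_pCons rat_eval_add rat_eval_smult mult_pCons_left algebra_simps)

lemma rat_eval_of_nat: "poly (map_poly of_rat (of_nat k)) t = of_nat k"
  for t :: "'a::field_char_0"
  by (simp add: of_nat_poly rat_eval_pCons)

lemma rat_eval_prod:
  "poly (map_poly of_rat (\<Prod>i\<in>A. p i)) t = (\<Prod>i\<in>A. poly (map_poly of_rat (p i)) t)"
  for t :: "'a::field_char_0"
  by (induction A rule: infinite_finite_induct) (auto simp: rat_eval_mult map_poly_1)

lemma to_fract_prod: "to_fract (\<Prod>i\<in>A. p i) = (\<Prod>i\<in>A. to_fract (p i))"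
  by (induction A rule: infinite_finite_induct) auto

text \<open>A polynomial is represented with denominator 1, so the substitution becomes plain
  evaluation, which is multiplicative. Coefficients of \<open>J [n]\<close> are brought into this
  form for that reason.\<close>

lemma subst_alpha_to_fract: "subst_alpha t (to_fract p) = poly (map_poly of_rat p) t"
  by (simp add: subst_alpha_def map_poly_1)

lemma to_fract_of_nat: "to_fract (of_nat k) = of_nat k"
  by (induction k) simp_all

text \<open>The rising factorial of 1/\<alpha> over m!, with denominators cleared by \<alpha>^m; the
  variable of the polynomial stands for \<alpha>.\<close>

definition rising_poly :: "nat \<Rightarrow> rat poly" where
  "rising_poly m = [:1 / fact m:] * (\<Prod>j<m. [:1, of_nat j:])"

lemma to_fract_rising_poly:
  "to_fract (rising_poly m) = alpha ^ m * (pochhammer (1 / alpha) m / fact m)"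
proof -
  have alpha: "alpha \<noteq> 0" using alpha_pos by simp
  have lin: "to_fract [:1, of_nat j:] = alpha * (1 / alpha + of_nat j)" for j
  proof -
    have "[:1, of_nat j:] = 1 + [:0, 1:] * (of_nat j :: rat poly)" by (simp add: of_nat_poly one_pCons)
    then have "to_fract [:1, of_nat j:] = 1 + alpha * of_nat j"
      unfolding alpha_def by (metis to_fract_1 to_fract_add to_fract_mult to_fract_of_nat)
    then show ?thesis using alpha by (simp add: distrib_left)
  qed
  have "to_fract [:1 / fact m:] * fact m = (1 :: rat_fun)"
  proof -
    have "[:1 / fact m:] * of_nat (fact m) = (1 :: rat poly)" by (simp add: of_nat_poly one_pCons)
    then show ?thesis by (metis of_nat_fact to_fract_1 to_fract_mult to_fract_of_nat)
  qed
  then have "to_fract [:1 / fact m:] = (1 / fact m :: rat_fun)" by (simp add: field_simps)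
  then show ?thesis
    unfolding rising_poly_def to_fract_mult to_fract_prod lin prod.distrib
    by (simp add: pochhammer_prod atLeast0LessThan)
qed

lemma rat_eval_rising_poly:
  "poly (map_poly of_rat (rising_poly m)) (1 / alpha) = pochhammer alpha m / fact m / alpha ^ m"
proof -
  have alpha: "alpha \<noteq> 0" using alpha_pos by simp
  have lin: "poly (map_poly of_rat [:1, of_nat j:]) (1 / alpha) = (alpha + of_nat j) / alpha" for j
    using alpha by (simp add: rat_eval_pCons add_divide_distrib)
  have "poly (map_poly of_rat [:1 / fact m:]) (1 / alpha) = 1 / fact m"
    using of_rat_of_nat_eq[of "fact m", where 'a = rat_fun] by (simp add: rat_eval_pCons of_rat_divide)
  then show ?thesis
    unfolding rising_poly_def rat_eval_mult rat_eval_prod lin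
    by (simp add: prod_dividef pochhammer_prod atLeast0LessThan)
qed

lemma J_tilde_row:
  assumes J: "integral_jack_family J" and n: "n \<ge> 1"
  shows "J_tilde J [n] = (\<lambda>x. if mdeg x = n then fact n * binomial_coeff_prod alpha x else 0)"
proof
  fix x :: "nat \<Rightarrow>\<^sub>0 nat"
  let ?K = "Poly_Mapping.keys x" and ?x = "Poly_Mapping.lookup x"
  have alpha: "alpha \<noteq> 0" using alpha_pos by simp
  show "J_tilde J [n] x = (if mdeg x = n then fact n * binomial_coeff_prod alpha x else 0)"
  proof (cases "mdeg x = n")
    case True
    \<comment> \<open>As n is the total degree, \<alpha>^n splits into one power per variable. This
      clears the denominators of \<open>J [n]\<close> before the substitution and cancels the powers
      that the substitution produces.\<close>
    have pow: "alpha ^ n = (\<Prod>i\<in>?K. alpha ^ ?x i)" unfolding True[symmetric] by (rule power_sum)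
    have Jx: "J [n] x = to_fract (of_nat (fact n) * (\<Prod>i\<in>?K. rising_poly (?x i)))"
      unfolding jack_row[OF assms] to_fract_mult to_fract_of_nat to_fract_prod to_fract_rising_poly prod.distrib
      using True by (simp add: pow)
    have "J_tilde J [n] x = alpha ^ n * (fact n * (\<Prod>i\<in>?K. pochhammer alpha (?x i) / fact (?x i) / alpha ^ ?x i))"
      unfolding J_tilde_def Jx subst_alpha_to_fract rat_eval_mult rat_eval_prod rat_eval_rising_poly
        rat_eval_of_nat by simp
    also have "\<dots> = fact n * binomial_coeff_prod alpha x"
      using alpha by (simp add: prod_dividef pow prod.distrib)
    finally show ?thesis using True by simp
  next
    case False
    then have "J [n] x = to_fract 0" by (simp add: jack_row[OF assms])
    then show ?thesis using False by (simp only: J_tilde_def subst_alpha_to_fract) simp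
  qed
qed

text \<open>The contents of a diagram form an interval containing 0, so consecutive values of
  \<open>\<kappa>\<close> differ by at most 1.\<close>

lemma content_sequence:
  fixes \<kappa> :: "nat \<Rightarrow> int"
  assumes D: "young D" and n: "card D = n" "n \<ge> 1"
    and img: "\<kappa> ` {1..n} = (\<lambda>(i, j). int i - int j) ` D"
    and anti: "\<And>i j. 1 \<le> i \<Longrightarrow> i \<le> j \<Longrightarrow> j \<le> n \<Longrightarrow> \<kappa> j \<le> \<kappa> i"
  shows "0 \<le> \<kappa> 1" "\<kappa> n \<le> 0"
    and "\<And>i. 1 \<le> i \<Longrightarrow> i < n \<Longrightarrow> \<kappa> i \<le> \<kappa> (Suc i) + 1"
proof -
  have "D \<noteq> {}" using n by auto
  then obtain i0 j0 where "(i0, j0) \<in> D" by auto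
  then have "(1, 1) \<in> D" using young_down[OF D, of i0 j0 1 1] young_pos[OF D, of i0 j0] by simp
  then have "int 1 - int 1 \<in> \<kappa> ` {1..n}" unfolding img by force
  then obtain k0 where k0: "k0 \<in> {1..n}" "\<kappa> k0 = 0" by auto
  then show "0 \<le> \<kappa> 1" "\<kappa> n \<le> 0" using anti[of 1 k0] anti[of k0 n] by auto
  fix i assume i: "1 \<le> i" "i < n"
  show "\<kappa> i \<le> \<kappa> (Suc i) + 1"
  proof (rule ccontr)
    assume gap: "\<not> \<kappa> i \<le> \<kappa> (Suc i) + 1"
    have no: "\<not> (\<kappa> (Suc i) < \<kappa> k \<and> \<kappa> k < \<kappa> i)" if "k \<in> {1..n}" for k
      using anti[of k i] anti[of "Suc i" k] that i by (cases "k \<le> i") auto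
    \<comment> \<open>A cell of nonzero content has a neighbour, to the left or below, whose content
      is one step closer to 0.\<close>
    have toward: "v - sgn v \<in> \<kappa> ` {1..n}" if "v \<in> \<kappa> ` {1..n}" for v
    proof -
      obtain a b where ab: "(a, b) \<in> D" "v = int a - int b" using \<open>v \<in> \<kappa> ` {1..n}\<close> unfolding img by auto
      note pos = young_pos[OF D ab(1)]
      consider "v = 0" | "0 < v" | "v < 0" by linarith
      then show ?thesis
      proof cases
        case 2
        then have "1 \<le> a - 1" using ab pos by linarith
        then have "(a - 1, b) \<in> D" using young_down[OF D ab(1), of "a - 1" b] pos by simp
        moreover have "v - sgn v = int (a - 1) - int b" using 2 ab pos by simp
        ultimately show ?thesis unfolding img by force
      next
        case 3
        then have "1 \<le> b - 1" using ab pos by linarith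
        then have "(a, b - 1) \<in> D" using young_down[OF D ab(1), of a "b - 1"] pos by simp
        moreover have "v - sgn v = int a - int (b - 1)" using 3 ab pos by simp
        ultimately show ?thesis unfolding img by force
      qed (use that in simp)
    qed
    have "\<kappa> i - sgn (\<kappa> i) \<in> \<kappa> ` {1..n}" "\<kappa> (Suc i) - sgn (\<kappa> (Suc i)) \<in> \<kappa> ` {1..n}"
      using toward i by auto
    then obtain k l where kl: "k \<in> {1..n}" "\<kappa> k = \<kappa> i - sgn (\<kappa> i)"
      "l \<in> {1..n}" "\<kappa> l = \<kappa> (Suc i) - sgn (\<kappa> (Suc i))" by force
    \<comment> \<open>The step towards 0 lands strictly inside the gap: from
      \<open>\<kappa> i\<close> if that is positive, and otherwise from
      \<open>\<kappa> (Suc i)\<close>, which is then negative.\<close>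
    show False using no[OF kl(1)] no[OF kl(3)] kl(2,4) gap by (auto simp: sgn_if split: if_splits)
  qed
qed

theorem theorem3p11:
  fixes n :: nat and la :: "nat list" and \<kappa> c :: "nat \<Rightarrow> int"
    and J :: "nat list \<Rightarrow> rat_fun series"
  assumes "integral_jack_family J"
    and "n \<ge> 1"
    and "is_partition la" and "sum_list la = n"
    and "image_mset \<kappa> (mset_set {1..n}) =
         image_mset (\<lambda>(i, j). int i - int j) (mset_set (diagram la))"
    and "\<And>i j. 1 \<le> i \<Longrightarrow> i \<le> j \<Longrightarrow> j \<le> n \<Longrightarrow> \<kappa> j \<le> \<kappa> i"
    and "\<And>i. 1 \<le> i \<Longrightarrow> i \<le> n \<Longrightarrow> c i = \<kappa> i + int i - 1"
  shows "(\<Prod>(i, j)\<in>diagram la. alpha + of_nat i - of_nat j) =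
         (\<Prod>i=1..n. alpha + of_int (c i) - of_nat i + 1)
       \<and> 0 \<le> c 1 \<and> (\<forall>i j. 1 \<le> i \<and> i \<le> j \<and> j \<le> n \<longrightarrow> c i \<le> c j) \<and> c n \<le> int n
       \<and> hall (J_tilde J [n]) (schur la) =
         (\<Sum>k=0..n. of_nat (card (SYT la)) * of_nat (hit_number n (ferrers_board n c) k)
            * ((alpha + of_nat k) gchoose n))
       \<and> (\<Sum>k=0..n. of_nat (card (SYT la)) * of_nat (hit_number n (ferrers_board n c) k)
            * ((alpha + of_nat k) gchoose n)) =
         (\<Sum>k=0..n. of_nat (card (SYT la)) * of_nat (rook_number (ferrers_board n c) (n - k))
            * (alpha gchoose k) * fact k)"
proof -
  let ?D = "diagram la"
  note D = young_diagram[OF assms(3)]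
  have card: "card ?D = n" using assms(4) by (simp add: card_diagram)
  have img: "\<kappa> ` {1..n} = (\<lambda>(i, j). int i - int j) ` ?D"
    using arg_cong[OF assms(5), of set_mset] young_finite[OF D] by simp
  note seq = content_sequence[OF D card assms(2) img assms(6)]
  have c1: "0 \<le> c 1" and cn: "c n \<le> int n" using seq(1,2) assms(2,7) by auto
  \<comment> \<open>The index term of \<open>c\<close> rises by 1 at each step while \<kappa> falls
    by at most 1.\<close>
  have mono: "c i \<le> c j" if "1 \<le> i" "i \<le> j" "j \<le> n" for i j
    using that(2,3)
  proof (induction j rule: dec_induct)
    case (step j)
    then have "c i \<le> c j" "\<kappa> j \<le> \<kappa> (Suc j) + 1" using that(1) seq(3)[of j] by auto
    then show ?case using assms(7)[of j] assms(7)[of "Suc j"] step that(1) by simp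
  qed simp
  have prod: "(\<Prod>(i, j)\<in>?D. alpha + of_nat i - of_nat j) = (\<Prod>i=1..n. alpha + of_int (c i) - of_nat i + 1)"
  proof -
    have "(\<Prod>(i, j)\<in>?D. alpha + of_nat i - of_nat j) =
        prod_mset (image_mset (\<lambda>v. alpha + of_int v) (image_mset (\<lambda>(i, j). int i - int j) (mset_set ?D)))"
      by (simp add: prod_unfold_prod_mset multiset.map_comp comp_def case_prod_unfold algebra_simps)
    also have "\<dots> = (\<Prod>i=1..n. alpha + of_int (\<kappa> i))"
      unfolding assms(5)[symmetric] by (simp add: prod_unfold_prod_mset multiset.map_comp comp_def)
    also have "\<dots> = (\<Prod>i=1..n. alpha + of_int (c i) - of_nat i + 1)"
      by (intro prod.cong) (auto simp: assms(7))
    finally show ?thesis .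
  qed
  define h where "h i = nat (c i)" for i
  have c_nonneg: "0 \<le> c i" and c_le: "c i \<le> int n" if "1 \<le> i" "i \<le> n" for i
    using c1 cn mono[of 1 i] mono[of i n] that by auto
  have board: "ferrers_board n c = column_board n h"
  proof (intro set_eqI iffI)
    fix u assume "u \<in> ferrers_board n c"
    then show "u \<in> column_board n h" by (auto simp: ferrers_board_def h_def le_nat_iff)
  next
    fix u assume "u \<in> column_board n h"
    then obtain i j where u: "u = (i, j)" "1 \<le> i" "i \<le> n" "1 \<le> j" "j \<le> h i" by auto
    then have "int j \<le> c i" using c_nonneg[of i] by (simp add: h_def le_nat_iff)
    then show "u \<in> ferrers_board n c" using c_le[of i] u by (simp add: ferrers_board_def)
  qed
  have sub: "ferrers_board n c \<subseteq> {1..n} \<times> {1..n}" by (auto simp: ferrers_board_def)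
  let ?r = "\<lambda>k. of_nat (rook_number (ferrers_board n c) k) :: rat_fun"
  \<comment> \<open>\<open>(alpha gchoose k) * fact k\<close> is the falling factorial of length k;
    replacing k by n - k gives the form of \<open>sum_rook_number_falling\<close>.\<close>
  have "(\<Sum>k=0..n. ?r (n - k) * (alpha gchoose k) * fact k) =
      (\<Sum>k=0..n. ?r k * (\<Prod>i=0..<n - k. alpha - of_nat i))"
    by (rule sum.reindex_bij_witness[of _ "\<lambda>k. n - k" "\<lambda>k. n - k"])
      (auto simp: gbinomial_mult_fact' mult.assoc)
  also have "\<dots> = (\<Prod>i=1..n. alpha + of_nat (h i) - of_nat i + 1)"
    unfolding board by (rule sum_rook_number_falling) (use mono in \<open>auto simp: h_def intro: nat_mono\<close>)
  also have "\<dots> = (\<Prod>i=1..n. alpha + of_int (c i) - of_nat i + 1)"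
    using c_nonneg by (intro prod.cong) (auto simp: h_def of_nat_nat)
  finally have rook: "(\<Sum>k=0..n. ?r (n - k) * (alpha gchoose k) * fact k) =
      (\<Prod>i=1..n. alpha + of_int (c i) - of_nat i + 1)" .
  have hit: "(\<Sum>k=0..n. of_nat (hit_number n (ferrers_board n c) k) * ((alpha + of_nat k) gchoose n)) =
      (\<Sum>k=0..n. ?r (n - k) * (alpha gchoose k) * fact k)"
    by (rule sum_hit_number_gchoose[OF sub])
  \<comment> \<open>\<open>J_tilde_row\<close> and \<open>has_expansion_schur_content\<close>
    describe the same series, so the Hall product reads off its Schur coefficient at
    \<open>la\<close>.\<close>
  have "hall (J_tilde J [n]) (schur la) = content_coeff alpha ?D"
    unfolding J_tilde_row[OF assms(1,2)]
    using hall_schur[OF has_expansion_schur_content[of n alpha] assms(3)] assms(3,4) by simp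
  also have "\<dots> = of_nat (card (SYT la)) * (\<Prod>(i, j)\<in>?D. alpha + of_nat i - of_nat j)"
    by (simp add: content_coeff_def card_SYT[OF assms(3)] case_prod_unfold)
  finally have hall: "hall (J_tilde J [n]) (schur la) = of_nat (card (SYT la)) *
      (\<Sum>k=0..n. of_nat (hit_number n (ferrers_board n c) k) * ((alpha + of_nat k) gchoose n))"
    unfolding prod hit rook .
  show ?thesis
    using prod c1 mono cn hall hit by (simp add: sum_distrib_left[symmetric] mult.assoc)
qed

end
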